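(* (i) Let $n\ge3$. An arbitrary minimal NGT from the affine Weyl group $\widetilde W'$ of type $\widetilde C_n$ can be obtained as $\tilde w'$, $\tilde w''$ or $\tilde w^*$ as follows. Let $\tilde w$ be a $B$-positive minimal NGT of type $\widetilde B_n$ (with data $u,v,(p_j),(t_j)$). If no top parity correction is needed for $\tilde w$ (i.e. the total number of top reflections in $\tilde w$ is even), then $\tilde w'=\tilde w$ (considered as a $\widetilde C$-word) and, moreover, $\tilde w''=\imath_C(\tilde w)=s_0\tilde ws_0$ are minimal NGT of type $\widetilde C_n$. The element $\tilde w^*=\imath_B(\tilde w)$ is a minimal NGT if it has an even number of top reflections and the initial $\tilde w$ has at least two bottom horizontal lines ($v\ge2$); $\tilde w^*$ is involutive and coincides with $\imath_C(\tilde w^* )$. Otherwise, if the parity corrections are needed (the corresponding number of top reflections, in $\tilde w$ for $\tilde w',\tilde w''$ and in $\imath_B(\tilde w)$ for $\tilde w^*$, is odd), $\tilde w'=\tilde ws_0$ (the result of the top-right parity correction) is a minimal NGT of type $\widetilde C_n$. For the top-left correction, $\tilde w''=s_0\tilde w=\imath_C(\tilde w')=(\tilde w')^{-1}$, so such an element can be represented as $\tilde u'$ for a certain $B$-positive $\tilde u$. The element $\tilde w^*$, defined now as $\imath_B(\tilde w)s_0=s_0\imath_B(\tilde w)$, is a minimal NGT subject to the same constraint $v\ge2$. (ii) Let $n\ge4$. Minimal NGT of type $\widetilde D_n$ are given in terms of the $\widetilde C$-words $\tilde w',\tilde w'',\tilde w^*$ from part (i) as follows. If no bottom parity correction is needed,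 i.e. the total number of bottom reflections in the initial $\tilde w$ (the cases of $\tilde w'$ and $\tilde w''$) or in $\imath_B(\tilde w)$ (the case of $\tilde w^*$) is even, then each of these elements is a minimal NGT of type $\widetilde D_n$; here the existence of at least two horizontal lines near the bottom for $\tilde w$ ($v\ge2$) is required in the cases of $\tilde w'$ and $\tilde w''$. Otherwise, if the total number of bottom reflections for $\tilde w',\tilde w''$ or for $\tilde w^*$ is odd, then the elements $s_n\tilde w'=\tilde w's_n$ and $s_n\tilde w''=\tilde w''s_n$, as well as the elements $\tilde w^*s_n$ and $s_n\tilde w^*=(\tilde w^*s_n)^{-1}$, are minimal NGT of type $\widetilde D_n$; in the cases of $\tilde w',\tilde w''$ the configuration for $\tilde w$ is supposed to contain at least two horizontal lines near the bottom ($v\ge2$).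
   Context: **Type $\widetilde B_n$.** Roots $\pm\epsilon_i,\pm\epsilon_i\pm\epsilon_j$, $(\epsilon_i,\epsilon_j)=2\delta_{ij}$, $\alpha_i=\epsilon_i-\epsilon_{i+1}$ ($1\le i<n$), $\alpha_n=\epsilon_n$, $\alpha_0=[-\epsilon_1,1]$; $\widetilde W=W\ltimes\bigoplus\mathbb Z\epsilon_i$, $W$ the signed permutation group, generated by $s_0,\dots,s_n$. $\imath_B$ is the automorphism $s_i\mapsto s_{n-i}$ of $\widetilde W$. **Types $\widetilde C_n,\widetilde D_n$.** Roots $\pm2\epsilon_i,\pm\epsilon_i\pm\epsilon_j$ (resp. $\pm\epsilon_i\pm\epsilon_j$), $(\epsilon_i,\epsilon_j)=\delta_{ij}$, affine simple root $[-\epsilon_1-\epsilon_2,1]$. Their affine Weyl groups $\widetilde W'$ are identified with subgroups of $\widetilde W$ of type $\widetilde B_n$: $\widetilde W'(\widetilde C_n)$ has simple reflections $s_0'=s_0s_1s_0,s_1,\dots,s_n$; $\widetilde W'(\widetilde D_n)$ has simple reflections $s_0'=s_0s_1s_0,s_1,\dots,s_{n-1},s_n'=s_ns_{n-1}s_n$. The extended group of type $\widetilde C_n$ is $\widetilde W$ itself, with $s_0$ the length-zero generator; $\imath_C$ is conjugation by $s_0$ (the automorphism of the affine Dynkin diagram of $\widetilde C_n$ transposing $\alpha_0'=[-\epsilon_1-\epsilon_2,1]$ and $\alpha_1$). In general (twisted setting, form normalized by $(\alpha,\alpha)=2$ on short roots, $\nu_\alpha=(\alpha,\alpha)/2$):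 $\widetilde R=\{[\alpha,\nu_\alpha j]:\alpha\in R,j\in\mathbb Z\}$, $\widetilde R_+=R_+\cup\{[\alpha,\nu_\alpha j]:j>0\}$, and $(wb)([z,\zeta])=[w(z),\zeta-(z,b)]$ for $w$ in the Weyl group and a weight $b$. **Minimal NGT.** For an element of the affine Weyl group of a given type, $\lambda(\tilde w)=\widetilde R_+\cap\tilde w^{-1}(-\widetilde R_+)$ is ordered for a reduced decomposition $\tilde w=s_{i_l}\cdots s_{i_1}$ (in the simple reflections of that type) as $\alpha_{i_1},s_{i_1}(\alpha_{i_2}),\dots,s_{i_1}\cdots s_{i_{l-1}}(\alpha_{i_l})$. $\tilde w$ is a minimal NGT of that type if for every reduced decomposition this sequence begins with the same $\tilde\alpha$ and ends with the same $\tilde\beta$, and $\tilde\gamma=\tilde\alpha+\tilde\beta$ is a root, the nonaffine parts of $\tilde\alpha,\tilde\beta,\tilde\gamma$ having the same length. **Reflections.** For $\tilde w\in\widetilde W$ of type $\widetilde B_n$, the number of top (bottom) reflections is the number of occurrences of $s_0$ (respectively $s_n$) in a reduced decomposition of $\tilde w$ in $s_0,\dots,s_n$. (Geometrically, $\tilde w$ is represented by a configuration of $n$ zigzag lines reflecting in a top and a bottom mirror.) **$B$-positive elements.** Data: integers $u\ge0$, $v\ge1$, $m=n-u-v\ge2$ (numbers of top and bottom horizontal lines, i.e. lines without reflections); $m=p_1+\dots+p_r$ with $p_j\ge1$, $p_r\ge2$ (sizes of the consecutive bunches of parallel non-horizontal lines, from top to bottom); $0\le t_1<\dots<t_r$ (each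 line of the $j$-th bunch has $t_j$ top and $t_j+1$ bottom reflections). Let $I_1,\dots,I_r$ be the consecutive intervals of lengths $p_1,\dots,p_r$ partitioning $\{u+1,\dots,u+m\}$. The corresponding $B$-positive element is $\tilde w=bw$ with $b=-\sum_jt_j\sum_{i\in I_j}\epsilon_i$, $w(\epsilon_i)=\epsilon_i$ for $i\notin\bigcup I_j$ and $w(\epsilon_i)=-\epsilon_{\iota_j(i)}$ for $i\in I_j$, where $\iota_j$ is the order-reversing bijection of $I_j$. It has $v$ bottom horizontal lines.
   Formalization: In (i), the claim that s_0 w~ is u~' for a B-positive u~ is stated only for u>=1, as it fails for u=0; in (ii), the list of all minimal NGT of type D_n also includes s_n w~* s_n (when iota_B(w~) has an even number of bottom reflections), which the printed list misses. *)

theory Defs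
  imports "HOL-Algebra.Bij" "HOL-Algebra.Generated_Groups" "HOL-Combinatorics.Permutations"
begin

datatype affine_type = TB | TC | TD

text \<open>
  A vector \<open>z\<close> has \<open>\<epsilon>\<^sub>i\<close>-coordinate \<open>z i\<close> for \<open>i \<in> {1..n}\<close>; the coordinates outside
  \<open>{1..n}\<close> are \<open>0\<close>. Integral coordinates are enough for the roots of all three types and for the
  lattice \<open>\<Oplus>\<int>\<epsilon>\<^sub>i\<close>. A pair \<open>(z, \<zeta>)\<close> of type \<open>avec\<close> stands for \<open>[z, \<zeta>]\<close>.
\<close>

type_synonym vec = "nat \<Rightarrow> int"
type_synonym avec = "vec \<times> int"

definition eps :: "nat \<Rightarrow> vec" where
  "eps i = (\<lambda>k. if k = i then 1 else 0)"

definition form :: "affine_type \<Rightarrow> nat \<Rightarrow> vec \<Rightarrow> vec \<Rightarrow> int" where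
  "form X n x y = (if X = TB then 2 else 1) * (\<Sum>i\<in>{1..n}. x i * y i)"

definition roots :: "affine_type \<Rightarrow> nat \<Rightarrow> vec set" where
  "roots X n =
     {\<lambda>k. a * eps i k + b * eps j k | a b i j.
        a \<in> {1, -1} \<and> b \<in> {1, -1} \<and> i \<in> {1..n} \<and> j \<in> {1..n} \<and> i \<noteq> j} \<union>
     (case X of TB \<Rightarrow> {\<lambda>k. a * eps i k | a i. a \<in> {1, -1} \<and> i \<in> {1..n}}
        | TC \<Rightarrow> {\<lambda>k. 2 * a * eps i k | a i. a \<in> {1, -1} \<and> i \<in> {1..n}}
        | TD \<Rightarrow> {})"

definition nu :: "affine_type \<Rightarrow> nat \<Rightarrow> vec \<Rightarrow> int" where
  "nu X n \<alpha> = form X n \<alpha> \<alpha> div 2"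

definition affine_roots :: "affine_type \<Rightarrow> nat \<Rightarrow> avec set" where
  "affine_roots X n = {(\<alpha>, nu X n \<alpha> * j) | \<alpha> j. \<alpha> \<in> roots X n}"

text \<open>
  Elements of the Weyl group \<open>W\<close> are linear maps on vectors, and an element \<open>bw\<close> of
  \<open>\<oplus>\<int>\<epsilon>\<^sub>i \<rtimes> W\<close> is the pair \<open>(b, w)\<close>. The group is the same for all three types; only the action
  \<open>act\<close> on the vectors \<open>[z, \<zeta>]\<close> depends on the type, through the form. This is how the groups of
  types \<open>C\<close> and \<open>D\<close> are subgroups of the one of type \<open>B\<close>.
\<close>

type_synonym aelt = "vec \<times> (vec \<Rightarrow> vec)"

definition signed_perms :: "nat \<Rightarrow> (vec \<Rightarrow> vec) set" where
  "signed_perms n = {\<lambda>z k. sg k * z (\<sigma> k) | sg \<sigma>. \<sigma> permutes {1..n} \<and>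
      (\<forall>k\<in>{1..n}. sg k \<in> {1, -1}) \<and> (\<forall>k. k \<notin> {1..n} \<longrightarrow> sg k = 1)}"

definition W_aff :: "nat \<Rightarrow> aelt monoid" where
  "W_aff n = \<lparr>carrier = {b. \<forall>k. k \<notin> {1..n} \<longrightarrow> b k = 0} \<times> signed_perms n,
     monoid.mult = (\<lambda>(b, w) (c, v). (\<lambda>k. b k + w c k, w \<circ> v)),
     monoid.one = (\<lambda>k. 0, id)\<rparr>"

definition act :: "affine_type \<Rightarrow> nat \<Rightarrow> aelt \<Rightarrow> avec \<Rightarrow> avec" where
  "act X n = (\<lambda>(b, w) (z, \<zeta>). (w z, \<zeta> - form X n (w z) b))"

definition simple_root :: "affine_type \<Rightarrow> nat \<Rightarrow> nat \<Rightarrow> avec" where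
  "simple_root X n i =
    (if i = 0 then
       (case X of TB \<Rightarrow> (\<lambda>k. - eps 1 k, 1) | _ \<Rightarrow> (\<lambda>k. - eps 1 k - eps 2 k, 1))
     else if i < n then (\<lambda>k. eps i k - eps (i + 1) k, 0)
     else (case X of TB \<Rightarrow> (eps n, 0) | TC \<Rightarrow> (\<lambda>k. 2 * eps n k, 0)
             | TD \<Rightarrow> (\<lambda>k. eps (n - 1) k + eps n k, 0)))"

text \<open>
  With \<open>\<alpha>\<^sup>\<or> = 2\<alpha>/(\<alpha>,\<alpha>)\<close>, the reflection \<open>x \<mapsto> x - (z, \<alpha>\<^sup>\<or>)[\<alpha>, \<zeta>]\<close> (where \<open>z\<close> is the nonaffine part
  of \<open>x\<close>) is the action of the product of the translation by \<open>-(\<zeta>/\<nu>\<^sub>\<alpha>)\<alpha>\<close> and the reflection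
  \<open>s\<^sub>\<alpha>\<close>. All the divisions are exact on roots.
\<close>

definition sB :: "nat \<Rightarrow> nat \<Rightarrow> aelt" where
  "sB n i = (case simple_root TB n i of (\<alpha>, \<zeta>) \<Rightarrow>
     (\<lambda>k. - (\<zeta> div nu TB n \<alpha>) * \<alpha> k,
      \<lambda>z k. z k - (2 * form TB n z \<alpha> div form TB n \<alpha> \<alpha>) * \<alpha> k))"

definition srefl :: "affine_type \<Rightarrow> nat \<Rightarrow> nat \<Rightarrow> aelt" where
  "srefl X n i =
    (if i = 0 \<and> X \<noteq> TB then sB n 0 \<otimes>\<^bsub>W_aff n\<^esub> sB n 1 \<otimes>\<^bsub>W_aff n\<^esub> sB n 0
     else if i = n \<and> X = TD then sB n n \<otimes>\<^bsub>W_aff n\<^esub> sB n (n - 1) \<otimes>\<^bsub>W_aff n\<^esub> sB n n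
     else sB n i)"

definition affine_weyl :: "affine_type \<Rightarrow> nat \<Rightarrow> aelt set" where
  "affine_weyl X n = generate (W_aff n) (srefl X n ` {0..n})"

text \<open>
  The list \<open>[i\<^sub>1, \<dots>, i\<^sub>l]\<close> encodes the word \<open>s\<^bsub>i\<^sub>l\<^esub> \<cdots> s\<^bsub>i\<^sub>1\<^esub>\<close>, so the product is taken from right to
  left. For a reduced word, \<open>root_seq\<close> enumerates \<open>\<lambda>(w)\<close> in the order of the word.
\<close>

fun word_elt :: "affine_type \<Rightarrow> nat \<Rightarrow> nat list \<Rightarrow> aelt" where
  "word_elt X n [] = \<one>\<^bsub>W_aff n\<^esub>"
| "word_elt X n (i # is) = word_elt X n is \<otimes>\<^bsub>W_aff n\<^esub> srefl X n i"

definition reduced_word :: "affine_type \<Rightarrow> nat \<Rightarrow> aelt \<Rightarrow> nat list \<Rightarrow> bool" where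
  "reduced_word X n x is \<longleftrightarrow> set is \<subseteq> {0..n} \<and> word_elt X n is = x \<and>
     (\<forall>js. set js \<subseteq> {0..n} \<and> word_elt X n js = x \<longrightarrow> length is \<le> length js)"

fun root_seq :: "affine_type \<Rightarrow> nat \<Rightarrow> nat list \<Rightarrow> avec list" where
  "root_seq X n [] = []"
| "root_seq X n (i # is) = simple_root X n i # map (act X n (srefl X n i)) (root_seq X n is)"

definition minimal_NGT :: "affine_type \<Rightarrow> nat \<Rightarrow> aelt \<Rightarrow> bool" where
  "minimal_NGT X n x \<longleftrightarrow> x \<in> affine_weyl X n \<and>
     (\<exists>\<alpha> a \<beta> b.
        (\<forall>is. reduced_word X n x is \<longrightarrow>
           is \<noteq> [] \<and> hd (root_seq X n is) = (\<alpha>, a) \<and> last (root_seq X n is) = (\<beta>, b)) \<and>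
        (\<lambda>k. \<alpha> k + \<beta> k, a + b) \<in> affine_roots X n \<and>
        form X n \<alpha> \<alpha> = form X n \<beta> \<beta> \<and>
        form X n (\<lambda>k. \<alpha> k + \<beta> k) (\<lambda>k. \<alpha> k + \<beta> k) = form X n \<alpha> \<alpha>)"

text \<open>
  Any two reduced words of type \<open>B\<close> of the same element have equally many letters \<open>0\<close>, and equally
  many letters \<open>n\<close>, because the nodes \<open>0\<close> and \<open>n\<close> are on double bonds only; so the
  choice made by \<open>SOME\<close> is irrelevant.
\<close>

definition top_refls :: "nat \<Rightarrow> aelt \<Rightarrow> nat" where
  "top_refls n x = count_list (SOME is. reduced_word TB n x is) 0"

definition bottom_refls :: "nat \<Rightarrow> aelt \<Rightarrow> nat" where
  "bottom_refls n x = count_list (SOME is. reduced_word TB n x is) n"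

definition iota_B :: "nat \<Rightarrow> aelt \<Rightarrow> aelt" where
  "iota_B n = (THE f. f \<in> auto (W_aff n) \<and> (\<forall>i\<in>{0..n}. f (sB n i) = sB n (n - i)))"

definition iota_C :: "nat \<Rightarrow> aelt \<Rightarrow> aelt" where
  "iota_C n x = sB n 0 \<otimes>\<^bsub>W_aff n\<^esub> x \<otimes>\<^bsub>W_aff n\<^esub> sB n 0"

text \<open>
  The lists \<open>p\<close> and \<open>t\<close> are indexed from \<open>0\<close>: the \<open>j\<close>-th bunch of the text is \<open>p ! (j - 1)\<close>.
\<close>

definition bunch :: "nat \<Rightarrow> nat list \<Rightarrow> nat \<Rightarrow> nat set" where
  "bunch u p j = {u + sum_list (take j p) + 1 .. u + sum_list (take (j + 1) p)}"

definition bunch_rev :: "nat \<Rightarrow> nat list \<Rightarrow> nat \<Rightarrow> nat \<Rightarrow> nat" where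
  "bunch_rev u p j i = Min (bunch u p j) + Max (bunch u p j) - i"

definition B_data :: "nat \<Rightarrow> nat \<Rightarrow> nat \<Rightarrow> nat list \<Rightarrow> nat list \<Rightarrow> bool" where
  "B_data n u v p t \<longleftrightarrow> 1 \<le> v \<and> u + v + sum_list p = n \<and> 2 \<le> sum_list p \<and>
     (\<forall>q\<in>set p. 1 \<le> q) \<and> 2 \<le> last p \<and> length t = length p \<and> sorted_wrt (<) t"

definition B_positive :: "nat \<Rightarrow> nat \<Rightarrow> nat \<Rightarrow> nat list \<Rightarrow> nat list \<Rightarrow> aelt \<Rightarrow> bool" where
  "B_positive n u v p t x \<longleftrightarrow> B_data n u v p t \<and>
     (\<exists>b w. x = (b, w) \<and> w \<in> signed_perms n \<and>
        b = (\<lambda>k. - (\<Sum>j<length p. int (t ! j) * (\<Sum>i\<in>bunch u p j. eps i k))) \<and>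
        (\<forall>i\<in>{1..n}. i \<notin> (\<Union>j<length p. bunch u p j) \<longrightarrow> w (eps i) = eps i) \<and>
        (\<forall>j<length p. \<forall>i\<in>bunch u p j. w (eps i) = (\<lambda>k. - eps (bunch_rev u p j i) k)))"

definition B_positive_NGT :: "nat \<Rightarrow> nat \<Rightarrow> nat \<Rightarrow> nat list \<Rightarrow> nat list \<Rightarrow> aelt \<Rightarrow> bool" where
  "B_positive_NGT n u v p t x \<longleftrightarrow> B_positive n u v p t x \<and> minimal_NGT TB n x"

text \<open>
  The elements \<open>w'\<close>, \<open>w''\<close> and \<open>w\<^sup>*\<close> attached to \<open>w\<close>, with the top parity correction when it is
  needed.
\<close>

definition prime_elt :: "nat \<Rightarrow> aelt \<Rightarrow> aelt" where
  "prime_elt n w = (if even (top_refls n w) then w else w \<otimes>\<^bsub>W_aff n\<^esub> sB n 0)"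

definition dprime_elt :: "nat \<Rightarrow> aelt \<Rightarrow> aelt" where
  "dprime_elt n w = (if even (top_refls n w) then iota_C n w else sB n 0 \<otimes>\<^bsub>W_aff n\<^esub> w)"

definition star_elt :: "nat \<Rightarrow> aelt \<Rightarrow> aelt" where
  "star_elt n w = (if even (top_refls n (iota_B n w)) then iota_B n w
                   else iota_B n w \<otimes>\<^bsub>W_aff n\<^esub> sB n 0)"

end

theory Submission
  imports Defs
begin

text \<open>
  Every element \<open>x = bw\<close> of \<open>\<oplus>\<int>\<epsilon>\<^sub>i \<rtimes> W\<close> is encoded by a permutation \<open>G\<close> of the integers with
  \<open>G (1 - m) = 1 - G m\<close> and \<open>G (m + 2n) = G m + 2n\<close>. The integer \<open>k \<in> {1..n}\<close> stands for \<open>[\<epsilon>\<^sub>k, 0]\<close>,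
  the mirror image \<open>1 - k\<close> for \<open>[-\<epsilon>\<^sub>k, 1]\<close>, and adding \<open>2n\<close> lowers the affine part by \<open>1\<close>; then
  \<open>G\<close> describes how \<open>x\<close> acts on these vectors (\<open>aperm\<close>). An affine root is, up to a positive
  factor, the difference of two such vectors, that is a pair \<open>a, b\<close> of integers; it is positive iff
  \<open>a < b\<close>, and \<open>x\<close> makes a positive root negative iff \<open>G a > G b\<close>. The three root systems thus live on
  the same permutations and differ only in their simple pairs: all of them have the pairs
  \<open>(k, k + 1)\<close> with \<open>0 < k < n\<close>; in type \<open>B\<close> the end nodes are the pairs \<open>(0, 1)\<close> and
  \<open>(n, n + 1)\<close>, which are their own mirror images up to the shift; type \<open>C\<close> replaces the first one by
  \<open>(-1, 1)\<close>, and type \<open>D\<close> also replaces the second one by \<open>(n - 1, n + 1)\<close>.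

  \<^bold>\<open>From words to permutations\<close> (\<open>minimal_NGT_iff\<close>). By the exchange condition, a letter starts
  some reduced word of \<open>x\<close> iff its simple pair is a descent of \<open>G\<close>, and it ends one iff it is a
  descent of the inverse of \<open>G\<close>. Hence \<open>x\<close> is a minimal NGT iff it lies in the affine Weyl group,
  \<open>G\<close> has a single descent \<open>i\<close>, its inverse has a single descent \<open>j\<close>, and the first and last roots
  have the length of \<open>\<epsilon>\<^sub>1 + \<epsilon>\<^sub>2\<close> and the inner product of two roots whose sum is a root of
  that length (predicate \<open>ngt\<close>). Other lengths are excluded by the parity of that inner product.

  \<^bold>\<open>Type \<open>B\<close>\<close> (\<open>ext_ngt_TB_classification\<close>). If \<open>i\<close> is the only descent of \<open>G\<close>, then \<open>G\<close> is increasing on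
  the blocks \<open>[1 - i, i]\<close> and \<open>[i + 1, 2n - i]\<close>, and the inverse of \<open>G\<close> on the blocks given by \<open>j\<close>.
  The inner product condition puts the preimage of \<open>j + 1\<close> at the start of a block or the preimage
  of \<open>j\<close> at the end of one, and this forces \<open>i = j\<close> and makes \<open>G\<close> the identity on one of the two
  blocks. The automorphism \<open>\<iota>\<^sub>B\<close>, which is the conjugation by \<open>m \<mapsto> n + 1 - m\<close>, exchanges the two
  possibilities. If the lower block is fixed, \<open>G\<close> maps \<open>[1 - i, i]\<close> to itself up to multiples of
  \<open>2n\<close>; these multiples increase along the block, and monotonicity of \<open>G\<close> and of its inverse
  determines \<open>G\<close> from them. Their level sets are the bunches, and the result is the \<open>B\<close>-positive
  element with these bunches.

  \<^bold>\<open>Types \<open>C\<close> and \<open>D\<close>.\<close> The reflection \<open>s\<^sub>0\<close> permutes the positive roots of type \<open>C\<close>, and \<open>s\<^sub>0\<close> and \<open>s\<^sub>n\<close>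
  permute those of type \<open>D\<close>, because they interchange the two simple roots of a fork of the diagram.
  So the condition on descents and inner products is invariant under multiplication by these
  reflections on either side. The shortest element of a double coset has no descent at the end nodes
  of type \<open>B\<close>; its descents in types \<open>C\<close> or \<open>D\<close> are then descents in type \<open>B\<close>, and it is a minimal
  NGT of type \<open>B\<close>. The given element is recovered from it by the parities of the numbers of
  letters \<open>0\<close> and \<open>n\<close>, which single out the affine Weyl groups of types \<open>C\<close> and \<open>D\<close>
  (\<open>affine_weyl_TC\<close>, \<open>affine_weyl_TD\<close>). The condition \<open>v \<ge> 2\<close> says that the descent is not at a
  fork, where it would create a second descent. A \<open>B\<close>-positive element is an involution and commutes
  with \<open>s\<^sub>n\<close>, and its image under \<open>\<iota>\<^sub>B\<close> commutes with \<open>s\<^sub>0\<close>; this gives the remaining identities.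
\<close>

section \<open>Affine signed permutations\<close>

text \<open>
  In the presence of the group notation, \<open>inv\<close> denotes the inverse in a group, so the inverse
  function has a name of its own.
\<close>

abbreviation finv :: "(int \<Rightarrow> int) \<Rightarrow> int \<Rightarrow> int" where "finv \<equiv> inv_into UNIV"

text \<open>
  The mirrors are at \<open>1/2\<close> and \<open>n + 1/2\<close>, so that no integer lies on a mirror and all simple
  reflections of type \<open>B\<close> interchange neighbours.
\<close>

definition affine_perm :: "nat \<Rightarrow> (int \<Rightarrow> int) \<Rightarrow> bool" where
  "affine_perm n G \<longleftrightarrow> bij G \<and> (\<forall>m. G (1 - m) = 1 - G m) \<and> (\<forall>m. G (m + 2 * int n) = G m + 2 * int n)"

lemma affine_perm_bij: "affine_perm n G \<Longrightarrow> bij G"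
  by (simp add: affine_perm_def)

lemma affine_perm_inj: "affine_perm n G \<Longrightarrow> G a = G b \<longleftrightarrow> a = b"
  by (meson affine_perm_bij bij_is_inj inj_eq)

lemma affine_perm_mirror: "affine_perm n G \<Longrightarrow> G (1 - m) = 1 - G m"
  by (simp add: affine_perm_def)

lemma affine_perm_shift: 
  assumes "affine_perm n G"
  shows "G (m + 2 * int n * k) = G m + 2 * int n * k"
proof (induction k rule: int_induct[where k = 0])
  case (step1 i)
  have e: "m + 2 * int n * (i + 1) = (m + 2 * int n * i) + 2 * int n"
    by (simp add: algebra_simps)
  have "G (m + 2 * int n * (i + 1)) = G (m + 2 * int n * i) + 2 * int n"
    unfolding e using assms by (simp add: affine_perm_def)
  then show ?case using step1 by (simp add: algebra_simps)
next
  case (step2 i)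
  have e: "m + 2 * int n * i = (m + 2 * int n * (i - 1)) + 2 * int n"
    by (simp add: algebra_simps)
  have "G (m + 2 * int n * i) = G (m + 2 * int n * (i - 1)) + 2 * int n"
    unfolding e using assms by (simp add: affine_perm_def)
  then show ?case using step2 by (simp add: algebra_simps)
qed simp

lemma affine_perm_reflect:
  assumes "affine_perm n G"
  shows "G (2 * int n * k + 1 - m) = 2 * int n * k + 1 - G m"
  using affine_perm_shift[OF assms, of "1 - m" k] affine_perm_mirror[OF assms, of m]
  by (simp add: algebra_simps)

lemma affine_perm_id: "affine_perm n id"
  by (simp add: affine_perm_def)

lemma affine_perm_comp: "affine_perm n G \<Longrightarrow> affine_perm n H \<Longrightarrow> affine_perm n (G \<circ> H)"
  by (auto simp: affine_perm_def bij_comp)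

lemma affine_perm_inv_f: "affine_perm n G \<Longrightarrow> finv G (G m) = m"
  by (meson affine_perm_bij bij_is_inj inv_f_f)

lemma affine_perm_f_inv: "affine_perm n G \<Longrightarrow> G (finv G m) = m"
  by (meson affine_perm_bij bij_inv_eq_iff)

lemma affine_perm_inv: assumes G: "affine_perm n G" shows "affine_perm n (finv G)"
proof -
  have "finv G (1 - m) = 1 - finv G m" for m
  proof -
    have "G (1 - finv G m) = 1 - m"
      using affine_perm_mirror[OF G, of "finv G m"] affine_perm_f_inv[OF G, of m] by simp
    then show ?thesis using affine_perm_inv_f[OF G, of "1 - finv G m"] by simp
  qed
  moreover have "finv G (m + 2 * int n) = finv G m + 2 * int n" for m
  proof -
    have "G (finv G m + 2 * int n) = m + 2 * int n"
      using affine_perm_shift[OF G, of "finv G m" 1] affine_perm_f_inv[OF G, of m] by simp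
    then show ?thesis using affine_perm_inv_f[OF G, of "finv G m + 2 * int n"] by simp
  qed
  ultimately show ?thesis
    using affine_perm_bij[OF G] by (simp add: affine_perm_def bij_imp_bij_inv)
qed

lemma dvd_diffE:
  assumes "(d::int) dvd a - b" obtains k where "a = b + d * k"
proof -
  from assms obtain k where "a - b = d * k" by (rule dvdE)
  then have "a = b + d * k" by simp
  then show ?thesis using that by blast
qed

lemma affine_perm_dvd:
  assumes "affine_perm n G"
  shows "2 * int n dvd G a - G b \<longleftrightarrow> 2 * int n dvd a - b"
proof
  assume "2 * int n dvd G a - G b"
  then obtain k where "G a = G b + 2 * int n * k" by (rule dvd_diffE)
  then have "G a = G (b + 2 * int n * k)" using affine_perm_shift[OF assms] by simp
  then show "2 * int n dvd a - b" using affine_perm_inj[OF assms] by simp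
next
  assume "2 * int n dvd a - b"
  then obtain k where "a = b + 2 * int n * k" by (rule dvd_diffE)
  then show "2 * int n dvd G a - G b" using affine_perm_shift[OF assms] by simp
qed

text \<open>
  The window \<open>{1..n}\<close>, its mirror images and their translates cover the integers.
\<close>

lemma affine_perm_eqI:
  assumes "affine_perm n G" "affine_perm n H" "n \<ge> 1"
    and eq: "\<And>k. 1 \<le> k \<Longrightarrow> k \<le> int n \<Longrightarrow> G k = H k"
  shows "G = H"
proof
  fix m
  define q r where "q = (m - 1) div (2 * int n)" and "r = (m - 1) mod (2 * int n)"
  have m: "m = r + 1 + 2 * int n * q" unfolding q_def r_def
    using mod_mult_div_eq[of "m - 1" "2 * int n"] by linarith
  have r: "0 \<le> r" "r < 2 * int n" using assms(3) unfolding r_def by auto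
  show "G m = H m"
  proof (cases "r < int n")
    case True
    then show ?thesis using r eq[of "r+1"] affine_perm_shift[OF assms(1), of "r+1" q]
        affine_perm_shift[OF assms(2), of "r+1" q] m by simp
  next
    case False
    have "m = 2 * int n * (q + 1) + 1 - (2 * int n - r)" using m by (simp add: algebra_simps)
    then show ?thesis using r False eq[of "2 * int n - r"] affine_perm_reflect[OF assms(1)] 
       affine_perm_reflect[OF assms(2)] by simp
  qed
qed

text \<open>
  The inner product of the vectors \<open>\<plusminus>\<epsilon>\<^sub>k\<close> that belong to the positions \<open>a\<close> and \<open>b\<close> (see
  \<open>dot_position_vec\<close>).
\<close>

definition pairing :: "nat \<Rightarrow> int \<Rightarrow> int \<Rightarrow> int" where
  "pairing n a b = of_bool (2 * int n dvd a - b) - of_bool (2 * int n dvd a + b - 1)"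

lemma pairing_invariant:
  assumes "affine_perm n G" shows "pairing n (G a) (G b) = pairing n a b"
  using affine_perm_dvd[OF assms, of a b] affine_perm_dvd[OF assms, of a "1 - b"]
    affine_perm_mirror[OF assms, of b]
  by (simp add: pairing_def algebra_simps)

lemma pairing_commute: "pairing n a b = pairing n b a"
  by (simp add: pairing_def dvd_diff_commute add.commute)

lemma pairing_mirror: "pairing n (1 - a) b = - pairing n a b"
  by (simp add: pairing_def) (smt (verit) dvd_diff_commute)

lemma pairing_shift: "pairing n (a + 2 * int n * k) b = pairing n a b"
proof -
  have "2 * int n dvd a + 2 * int n * k - b \<longleftrightarrow> 2 * int n dvd a - b"
    using dvd_add_left_iff[of "2 * int n" "2 * int n * k" "a - b"] by (simp add: algebra_simps)
  moreover have "2 * int n dvd a + 2 * int n * k + b - 1 \<longleftrightarrow> 2 * int n dvd a + b - 1"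
    using dvd_add_left_iff[of "2 * int n" "2 * int n * k" "a + b - 1"] by (simp add: algebra_simps)
  ultimately show ?thesis by (simp add: pairing_def)
qed

text \<open>
  The reflection in the root of the pair \<open>(a, b)\<close>: it interchanges \<open>a\<close> with \<open>b\<close> and, to be compatible
  with the mirror, \<open>1 - a\<close> with \<open>1 - b\<close>, together with all translates by \<open>2n\<close>. Positions congruent to
  \<open>a\<close> or \<open>1 - b\<close> move by \<open>b - a\<close>, and those congruent to \<open>b\<close> or \<open>1 - a\<close> move back.
\<close>

definition affine_refl :: "nat \<Rightarrow> int \<Rightarrow> int \<Rightarrow> int \<Rightarrow> int" where
  "affine_refl n a b m = m + (if 2 * int n dvd m - a \<or> 2 * int n dvd m + b - 1 then b - a
     else if 2 * int n dvd m - b \<or> 2 * int n dvd m + a - 1 then a - b else 0)"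

lemma even_not_dvd: "\<not> 2 * int n dvd 2 * m - 1" "\<not> 2 * int n dvd 1 - 2 * m" 
proof -
  have "2 dvd 2 * m - 1 \<Longrightarrow> False" "2 dvd 1 - 2 * m \<Longrightarrow> False" by presburger+
  then show "\<not> 2 * int n dvd 2 * m - 1" "\<not> 2 * int n dvd 1 - 2 * m" using dvd_mult_left by blast+
qed

lemma dvd_sub2: "(d::int) dvd x \<Longrightarrow> d dvd y \<Longrightarrow> z = x - y \<Longrightarrow> d dvd z"
  by simp
lemma dvd_add2: "(d::int) dvd x \<Longrightarrow> d dvd y \<Longrightarrow> z = x + y \<Longrightarrow> d dvd z"
  by simp

text \<open>
  A position never moves in both directions: \<open>2a - 1\<close> is odd, so \<open>a\<close> and \<open>1 - a\<close> are not congruent.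
\<close>

lemma refl_up_down_disjoint:
  assumes ab: "\<not> 2 * int n dvd a - b"
    and "2 * int n dvd m - a \<or> 2 * int n dvd m + b - 1"
    and "2 * int n dvd m - b \<or> 2 * int n dvd m + a - 1"
  shows False
proof -
  have 1: False if "2 * int n dvd m - a" "2 * int n dvd m - b"
    using dvd_sub2[OF that(2,1), of "a - b"] ab by simp
  have 2: False if "2 * int n dvd m - a" "2 * int n dvd m + a - 1"
    using dvd_sub2[OF that(2,1), of "2 * a - 1"] even_not_dvd(1) by simp
  have 3: False if "2 * int n dvd m + b - 1" "2 * int n dvd m - b"
    using dvd_sub2[OF that, of "2 * b - 1"] even_not_dvd(1) by simp
  have 4: False if "2 * int n dvd m + b - 1" "2 * int n dvd m + a - 1"
    using dvd_sub2[OF that(2,1), of "a - b"] ab by simp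
  show False using assms(2,3) 1 2 3 4 by blast
qed

lemma refl_cases:
  assumes "\<not> 2 * int n dvd a - b"
  obtains (up) "2 * int n dvd m - a \<or> 2 * int n dvd m + b - 1" "affine_refl n a b m = m + (b - a)"
  | (down) "2 * int n dvd m - b \<or> 2 * int n dvd m + a - 1" "affine_refl n a b m = m + (a - b)"
  | (stay) "\<not> 2 * int n dvd m - a" "\<not> 2 * int n dvd m + b - 1" "\<not> 2 * int n dvd m - b" 
        "\<not> 2 * int n dvd m + a - 1" "affine_refl n a b m = m"
  using refl_up_down_disjoint[OF assms] unfolding affine_refl_def by (smt (verit))

lemma refl_up: "2 * int n dvd m - a \<or> 2 * int n dvd m + b - 1 \<Longrightarrow> affine_refl n a b m = m + (b - a)"
  by (auto simp: affine_refl_def)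

lemma refl_down:
  assumes "\<not> 2 * int n dvd a - b" "2 * int n dvd m - b \<or> 2 * int n dvd m + a - 1"
  shows "affine_refl n a b m = m + (a - b)"
  using refl_up_down_disjoint[OF assms(1) _ assms(2)] assms(2) by (auto simp: affine_refl_def)

lemma refl_invol:
  assumes ab: "\<not> 2 * int n dvd a - b" shows "affine_refl n a b (affine_refl n a b m) = m"
proof (rule refl_cases[OF ab, of m], goal_cases up down stay)
  case up
  from up(1) have "2 * int n dvd (m + (b - a)) - b \<or> 2 * int n dvd (m + (b - a)) + a - 1"
    by (simp add: algebra_simps)
  then show ?thesis using refl_down[OF ab] up(2) by simp
next
  case down
  from down(1) have "2 * int n dvd (m + (a - b)) - a \<or> 2 * int n dvd (m + (a - b)) + b - 1"
    by (simp add: algebra_simps)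
  then show ?thesis using refl_up down(2) by simp
next
  case stay then show ?thesis by simp
qed

text \<open>
  The permutation form of \<open>w s\<^sub>\<alpha> w\<^sup>-\<^sup>1 = s\<^bsub>w\<alpha>\<^esub>\<close>.
\<close>

lemma refl_conj:
  assumes G: "affine_perm n G"
  shows "G (affine_refl n a b m) = affine_refl n (G a) (G b) (G m)"
proof -
  have d: "2 * int n dvd G m - G c \<longleftrightarrow> 2 * int n dvd m - c" for c
    by (rule affine_perm_dvd[OF G])
  have d': "2 * int n dvd G m + G c - 1 \<longleftrightarrow> 2 * int n dvd m + c - 1" for c
    using d[of "1 - c"] affine_perm_mirror[OF G, of c] by (simp add: algebra_simps)
  have s: "G (m + (q - p)) = G m + (G q - G p)" if "2 * int n dvd m - p" for p q
  proof -
    from that obtain k where "m = p + 2 * int n * k" by (rule dvd_diffE)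
    then show ?thesis using affine_perm_shift[OF G, of p k] affine_perm_shift[OF G, of q k] 
      by (simp add: algebra_simps)
  qed
  have s': "G (m + (q - p)) = G m + (G q - G p)" if "2 * int n dvd m + q - 1" for p q
    using s[of "1 - q" "1 - p"] that affine_perm_mirror[OF G, of p] affine_perm_mirror[OF G, of q] by (simp add: algebra_simps)
  have up: "G (m + (b - a)) = G m + (G b - G a)" if "2 * int n dvd m - a \<or> 2 * int n dvd m + b - 1"
    using that s s' by blast
  have down: "G (m + (a - b)) = G m + (G a - G b)" if "2 * int n dvd m - b \<or> 2 * int n dvd m + a - 1"
    using that s s' by blast
  show ?thesis unfolding affine_refl_def using up down d d' by simp
qed

lemma affine_perm_refl:
  assumes ab: "\<not> 2 * int n dvd a - b" shows "affine_perm n (affine_refl n a b)"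
  unfolding affine_perm_def
proof (intro conjI allI)
  show "bij (affine_refl n a b)" using refl_invol[OF ab] by (metis bijI')
  show "affine_refl n a b (m + 2 * int n) = affine_refl n a b m + 2 * int n" for m
  proof -
    have "2 * int n dvd m + 2 * int n - c \<longleftrightarrow> 2 * int n dvd m - c" for c
      using dvd_add_triv_right_iff[of "2 * int n" "m - c"] by (simp add: algebra_simps)
    moreover have "2 * int n dvd m + 2 * int n + c - 1 \<longleftrightarrow> 2 * int n dvd m + c - 1" for c
      using dvd_add_triv_right_iff[of "2 * int n" "m + c - 1"] by (simp add: algebra_simps)
    ultimately show ?thesis unfolding affine_refl_def by simp
  qed
  show "affine_refl n a b (1 - m) = 1 - affine_refl n a b m" for m
  proof -
    have e: "2 * int n dvd 1 - m - c \<longleftrightarrow> 2 * int n dvd m + c - 1" for c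
      using dvd_minus_iff[of "2 * int n" "m + c - 1"] by (simp add: algebra_simps)
    have e': "2 * int n dvd 1 - m + c - 1 \<longleftrightarrow> 2 * int n dvd m - c" for c
      using dvd_minus_iff[of "2 * int n" "m - c"] by (simp add: algebra_simps)
    show ?thesis
    proof (rule refl_cases[OF ab, of m], goal_cases up down stay)
      case up then show ?thesis using refl_down[OF ab, of "1 - m"] e e' by auto
    next
      case down then show ?thesis using refl_up[of n "1 - m" a b] e e' by auto
    next
      case stay then show ?thesis using e e' unfolding affine_refl_def by simp
    qed
  qed
qed

text \<open>
  A pair and its mirror image define the same root.
\<close>

lemma refl_mirror: 
  assumes "\<not> 2 * int n dvd a - b"
  shows "affine_refl n (1 - b) (1 - a) = affine_refl n a b"
proof (rule ext)
  fix m
  have e: "m + (1 - c) - 1 = m - c" "m - (1 - c) = m + c - 1" for c :: int by auto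
  show "affine_refl n (1 - b) (1 - a) m = affine_refl n a b m" unfolding affine_refl_def e by (simp add: disj_commute)
qed

lemma refl_cong:
  assumes d: "2 * int n dvd a - a'" and e: "b - a = b' - a'" shows "affine_refl n a b = affine_refl n a' b'"
proof (rule ext)
  fix m
  have "b - b' = a - a'" using e by simp
  then have d': "2 * int n dvd b - b'" using d by simp
  have x: "2 * int n dvd m - c \<longleftrightarrow> 2 * int n dvd m - c'" if "2 * int n dvd c - c'" for c c'
    using dvd_add_left_iff[OF that, of "m - c"] by (simp add: algebra_simps)
  have y: "2 * int n dvd m + c - 1 \<longleftrightarrow> 2 * int n dvd m + c' - 1" if "2 * int n dvd c - c'" for c c'
    using dvd_add_left_iff[OF that, of "m + c' - 1"] by (simp add: algebra_simps)
  show "affine_refl n a b m = affine_refl n a' b' m" unfolding affine_refl_def x[OF d] x[OF d'] y[OF d] y[OF d'] using e by simp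
qed

section \<open>Simple pairs of the three types\<close>

text \<open>
  The simple root of node \<open>i\<close> is the difference of the vectors at these two positions. At the fork of
  types \<open>C\<close> and \<open>D\<close> the pair \<open>(-1, 1)\<close> is used for \<open>-\<epsilon>\<^sub>1 - \<epsilon>\<^sub>2\<close> and not its mirror image
  \<open>(0, 2)\<close>; then the upper position is \<open>i + 1\<close> at every node.
\<close>

fun node_lo node_hi :: "affine_type \<Rightarrow> nat \<Rightarrow> nat \<Rightarrow> int" where
  "node_lo X n i = (if i = 0 \<and> X \<noteq> TB then -1 else if i = n \<and> X = TD then int n - 1 else int i)"
| "node_hi X n i = int i + 1"

declare node_lo.simps [simp del] node_hi.simps [simp del]
lemmas node_simps = node_lo.simps node_hi.simps

text \<open>
  The nodes whose simple root has the form \<open>\<plusminus>\<epsilon>\<^sub>k \<plusminus> \<epsilon>\<^sub>l\<close>.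
\<close>

definition norm_two_nodes :: "affine_type \<Rightarrow> nat \<Rightarrow> nat set" where
  "norm_two_nodes X n = (case X of TB \<Rightarrow> {1..<n} | TC \<Rightarrow> {0..<n} | TD \<Rightarrow> {0..n})"

text \<open>
  From these ranks on, a reflection at a fork does not move the neighbours of the four consecutive
  positions that it permutes, and in type \<open>D\<close> the two forks are disjoint.
\<close>

definition rank_ok :: "affine_type \<Rightarrow> nat \<Rightarrow> bool" where
  "rank_ok X n \<longleftrightarrow> (case X of TD \<Rightarrow> 4 \<le> n | _ \<Rightarrow> 3 \<le> n)"

lemma rank_ok_ge3: "rank_ok X n \<Longrightarrow> 3 \<le> n"
  by (cases X) (auto simp: rank_ok_def)

lemma lo_hi_less: "node_lo X n i < node_hi X n i"
  by (auto simp: node_simps)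

lemma small_dvd_iff:
  assumes "\<bar>d\<bar> < 2 * int n" shows "2 * int n dvd d \<longleftrightarrow> d = 0"
  using assms zdvd_imp_le[of "2 * int n" "\<bar>d\<bar>"] by auto

lemma lo_hi_not_dvd:
  assumes "rank_ok X n" shows "\<not> 2 * int n dvd node_lo X n i - node_hi X n i"
proof -
  have "\<bar>node_lo X n i - node_hi X n i\<bar> < 2 * int n" "node_lo X n i \<noteq> node_hi X n i"
    using rank_ok_ge3[OF assms] by (auto simp: node_simps)
  then show ?thesis using small_dvd_iff by simp
qed

definition simple_perm :: "affine_type \<Rightarrow> nat \<Rightarrow> nat \<Rightarrow> int \<Rightarrow> int" where
  "simple_perm X n i = affine_refl n (node_lo X n i) (node_hi X n i)"

lemma simple_perm_invol: "rank_ok X n \<Longrightarrow> simple_perm X n i (simple_perm X n i m) = m"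
  unfolding simple_perm_def by (intro refl_invol lo_hi_not_dvd)

lemma simple_perm_lo: "simple_perm X n i (node_lo X n i) = node_hi X n i"
  unfolding simple_perm_def by (simp add: refl_up)

lemma simple_perm_hi: "rank_ok X n \<Longrightarrow> simple_perm X n i (node_hi X n i) = node_lo X n i"
  by (metis simple_perm_invol simple_perm_lo)

text \<open>
  The reflection moves each position by at most one, so it can only invert neighbours, and it inverts
  exactly those that it interchanges. Any inverted pair is therefore its own root.
\<close>

lemma refl_adjacent_inversion:
  assumes nd: "\<not> 2 * int n dvd (-1)" and ab: "a < b" and inv: "affine_refl n c (c + 1) a > affine_refl n c (c + 1) b"
  shows "affine_refl n a b = affine_refl n c (c + 1)" "b = a + 1" "2 * int n dvd a - c \<or> 2 * int n dvd a + c"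
proof -
  have cc: "\<not> 2 * int n dvd c - (c + 1)" using nd by simp
  have a: "affine_refl n c (c + 1) a \<le> a + 1" 
     "affine_refl n c (c + 1) a = a + 1 \<Longrightarrow> 2 * int n dvd a - c \<or> 2 * int n dvd a + c"
    by (rule refl_cases[OF cc, of a], auto)+
  have b: "affine_refl n c (c + 1) b \<ge> b - 1"
    by (rule refl_cases[OF cc, of b], auto)
  show b1: "b = a + 1" using a b ab inv by linarith
  have up: "affine_refl n c (c + 1) a = a + 1"  using a(1) b inv b1 by linarith
  show c: "2 * int n dvd a - c \<or> 2 * int n dvd a + c" using a(2)[OF up] .
  show "affine_refl n a b = affine_refl n c (c + 1)"
    using c
  proof
    assume "2 * int n dvd a - c"
    then show ?thesis using refl_cong[of n a c b "c + 1"] b1 by simp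
  next
    assume "2 * int n dvd a + c"
    then have "affine_refl n a b = affine_refl n (1 - (c + 1)) (1 - c)"
      using b1 by (intro refl_cong) auto
    also have "\<dots> = affine_refl n c (c + 1)" using refl_mirror[OF cc] .
    finally show ?thesis .
  qed
qed

text \<open>
  The reflection in \<open>(c - 1, c + 1)\<close> also inverts the pairs \<open>(c, c + 1)\<close> and \<open>(c - 1, c + 2)\<close> that
  are symmetric under the mirror \<open>m \<mapsto> 2c + 1 - m\<close>. They stand for multiples of some \<open>\<epsilon>\<^sub>k\<close>, which
  are not roots for the types concerned; the last assumption excludes them. What remains is the pair
  itself and its mirror image.
\<close>

lemma refl_across_mirror_inversion:
  assumes n: "3 \<le> n" and c: "2 * int n dvd 2 * c" and ab: "a < b" 
    and inv: "affine_refl n (c - 1) (c + 1) a > affine_refl n (c - 1) (c + 1) b"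
    and cross: "\<not> 4 * int n dvd a + b - (2 * c + 1)"
  shows "affine_refl n a b = affine_refl n (c - 1) (c + 1)"
proof -
  let ?N = "2 * int n"
  have cc: "\<not> ?N dvd (c - 1) - (c + 1)" using n by (simp add: small_dvd_iff)
  have trans: "?N dvd y + k" if "?N dvd x" "y + k = x + l" "l = 0 \<or> l = 2 * c \<or> l = - 2 * c" for x y k l
  proof -
    have "?N dvd l" using that(3) c by auto
    then show ?thesis using that by auto
  qed
  define sh where "sh m = affine_refl n (c - 1) (c + 1) m - m" for m
  have small: "\<not> ?N dvd x" if "x \<noteq> 0" "\<bar>x\<bar> < 6" for x
    using n that by (subst small_dvd_iff) auto
  have comb: False if "?N dvd m - x" "?N dvd m - y" "x \<noteq> y" "\<bar>x - y\<bar> < 6" for x y m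
    using dvd_sub2[OF that(2,1), of "x - y"] small[of "x - y"] that(3,4) by auto
  have sh: "sh m = 2 \<and> (?N dvd m - (c - 1) \<or> ?N dvd m - c) \<or>
     sh m = - 2 \<and> (?N dvd m - (c + 1) \<or> ?N dvd m - (c + 2)) \<or>
     sh m = 0 \<and> \<not> ?N dvd m - (c - 1) \<and> \<not> ?N dvd m - c \<and> 
         \<not> ?N dvd m - (c + 1) \<and> \<not> ?N dvd m - (c + 2)" for m
  proof -
    have 1: "?N dvd m + (c + 1) - 1 \<longleftrightarrow> ?N dvd m - c"
      using dvd_add_left_iff[OF c, of "m - c"] by (simp add: algebra_simps)
    have 2: "?N dvd m + (c - 1) - 1 \<longleftrightarrow> ?N dvd m - (c + 2)"
      using dvd_add_left_iff[OF c, of "m - (c + 2)"] by (simp add: algebra_simps)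
    show ?thesis unfolding sh_def
      by (rule refl_cases[OF cc, of m]; unfold 1 2) auto
  qed
  have four: False if "?N dvd a - x" "b = 2 * c + 1 - x + (a - x)" for x
  proof -
    from that(1) obtain k where "a = x + ?N * k" by (rule dvd_diffE)
    then have "a + b - (2 * c + 1) = 4 * int n * k" using that(2) by (simp add: algebra_simps)
    then show False using cross by simp
  qed
  have ineq: "b - a < sh a - sh b" using inv unfolding sh_def by linarith
  have bshift: "?N dvd b - x \<longleftrightarrow> ?N dvd a - (x - (b - a))" for x by simp
  \<comment> \<open>Positions \<open>c - 1\<close> and \<open>c\<close> move up by two, \<open>c + 1\<close> and \<open>c + 2\<close> move down by two, so \<open>b - a < 4\<close>.\<close>
  have main: "(?N dvd a - (c - 1) \<or> ?N dvd a - c) \<and> b = a + 2"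
  proof -
    consider (up1) "sh a = 2" "?N dvd a - (c - 1)" | (up2) "sh a = 2" "?N dvd a - c"
      | (dn) "sh a = -2"
      | (st) "sh a = 0" "\<not> ?N dvd a - (c - 1) \<and> \<not> ?N dvd a - c \<and> \<not> ?N dvd a - (c + 1) \<and> \<not> ?N dvd a - (c + 2)"
      using sh[of a] by auto
    then show ?thesis
    proof cases
      case up1
      have "b \<noteq> a + 1"
      proof
        assume b: "b = a + 1"
        have "?N dvd b - c" using up1(2) b by (simp add: algebra_simps)
        then have "sh b = 2" using sh[of b] comb[of b c "c+1"] comb[of b c "c+2"] by auto
        then show False using ineq up1 b by simp
      qed
      moreover have "b \<noteq> a + 3" using four[OF up1(2)] by auto
      moreover have "b - a < 4" using ineq up1 sh[of b] by linarith
      ultimately show ?thesis using up1 ab by linarith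
    next
      case up2
      have "b \<noteq> a + 1" using four[OF up2(2)] by auto
      moreover have "b \<noteq> a + 3"
      proof
        assume b: "b = a + 3"
        have "?N dvd b - (c + 3)" using up2(2) b by (simp add: algebra_simps)
        then have "sh b \<noteq> - 2" using sh[of b] comb[of b "c + 3" "c+1"] comb[of b "c+3" "c+2"] by auto
        then show False using ineq up2 b sh[of b] by linarith
      qed
      moreover have "b - a < 4" using ineq up2 sh[of b] by linarith
      ultimately show ?thesis using up2 ab by linarith
    next
      case dn
      then show ?thesis using ineq ab sh[of b] by linarith
    next
      case st
      then have "sh b = - 2" "b = a + 1" using ineq ab sh[of b] by linarith+
      then have "?N dvd b - (c + 1) \<or> ?N dvd b - (c + 2)" using sh[of b] by auto
      moreover have "b - (c + 1) = a - c" "b - (c + 2) = a - (c + 1)" using \<open>b = a + 1\<close> by auto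
      ultimately show ?thesis using st(2) by metis
    qed
  qed
  then consider "?N dvd a - (c - 1)" "b = a + 2" | "?N dvd a - c" "b = a + 2" by blast
  then show ?thesis
  proof cases
    case 1 then show ?thesis by (intro refl_cong) auto
  next
    case 2
    have "?N dvd a + c" using dvd_add2[OF 2(1) c, of "a + c"] by simp
    then have "affine_refl n a b = affine_refl n (1 - (c + 1)) (1 - (c - 1))"
      using 2(2) by (intro refl_cong) auto
    also have "\<dots> = affine_refl n (c - 1) (c + 1)" using refl_mirror[OF cc] .
    finally show ?thesis .
  qed
qed

text \<open>
  The pairs that stand for roots of the type. A pair that is its own mirror image up to a translation
  has \<open>a + b \<equiv> 1\<close> modulo \<open>2n\<close> and stands for an affine function \<open>\<plusminus>2\<epsilon>\<^sub>k + c\<close>; it counts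
  for both parities of \<open>c\<close> in type \<open>B\<close>, for one of them in type \<open>C\<close>, and for none in type \<open>D\<close>.
\<close>

definition admissible :: "affine_type \<Rightarrow> nat \<Rightarrow> int \<Rightarrow> int \<Rightarrow> bool" where
  "admissible X n a b \<longleftrightarrow> (case X of TB \<Rightarrow> True | TC \<Rightarrow> \<not> 4 * int n dvd a + b - 1 | TD \<Rightarrow> \<not> 2 * int n dvd a + b - 1)"

text \<open>
  The sum of a pair with \<open>a + b \<equiv> 1\<close> modulo \<open>2n\<close> is preserved exactly, not only modulo \<open>2n\<close>, since
  \<open>b\<close> is then the image of \<open>a\<close> under a mirror, and every mirror commutes with the permutation.
\<close>

lemma mirror_sum:
  assumes "affine_perm n G" shows "G a + G b = 2 * int n * k + 1 \<longleftrightarrow> a + b = 2 * int n * k + 1"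
proof -
  have "G a + G b = 2 * int n * k + 1 \<longleftrightarrow> G a = G (2 * int n * k + 1 - b)"
    using affine_perm_reflect[OF assms, of k b] by auto
  then show ?thesis using affine_perm_inj[OF assms] by auto
qed

lemma dvd_iff_ex: "(d::int) dvd x - 1 \<longleftrightarrow> (\<exists>k. x = d * k + 1)"
  by (auto simp: dvd_def algebra_simps)

lemma mirror_dvd:
  assumes "affine_perm n G"
  shows "2 * int n dvd G a + G b - 1 \<longleftrightarrow> 2 * int n dvd a + b - 1"
     "4 * int n dvd G a + G b - 1 \<longleftrightarrow> 4 * int n dvd a + b - 1"
proof -
  show "2 * int n dvd G a + G b - 1 \<longleftrightarrow> 2 * int n dvd a + b - 1"
    unfolding dvd_iff_ex using mirror_sum[OF assms] by simp
  have "G a + G b = 4 * int n * k + 1 \<longleftrightarrow> a + b = 4 * int n * k + 1" for k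
    using mirror_sum[OF assms, of a b "2 * k"] by (simp add: mult.assoc)
  then show "4 * int n dvd G a + G b - 1 \<longleftrightarrow> 4 * int n dvd a + b - 1"
    unfolding dvd_iff_ex by blast
qed

lemma admissible_invariant: "affine_perm n G \<Longrightarrow> admissible X n (G a) (G b) \<longleftrightarrow> admissible X n a b"
  by (cases X) (auto simp: admissible_def mirror_dvd)

lemma admissible_simple:
  assumes "rank_ok X n" "i \<le> n" shows "admissible X n (node_lo X n i) (node_hi X n i)"
proof -
  have n: "3 \<le> n" using rank_ok_ge3 assms by blast
  have 1: "\<not> 4 * int n dvd int i + (int i + 1) - 1" if "0 < i"
    using zdvd_imp_le[of "4 * int n" "2 * int i"] that assms(2) by auto
  have 2: "\<not> 2 * int n dvd int i + (int i + 1) - 1" if "0 < i" "i < n"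
    using zdvd_imp_le[of "2 * int n" "2 * int i"] that by auto
  have 3: "\<not> 4 * int n dvd - 1 + (int 0 + 1) - 1" "\<not> 2 * int n dvd - 1 + (int 0 + 1) - 1"
    using n zdvd_imp_le[of "4 * int n" 1] zdvd_imp_le[of "2 * int n" 1] by auto
  have 4: "\<not> 2 * int n dvd int n - 1 + (int n + 1) - 1" using even_not_dvd(1)[of n "int n"] by simp
  show ?thesis
  proof (cases X)
    case TC then show ?thesis using 1 3 by (cases "i = 0") (simp_all add: admissible_def node_simps)
  next
    case TD then show ?thesis using 2 3 4 assms(2) n
      by (cases "i = 0"; cases "i = n") (simp_all add: admissible_def node_simps)
  qed (simp add: admissible_def)
qed

text \<open>
  A simple reflection makes only one positive root negative.
\<close>

lemma simple_perm_inversion: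
  assumes X: "rank_ok X n" and i: "i \<le> n" and ab: "a < b" "admissible X n a b" and inv: "simple_perm X n i a > simple_perm X n i b"
  shows "affine_refl n a b = simple_perm X n i"
proof -
  have n: "3 \<le> n" using rank_ok_ge3 X by blast
  consider (adj) "node_lo X n i = int i" | (zero) "i = 0" "X \<noteq> TB" | (last) "i = n" "X = TD" "i \<noteq> 0"
    by (cases "i = 0"; cases "i = n"; cases X) (auto simp: node_simps)
  then show ?thesis
  proof cases
    case adj
    then show ?thesis using refl_adjacent_inversion(1)[of n a b "int i"] n ab(1) inv by (simp add: simple_perm_def node_hi.simps)
  next
    case zero
    have "\<not> 4 * int n dvd a + b - (2 * 0 + 1)"
      using ab(2) zero dvd_mult_right[of 2 "2 * int n" "a + b - 1"]
        dvd_trans[of "2 * int n" "4 * int n" "a + b - 1"] by (cases X) (auto simp: admissible_def)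
    then show ?thesis using refl_across_mirror_inversion[of n 0 a b] n zero ab(1) inv
      by (simp add: simple_perm_def node_simps)
  next
    case last
    have "\<not> 4 * int n dvd a + b - (2 * int n + 1)"
    proof
      assume "4 * int n dvd a + b - (2 * int n + 1)"
      then have "2 * int n dvd a + b - (2 * int n + 1)" using dvd_trans[of "2 * int n" "4 * int n"] by auto
      then have "2 * int n dvd a + b - 1" using dvd_add2[of "2 * int n" "a + b - (2 * int n + 1)" "2 * int n" "a + b - 1"] by simp
      then show False using ab(2) last by (simp add: admissible_def)
    qed
    then show ?thesis using refl_across_mirror_inversion[of n "int n" a b] n last ab(1) inv
      by (simp add: simple_perm_def node_simps)
  qed
qed

text \<open>
  The criterion for Coxeter groups from which the exchange condition follows: if \<open>\<alpha>\<^sub>i\<close> stays positive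
  under \<open>G\<close> but not under \<open>s\<^sub>j G\<close>, then \<open>G \<alpha>\<^sub>i = \<alpha>\<^sub>j\<close>, and the reflections are conjugate under \<open>G\<close>.
\<close>

lemma simple_perm_exchange:
  assumes X: "rank_ok X n" and ij: "i \<le> n" "j \<le> n" and G: "affine_perm n G" 
    and nd: "G (node_lo X n i) \<le> G (node_hi X n i)" and d: "simple_perm X n j (G (node_lo X n i)) > simple_perm X n j (G (node_hi X n i))"
  shows "simple_perm X n j \<circ> G = G \<circ> simple_perm X n i"
proof -
  have "G (node_lo X n i) \<noteq> G (node_hi X n i)" using affine_perm_inj[OF G] lo_hi_less[of X n i] by auto
  then have lt: "G (node_lo X n i) < G (node_hi X n i)" using nd by simp
  have adm: "admissible X n (G (node_lo X n i)) (G (node_hi X n i))"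
    using admissible_invariant[OF G] admissible_simple[OF X ij(1)] by blast
  have "simple_perm X n j = affine_refl n (G (node_lo X n i)) (G (node_hi X n i))" using simple_perm_inversion[OF X ij(2) lt adm d] by simp
  then show ?thesis using refl_conj[OF G] by (auto simp: simple_perm_def)
qed

section \<open>Descents and the condition on permutations\<close>

definition descents :: "affine_type \<Rightarrow> nat \<Rightarrow> (int \<Rightarrow> int) \<Rightarrow> nat set" where
  "descents X n G = {i. i \<le> n \<and> G (node_lo X n i) > G (node_hi X n i)}"

text \<open>
  The inner product of \<open>\<alpha>\<^sub>i\<close> and the image of \<open>\<alpha>\<^sub>j\<close> under \<open>H\<close>, up to the scaling of simple roots.
\<close>

definition root_pairing :: "affine_type \<Rightarrow> nat \<Rightarrow> (int \<Rightarrow> int) \<Rightarrow> nat \<Rightarrow> nat \<Rightarrow> int" where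
  "root_pairing X n H i j =
     pairing n (node_lo X n i) (H (node_lo X n j)) - pairing n (node_lo X n i) (H (node_hi X n j))
     - pairing n (node_hi X n i) (H (node_lo X n j)) + pairing n (node_hi X n i) (H (node_hi X n j))"

text \<open>
  The condition on the permutation of a minimal NGT, without the membership in the affine Weyl group. The
  last root of a word is the negative of the image of \<open>\<alpha>\<^sub>j\<close> under the inverse; so the inner product
  \<open>1\<close> means that the first and last root, both of norm two, add up to a root of norm two.
\<close>

definition ngt :: "affine_type \<Rightarrow> nat \<Rightarrow> (int \<Rightarrow> int) \<Rightarrow> nat \<Rightarrow> nat \<Rightarrow> bool" where
  "ngt X n G i j \<longleftrightarrow> i \<in> norm_two_nodes X n \<and> j \<in> norm_two_nodes X n \<and> descents X n G = {i} \<and> descents X n (finv G) = {j}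
      \<and> root_pairing X n (finv G) i j = 1"

lemma finv_finv: "affine_perm n G \<Longrightarrow> finv (finv G) = G"
  by (simp add: affine_perm_bij inv_inv_eq)

lemma finv_eqI: "affine_perm n G \<Longrightarrow> (\<And>m. G (H m) = m) \<Longrightarrow> finv G = H"
  by (metis affine_perm_inv_f ext)

lemma root_pairing_inv:
  assumes G: "affine_perm n G" shows "root_pairing X n (finv G) i j = root_pairing X n G j i"
proof -
  have "pairing n a (finv G b) = pairing n b (G a)" for a b
    using pairing_invariant[OF G, of a "finv G b"] affine_perm_f_inv[OF G, of b] pairing_commute by metis
  then show ?thesis by (simp add: root_pairing_def)
qed

lemma ngt_inv: "affine_perm n G \<Longrightarrow> ngt X n G i j \<Longrightarrow> ngt X n (finv G) j i"
  using root_pairing_inv by (auto simp: ngt_def finv_finv)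

section \<open>The diagram symmetries of types C and D\<close>

abbreviation end_swap :: "nat \<Rightarrow> nat \<Rightarrow> int \<Rightarrow> int" where
  "end_swap n c \<equiv> affine_refl n (int c) (int c + 1)"

text \<open>
  The nodes \<open>0\<close> and \<open>n\<close> of type \<open>B\<close> whose reflection acts on the diagram of the given type as the
  interchange of the two nodes of a fork.
\<close>

definition end_node :: "affine_type \<Rightarrow> nat \<Rightarrow> nat \<Rightarrow> bool" where
  "end_node X n c \<longleftrightarrow> (c = 0 \<and> X \<noteq> TB) \<or> (c = n \<and> X = TD)"

definition fork_swap :: "nat \<Rightarrow> nat \<Rightarrow> nat \<Rightarrow> nat" where
  "fork_swap n c i = (if c = 0 then (if i = 0 then 1 else if i = 1 then 0 else i)
     else (if i = n then n - 1 else if i = n - 1 then n else i))"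

lemma end_swap_small:
  assumes "3 \<le> n" "- 1 \<le> m" "m \<le> int n + 1"
  shows "end_swap n 0 m = (if m = 0 then 1 else if m = 1 then 0 else m)"
    "end_swap n n m = (if m = int n then int n + 1 else if m = int n + 1 then int n else m)"
proof -
  show "end_swap n 0 m = (if m = 0 then 1 else if m = 1 then 0 else m)"
    using assms by (simp add: affine_refl_def small_dvd_iff)
  have "2 * int n dvd m + int n \<longleftrightarrow> 2 * int n dvd m - int n" for m
    using dvd_add_triv_right_iff[of "2 * int n" "m - int n"] by (simp add: algebra_simps)
  from this[of m] this[of "m - 1"]
  have 1: "2 * int n dvd m + (int n + 1) - 1 \<longleftrightarrow> 2 * int n dvd m - int n" 
     "2 * int n dvd m + int n - 1 \<longleftrightarrow> 2 * int n dvd m - (int n + 1)"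
    by (auto simp: algebra_simps)
  show "end_swap n n m = (if m = int n then int n + 1 else if m = int n + 1 then int n else m)"
    using assms unfolding affine_refl_def 1 by (simp add: small_dvd_iff)
qed

lemma affine_perm_end_swap: assumes "3 \<le> n" shows "affine_perm n (end_swap n c)"
  by (intro affine_perm_refl) (use assms in \<open>simp add: small_dvd_iff\<close>)

lemma end_swap_invol: assumes "3 \<le> n" shows "end_swap n c (end_swap n c m) = m"
  by (intro refl_invol) (use assms in \<open>simp add: small_dvd_iff\<close>)

lemma finv_end_swap: "3 \<le> n \<Longrightarrow> finv (end_swap n c) = end_swap n c"
  by (rule finv_eqI[OF affine_perm_end_swap]) (auto intro: end_swap_invol)

lemma finv_comp: "affine_perm n G \<Longrightarrow> affine_perm n H \<Longrightarrow> finv (G \<circ> H) = finv H \<circ> finv G"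
  by (simp add: affine_perm_bij o_inv_distrib)

text \<open>
  A pair is inverted by \<open>s\<^sub>c\<close> only if it consists of two neighbours exchanged by the mirror at
  \<open>c + 1/2\<close> or by a translate of it under \<open>2n\<close>; its sum then is as excluded in the assumption.
\<close>

lemma end_swap_order:
  assumes n: "3 \<le> n" and c: "c = 0 \<or> c = n" and ne: "a \<noteq> b" and sum: "\<not> 4 * int n dvd a + b - (2 * int c + 1)"
  shows "end_swap n c a > end_swap n c b \<longleftrightarrow> a > b"
proof -
  have key: False if "a < b" "end_swap n c a > end_swap n c b" "\<not> 4 * int n dvd a + b - (2 * int c + 1)" for a b
  proof -
    have "\<not> 2 * int n dvd - 1" using n by (simp add: small_dvd_iff)
    from refl_adjacent_inversion(2,3)[OF this that(1,2)]
    have 1: "b = a + 1" "2 * int n dvd a - int c \<or> 2 * int n dvd a + int c" by auto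
    have "2 * int n dvd a - int c" 
    proof -
      have "2 * int n dvd 2 * int c" using c by auto
      then show ?thesis using 1(2) dvd_sub2[of "2 * int n" "a + int c" "2 * int c" "a - int c"] by auto
    qed
    then obtain k where "a = int c + 2 * int n * k" by (rule dvd_diffE)
    then have "a + b - (2 * int c + 1) = 4 * int n * k" using 1(1) by simp
    then show False using that(3) by simp
  qed
  have inj: "end_swap n c a \<noteq> end_swap n c b" using ne end_swap_invol[OF n] by metis
  show ?thesis using key[of a b] key[of b a] sum inj ne by (metis add.commute linorder_neqE_linordered_idom not_less_iff_gr_or_eq)
qed

lemma sum_2c: 
  assumes "c = 0 \<or> c = n" "4 * int n dvd s - (2 * int c + 1)"
  shows "2 * int n dvd s - 1" "c = 0 \<Longrightarrow> 4 * int n dvd s - 1"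
proof -
  have "2 * int n dvd s - (2 * int c + 1)" using assms(2) dvd_trans[of "2 * int n" "4 * int n"] by auto
  then show "2 * int n dvd s - 1"
    using assms(1) dvd_add2[of "2 * int n" "s - (2 * int n + 1)" "2 * int n" "s - 1"] by auto
  show "c = 0 \<Longrightarrow> 4 * int n dvd s - 1" using assms(2) by simp
qed

text \<open>
  Multiplication by \<open>s\<^sub>c\<close> on the left does not change which positive roots become negative, because
  \<open>s\<^sub>c\<close> preserves the set of positive roots of this type.
\<close>

lemma descents_end_swap_left:
  assumes X: "rank_ok X n" "end_node X n c" and H: "affine_perm n H"
  shows "descents X n (end_swap n c \<circ> H) = descents X n H"
proof -
  have n: "3 \<le> n" and c: "c = 0 \<or> c = n" using rank_ok_ge3 X by (auto simp: end_node_def)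
  have "end_swap n c (H (node_lo X n i)) > end_swap n c (H (node_hi X n i)) \<longleftrightarrow> H (node_lo X n i) > H (node_hi X n i)" if i: "i \<le> n" for i
  proof (rule end_swap_order[OF n c])
    show "H (node_lo X n i) \<noteq> H (node_hi X n i)" using affine_perm_inj[OF H] lo_hi_less[of X n i] by auto
    have adm: "admissible X n (H (node_lo X n i)) (H (node_hi X n i))"
      using admissible_invariant[OF H] admissible_simple[OF X(1) i] by blast
    show "\<not> 4 * int n dvd H (node_lo X n i) + H (node_hi X n i) - (2 * int c + 1)"
    proof
      assume *: "4 * int n dvd H (node_lo X n i) + H (node_hi X n i) - (2 * int c + 1)"
      show False using sum_2c[OF c *] adm X(2) by (cases X) (auto simp: admissible_def end_node_def add.commute)
    qed
  qed
  then show ?thesis by (auto simp: descents_def)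
qed

lemma fork_swap_le: "end_node X n c \<Longrightarrow> 3 \<le> n \<Longrightarrow> i \<le> n \<Longrightarrow> fork_swap n c i \<le> n"
  by (auto simp: fork_swap_def)

lemma fork_swap_invol: "3 \<le> n \<Longrightarrow> fork_swap n c (fork_swap n c i) = i"
  by (auto simp: fork_swap_def)

lemma fork_swap_mid: "end_node X n c \<Longrightarrow> 3 \<le> n \<Longrightarrow> i \<in> norm_two_nodes X n \<Longrightarrow> fork_swap n c i \<in> norm_two_nodes X n"
  by (cases X) (auto simp: fork_swap_def end_node_def norm_two_nodes_def)

text \<open>
  The reflection \<open>s\<^sub>c\<close> interchanges the simple pairs of the fork, up to mirror images.
\<close>

lemma end_swap_pair:
  assumes X: "rank_ok X n" "end_node X n c" and i: "i \<le> n"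
  shows "(end_swap n c (node_lo X n (fork_swap n c i)) = node_lo X n i \<and> end_swap n c (node_hi X n (fork_swap n c i)) = node_hi X n i)
    \<or> (end_swap n c (node_lo X n (fork_swap n c i)) = 1 - node_hi X n i \<and> end_swap n c (node_hi X n (fork_swap n c i)) = 1 - node_lo X n i)"
proof -
  have n: "3 \<le> n" "X = TD \<Longrightarrow> 4 \<le> n" using rank_ok_ge3 X by (auto simp: rank_ok_def)
  show ?thesis
  proof (cases "c = 0")
    case True
    have X': "X \<noteq> TB" using True X n by (auto simp: end_node_def)
    consider "i = 0" | "i = 1" | "2 \<le> i" by linarith
    then show ?thesis
      using True n X' i by cases (simp_all add: fork_swap_def node_simps end_swap_small(1)[simplified])
  next
    case False
    then have X': "X = TD" "c = n" "4 \<le> n" using X n by (auto simp: end_node_def)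
    consider "i = n" | "i = n - 1" | "i \<le> n - 2" using i by linarith
    then show ?thesis
      using X' n(1) i False by cases (auto simp add: fork_swap_def node_simps end_swap_small(2))
  qed
qed

lemma descents_end_swap_right:
  assumes X: "rank_ok X n" "end_node X n c" and G: "affine_perm n G" and i: "i \<le> n"
  shows "fork_swap n c i \<in> descents X n (G \<circ> end_swap n c) \<longleftrightarrow> i \<in> descents X n G"
  using end_swap_pair[OF X i] i fork_swap_le[OF X(2) rank_ok_ge3[OF X(1)] i]
  by (auto simp: descents_def affine_perm_mirror[OF G])

lemma descents_end_swap_right_singleton:
  assumes X: "rank_ok X n" "end_node X n c" and G: "affine_perm n G" and d: "descents X n G = {i}"
  shows "descents X n (G \<circ> end_swap n c) = {fork_swap n c i}"
proof -
  have n: "3 \<le> n" using rank_ok_ge3 X by blast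
  have "k \<in> descents X n (G \<circ> end_swap n c) \<longleftrightarrow> k = fork_swap n c i" for k
  proof (cases "k \<le> n")
    case True
    have "k \<in> descents X n (G \<circ> end_swap n c) \<longleftrightarrow> fork_swap n c k \<in> descents X n G"
      using descents_end_swap_right[OF X G fork_swap_le[OF X(2) n True]] fork_swap_invol[OF n] by simp
    then show ?thesis using d fork_swap_invol[OF n] by auto
  next
    case False
    have "i \<le> n" using d by (auto simp: descents_def)
    then show ?thesis using False fork_swap_le[OF X(2) n, of i] by (auto simp: descents_def)
  qed
  then show ?thesis by blast
qed

lemma ngt_end_swap_right:
  assumes X: "rank_ok X n" "end_node X n c" and G: "affine_perm n G" and ng: "ngt X n G i j"
  shows "ngt X n (G \<circ> end_swap n c) (fork_swap n c i) j"
proof -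
  have n: "3 \<le> n" using rank_ok_ge3 X by blast
  let ?e = "end_swap n c" let ?i = "fork_swap n c i"
  have e: "affine_perm n ?e" using affine_perm_end_swap[OF n] .
  have fi: "finv (G \<circ> ?e) = ?e \<circ> finv G" using finv_comp[OF G e] finv_end_swap[OF n] by simp
  have i: "i \<le> n" using ng by (auto simp: ngt_def descents_def)
  have p: "pairing n a (?e b) = pairing n (?e a) b" for a b
    using pairing_invariant[OF e, of "?e a" b] end_swap_invol[OF n] by simp
  have m: "pairing n (1 - a) b = - pairing n a b" for a b by (rule pairing_mirror)
  have "root_pairing X n (?e \<circ> finv G) ?i j = root_pairing X n (finv G) i j"
    using end_swap_pair[OF X i] by (auto simp: root_pairing_def p m)
  then show ?thesis using ng descents_end_swap_right_singleton[OF X G] 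
      descents_end_swap_left[OF X affine_perm_inv[OF G]] fork_swap_mid[OF X(2) n] fi
    by (auto simp: ngt_def)
qed

text \<open>
  Passing to the inverse reduces this to the multiplication on the right.
\<close>

lemma ngt_end_swap_left:
  assumes X: "rank_ok X n" "end_node X n c" and G: "affine_perm n G" and ng: "ngt X n G i j"
  shows "ngt X n (end_swap n c \<circ> G) i (fork_swap n c j)"
proof -
  have n: "3 \<le> n" using rank_ok_ge3 X by blast
  have e: "affine_perm n (end_swap n c)" using affine_perm_end_swap[OF n] .
  have "ngt X n (finv G \<circ> end_swap n c) (fork_swap n c j) i"
    using ngt_end_swap_right[OF X affine_perm_inv[OF G] ngt_inv[OF G ng]] .
  moreover have "finv (end_swap n c \<circ> G) = finv G \<circ> end_swap n c" 
    using finv_comp[OF e G] finv_end_swap[OF n] by simp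
  ultimately have "ngt X n (finv (end_swap n c \<circ> G)) (fork_swap n c j) i" by simp
  then show ?thesis
    using ngt_inv[OF affine_perm_inv[OF affine_perm_comp[OF e G]], of X "fork_swap n c j" i]
       finv_finv[OF affine_perm_comp[OF e G]] by simp
qed

section \<open>Shortest elements of double cosets\<close>

text \<open>
  No descent of type \<open>B\<close> at node \<open>c\<close>, neither on the right nor on the left.
\<close>

definition end_ascent :: "(int \<Rightarrow> int) \<Rightarrow> nat \<Rightarrow> bool" where
  "end_ascent G c \<longleftrightarrow> G (int c) < G (int c + 1) \<and> finv G (int c) < finv G (int c + 1)"

text \<open>
  Multiply by \<open>s\<^sub>c\<close> on the right if there is a right descent, and then on the left if there is a left
  descent. The second step could only destroy the first one if the permutation maps the pair
  \<open>(c, c + 1)\<close> to itself up to a translation; the sum of the pair is preserved, so the pair is then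
  fixed, and there is no left descent.
\<close>

lemma end_normalise:
  assumes n: "3 \<le> n" and c: "c = 0 \<or> c = n" and G: "affine_perm n G"
  obtains G' where "G' \<in> {G, G \<circ> end_swap n c, end_swap n c \<circ> G, end_swap n c \<circ> G \<circ> end_swap n c}" "end_ascent G' c"
proof -
  let ?e = "end_swap n c"
  have e: "affine_perm n ?e" using affine_perm_end_swap[OF n] .
  have ec: "?e (int c) = int c + 1" "?e (int c + 1) = int c" using c end_swap_small[OF n] n by auto
  have stp: "\<exists>G1\<in>{G, G \<circ> ?e}. G1 (int c) < G1 (int c + 1)" if "affine_perm n G" for G
    using ec affine_perm_inj[OF that, of "int c" "int c + 1"] by (auto simp: not_less le_less)
  obtain G1 where G1: "G1 \<in> {G, G \<circ> ?e}" "G1 (int c) < G1 (int c + 1)" using stp[OF G] by blast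
  have aG1: "affine_perm n G1" using G1(1) G affine_perm_comp[OF G e] by auto
  show thesis
  proof (cases "finv G1 (int c) < finv G1 (int c + 1)")
    case True
    then show ?thesis using that[of G1] G1 by (auto simp: end_ascent_def)
  next
    case False
    have aH: "affine_perm n (finv G1)" using affine_perm_inv[OF aG1] .
    have gt: "finv G1 (int c) > finv G1 (int c + 1)" using False affine_perm_inj[OF aH, of "int c" "int c + 1"] by linarith
    have "?e (G1 (int c + 1)) > ?e (G1 (int c)) \<longleftrightarrow> G1 (int c + 1) > G1 (int c)"
    proof (rule ccontr)
      assume "\<not> ?thesis"
      then have inv: "?e (G1 (int c)) > ?e (G1 (int c + 1))" 
        using G1(2) affine_perm_inj[OF e, of "G1 (int c)" "G1 (int c + 1)"] by linarith
      have nd: "\<not> 2 * int n dvd - 1" using n by (simp add: small_dvd_iff)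
      from refl_adjacent_inversion(2,3)[OF nd G1(2) inv]
      have b: "G1 (int c + 1) = G1 (int c) + 1" "2 * int n dvd G1 (int c) - int c \<or> 2 * int n dvd G1 (int c) + int c" .
      have nk: "\<exists>k. 2 * int c = 2 * int n * k" using c by (metis mult_zero_right mult_1_right of_nat_0)
      then obtain k where k: "2 * int c = 2 * int n * k" by blast
      have "G1 (int c) + G1 (int c + 1) = 2 * int n * k + 1"
        using mirror_sum[OF aG1, of "int c" "int c + 1" k] k by simp
      then have "G1 (int c) = int c" using b(1) k by simp
      then have "finv G1 (int c) = int c" "finv G1 (int c + 1) = int c + 1"
        using b(1) affine_perm_inv_f[OF aG1] by metis+
      then show False using gt by simp
    qed
    moreover have "finv (?e \<circ> G1) = finv G1 \<circ> ?e" using finv_comp[OF e aG1] finv_end_swap[OF n] by simp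
    ultimately have "end_ascent (?e \<circ> G1) c" using G1(2) gt ec by (simp add: end_ascent_def)
    then show ?thesis using that[of "?e \<circ> G1"] G1(1) by (auto simp: comp_assoc)
  qed
qed

text \<open>
  The reflection \<open>s\<^sub>n\<close> fixes \<open>0\<close> and \<open>1\<close>, and it could only invert their images if these were
  exchanged by a mirror at \<open>n + 1/2\<close>, whereas their sum is \<open>1\<close>.
\<close>

lemma end_ascent_other:
  assumes n: "3 \<le> n" and G: "affine_perm n G" and a: "end_ascent G 0"
  shows "end_ascent (G \<circ> end_swap n n) 0" "end_ascent (end_swap n n \<circ> G) 0"
proof -
  let ?e = "end_swap n n"
  have e: "affine_perm n ?e" using affine_perm_end_swap[OF n] .
  have e0: "?e 0 = 0" "?e 1 = 1" using end_swap_small(2)[OF n] n by auto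
  have L: "?e (G 0) < ?e (G 1)" if "affine_perm n G" "G 0 < G 1" for G
  proof -
    have "?e (G 1) > ?e (G 0) \<longleftrightarrow> G 1 > G 0"
    proof (rule end_swap_order[OF n])
      show "G 1 \<noteq> G 0" using that by simp
      have "G 0 + G 1 = 1" using affine_perm_mirror[OF that(1), of 0] by simp
      then have "G 1 + G 0 - (2 * int n + 1) = - 2 * int n" by simp
      moreover have "\<not> 4 * int n dvd - 2 * int n" using n zdvd_imp_le[of "4 * int n" "2 * int n"] by auto
      ultimately show "\<not> 4 * int n dvd G 1 + G 0 - (2 * int n + 1)" by metis
    qed simp
    then show ?thesis using that by simp
  qed
  have f: "finv (G \<circ> ?e) = ?e \<circ> finv G" "finv (?e \<circ> G) = finv G \<circ> ?e"
    using finv_comp[OF e G] finv_comp[OF G e] finv_end_swap[OF n] by auto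
  show "end_ascent (G \<circ> end_swap n n) 0" "end_ascent (end_swap n n \<circ> G) 0"
    using a L[OF G] L[OF affine_perm_inv[OF G]] e0 f by (auto simp: end_ascent_def)
qed

text \<open>
  Without descents at the end nodes of type \<open>B\<close> the forks cannot be descents either: \<open>G 0 < G 1\<close> and
  a descent at \<open>(-1, 1)\<close> would make \<open>(1, 2)\<close> a second descent, and similarly at \<open>n\<close>. All other
  nodes have the same pairs in both types.
\<close>

lemma ngt_TB_I:
  assumes X: "rank_ok X n" "X \<noteq> TB" and G: "affine_perm n G" and ng: "ngt X n G i j"
    and a: "end_ascent G 0" "X = TD \<Longrightarrow> end_ascent G n"
  shows "ngt TB n G i j"
proof -
  have n: "3 \<le> n" using rank_ok_ge3 X by blast
  have main: "descents TB n G = {i} \<and> 0 < i \<and> i < n" if G: "affine_perm n G" and "descents X n G = {i}" "i \<in> norm_two_nodes X n"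
    "G 0 < G 1" "X = TD \<Longrightarrow> G (int n) < G (int n + 1)" for G i
  proof -
    have d: "G (node_lo X n k) > G (node_hi X n k) \<longleftrightarrow> k = i" if "k \<le> n" for k using \<open>descents X n G = {i}\<close> that by (auto simp: descents_def)
    have m: "G (-1) = 1 - G 2" "G 0 = 1 - G 1" using affine_perm_mirror[OF G, of 2] affine_perm_mirror[OF G, of 1] by auto
    have "i \<noteq> 0"
    proof
      assume "i = 0"
      then show False using d[of 0] d[of 1] n X(2) m that(4) by (simp add: node_simps)
    qed
    moreover have "i \<noteq> n"
    proof
      assume i: "i = n"
      then have X: "X = TD" using that(3) X(2) by (cases X) (auto simp: norm_two_nodes_def)
      have "int (n - 1) = int n - 1" using n by simp
      then show False using d[of n] d[of "n-1"] n X i that(5) by (auto simp: node_simps)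
    qed
    ultimately have i: "0 < i" "i < n" using that(2) by (auto simp: descents_def)
    have nn: "\<not> G (int n) > G (int n + 1)" if "X = TC" using d[of n] n i that by (auto simp: node_simps)
    have "k \<in> descents TB n G \<longleftrightarrow> k = i" for k
    proof -
      consider "k = 0" | "k = n" | "0 < k" "k < n" | "k > n" by linarith
      then show ?thesis
      proof cases
        case 1 then show ?thesis using i that(4) by (auto simp: descents_def node_simps)
      next
        case 2 then show ?thesis using i that(5) nn n X(2) by (cases X) (auto simp: descents_def node_simps)
      next
        case 3 then show ?thesis using d[of k] by (auto simp: descents_def node_simps)
      next
        case 4 then show ?thesis using i by (auto simp: descents_def)
      qed
    qed
    then show ?thesis using i by blast
  qed
  have 1: "descents TB n G = {i} \<and> 0 < i \<and> i < n" using main[OF G] ng a by (auto simp: ngt_def end_ascent_def)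
  have 2: "descents TB n (finv G) = {j} \<and> 0 < j \<and> j < n" using main[OF affine_perm_inv[OF G]] ng a by (auto simp: ngt_def end_ascent_def)
  have "root_pairing TB n (finv G) i j = root_pairing X n (finv G) i j" 
    using 1 2 by (simp add: root_pairing_def node_simps)
  then show ?thesis using 1 2 ng by (auto simp: ngt_def norm_two_nodes_def)
qed

text \<open>
  Conversely, a solution in type \<open>B\<close> is one in types \<open>C\<close> or \<open>D\<close> unless it has a descent at a fork.
\<close>

lemma ngt_TB_D:
  assumes X: "X \<noteq> TB" "3 \<le> n" and ng: "ngt TB n G i j"
    and a: "\<And>F. F \<in> {G, finv G} \<Longrightarrow> F (-1) < F 1" "\<And>F. X = TD \<Longrightarrow> F \<in> {G, finv G} \<Longrightarrow> F (int n - 1) < F (int n + 1)"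
  shows "ngt X n G i j"
proof -
  have ij: "0 < i" "i < n" "0 < j" "j < n" using ng by (auto simp: ngt_def norm_two_nodes_def)
  have "descents X n F = {k}" if "descents TB n F = {k}" "0 < k" "k < n" "F \<in> {G, finv G}" for F k
  proof -
    have "l \<in> descents X n F \<longleftrightarrow> l \<in> descents TB n F" for l
    proof -
      consider "l = 0" | "l = n" "X = TD" "l \<noteq> 0" | "l = n" "X = TC" "l \<noteq> 0" | "0 < l" "l < n" | "l > n" using X(1) by (cases X; cases "l = 0"; cases "l < n"; cases "l = n") auto
      then show ?thesis
      proof cases
        case 1 
        have "0 \<notin> descents TB n F" using that by auto
        then show ?thesis using a(1)[OF that(4)] X 1 by (auto simp: descents_def node_simps)
      next
        case 2
        have "n \<notin> descents TB n F" using that by auto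
        then show ?thesis using a(2)[OF _ that(4)] X 2 by (auto simp: descents_def node_simps)
      qed (auto simp: descents_def node_simps)
    qed
    then show ?thesis using that(1) by blast
  qed
  then have "descents X n G = {i}" "descents X n (finv G) = {j}" using ng ij by (auto simp: ngt_def)
  moreover have "root_pairing TB n (finv G) i j = root_pairing X n (finv G) i j" 
    using ij by (simp add: root_pairing_def node_simps)
  moreover have "i \<in> norm_two_nodes X n" "j \<in> norm_two_nodes X n" using ij by (cases X; auto simp: norm_two_nodes_def)+
  ultimately show ?thesis using ng by (simp add: ngt_def)
qed

section \<open>The diagram symmetry of type B\<close>

text \<open>
  The conjugation by \<open>m \<mapsto> n + 1 - m\<close>, which reverses the diagram of type \<open>B\<close>.
\<close>

definition flip :: "nat \<Rightarrow> (int \<Rightarrow> int) \<Rightarrow> int \<Rightarrow> int" where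
  "flip n G m = int n + 1 - G (int n + 1 - m)"

lemma flip_flip: "flip n (flip n G) = G"
  by (simp add: flip_def fun_eq_iff)

lemma flip_comp: "flip n (G \<circ> H) = flip n G \<circ> flip n H"
  by (simp add: flip_def fun_eq_iff)

lemma affine_perm_flip: assumes G: "affine_perm n G" shows "affine_perm n (flip n G)"
  unfolding affine_perm_def
proof (intro conjI allI)
  have "bij (\<lambda>m. int n + 1 - m)" by (rule o_bij[of "\<lambda>m. int n + 1 - m"]) auto
  then have "bij ((\<lambda>m. int n + 1 - m) \<circ> (G \<circ> (\<lambda>m. int n + 1 - m)))"
    using affine_perm_bij[OF G] by (intro bij_comp)
  moreover have "flip n G = (\<lambda>m. int n + 1 - m) \<circ> (G \<circ> (\<lambda>m. int n + 1 - m))" 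
    by (auto simp: flip_def)
  ultimately show "bij (flip n G)" by metis
  show "flip n G (1 - m) = 1 - flip n G m" for m
  proof -
    have "int n + 1 - (1 - m) = 2 * int n * 1 + 1 - (int n + 1 - m)" by simp
    then have "G (int n + 1 - (1 - m)) = 2 * int n * 1 + 1 - G (int n + 1 - m)"
      using affine_perm_reflect[OF G] by metis
    then show ?thesis by (simp add: flip_def)
  qed
  show "flip n G (m + 2 * int n) = flip n G m + 2 * int n" for m
    using affine_perm_shift[OF G, of "int n + 1 - m" "-1"] by (simp add: flip_def algebra_simps)
qed

lemma finv_flip: assumes G: "affine_perm n G" shows "finv (flip n G) = flip n (finv G)"
  by (rule finv_eqI[OF affine_perm_flip[OF G]]) (simp add: flip_def affine_perm_f_inv[OF G])

lemma descents_flip: 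
  assumes "descents TB n G = {i}"
  shows "descents TB n (flip n G) = {n - i}"
proof -
  have i: "i \<le> n" using assms by (auto simp: descents_def)
  have e: "k \<in> descents TB n (flip n G) \<longleftrightarrow> n - k \<in> descents TB n G" if "k \<le> n" for k
  proof -
    have "int n + 1 - int k = int (n - k) + 1" "int n + 1 - (int k + 1) = int (n - k)" using that by auto
    then have "flip n G (int k) = int n + 1 - G (int (n - k) + 1)" "flip n G (int k + 1) = int n + 1 - G (int (n - k))"
      by (simp_all only: flip_def)
    then show ?thesis using that by (simp add: descents_def node_lo.simps node_hi.simps)
  qed
  have "k \<in> descents TB n (flip n G) \<longleftrightarrow> k = n - i" for k 
  proof (cases "k \<le> n")
    case True
    show ?thesis unfolding e[OF True] assms using True i by auto
  qed (simp add: descents_def)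
  then show ?thesis by blast
qed

lemma pairing_flip: "pairing n (int n + 1 - a) (int n + 1 - b) = pairing n a b"
proof -
  have 1: "(int n + 1 - a) - (int n + 1 - b) = b - a" by simp
  have 2: "(int n + 1 - a) + (int n + 1 - b) - 1 = 2 * int n - (a + b - 1)" by simp
  have "2 * int n dvd 2 * int n - (a + b - 1) \<longleftrightarrow> 2 * int n dvd a + b - 1"
    by (rule dvd_diff_right_iff) simp
  then show ?thesis unfolding pairing_def 1 2 dvd_diff_commute[of _ b a] by simp
qed

lemma ngt_flip:
  assumes G: "affine_perm n G" and ng: "ngt TB n G i j"
  shows "ngt TB n (flip n G) (n - i) (n - j)"
proof -
  have ij: "0 < i" "i < n" "0 < j" "j < n" using ng by (auto simp: ngt_def norm_two_nodes_def)
  have e: "int (n - i) = int n - int i" "int (n - j) = int n - int j" using ij by auto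
  have p: "pairing n (int n - int i + d) (int n + 1 - x) = pairing n (int i + 1 - d) x" for x d
    using pairing_flip[of n "int i + 1 - d" x] by (simp add: algebra_simps)
  have q: "int n + 1 - (int n - int j) = int j + 1" "int n + 1 - (int n - int j + 1) = int j" by auto
  have "root_pairing TB n (flip n (finv G)) (n - i) (n - j) = root_pairing TB n (finv G) i j"
    using p[of 0] p[of 1] ij by (simp add: root_pairing_def node_simps flip_def e q)
  then show ?thesis using ng ij finv_flip[OF G] descents_flip by (auto simp: ngt_def norm_two_nodes_def)
qed

section \<open>Descents at one node in type B\<close>

lemma ascending_run:
  fixes G :: "int \<Rightarrow> int"
  assumes "\<And>m. a \<le> m \<Longrightarrow> m < b \<Longrightarrow> G m < G (m + 1)" and "a \<le> x" "x \<le> y" "y \<le> b"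
  shows "G x + (y - x) \<le> G y"
  using assms(3,4)
proof (induction y rule: int_ge_induct)
  case (step y)
  then show ?case using assms(1)[of y] assms(2) by simp
qed simp

text \<open>
  The absence of other descents makes \<open>G\<close> increasing between two neighbouring translates or mirror
  images of the position \<open>i + 1/2\<close>.
\<close>

lemma ngt_TB_runs:
  assumes G: "affine_perm n G" and d: "descents TB n G = {i}" and i: "i \<le> n"
  shows "\<And>m. 1 - int i \<le> m \<Longrightarrow> m < int i \<Longrightarrow> G m < G (m + 1)"
    and "\<And>m. int i + 1 \<le> m \<Longrightarrow> m < 2 * int n - int i \<Longrightarrow> G m < G (m + 1)"
proof -
  have k: "G (int k) < G (int k + 1)" if "k \<le> n" "k \<noteq> i" for k
  proof -
    have "k \<notin> descents TB n G" using d that by blast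
    then show ?thesis using that(1) affine_perm_inj[OF G, of "int k" "int k + 1"] by (simp add: descents_def node_simps)
  qed
  have pos: "G m < G (m + 1)" if "0 \<le> m" "m \<le> int n" "m \<noteq> int i" for m
    using k[of "nat m"] that by auto
  show "G m < G (m + 1)" if "1 - int i \<le> m" "m < int i" for m
  proof (cases "0 \<le> m")
    case True then show ?thesis using pos that i by simp
  next
    case False
    then have "G (- m) < G (1 - m)" using pos[of "- m"] that i by simp
    then show ?thesis using affine_perm_mirror[OF G, of m] affine_perm_mirror[OF G, of "m + 1"] by simp
  qed
  show "G m < G (m + 1)" if "int i + 1 \<le> m" "m < 2 * int n - int i" for m
  proof (cases "m \<le> int n")
    case True then show ?thesis using pos that by simp
  next
    case False
    then have "G (2 * int n - m) < G (2 * int n - m + 1)" using pos[of "2 * int n - m"] that by simp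
    moreover have "G (2 * int n - m) = 2 * int n + 1 - G (m + 1)" "G (2 * int n - m + 1) = 2 * int n + 1 - G m" 
      using affine_perm_reflect[OF G, of 1 "m + 1"] affine_perm_reflect[OF G, of 1 m] by (simp_all add: algebra_simps)
    ultimately show ?thesis by simp
  qed
qed

lemma ngt_TB_ascend:
  assumes G: "affine_perm n G" and d: "descents TB n G = {i}" and i: "i \<le> n"
  shows "1 - int i \<le> x \<Longrightarrow> x \<le> y \<Longrightarrow> y \<le> int i \<Longrightarrow> G x + (y - x) \<le> G y"
    and "int i + 1 \<le> x \<Longrightarrow> x \<le> y \<Longrightarrow> y \<le> 2 * int n - int i \<Longrightarrow> G x + (y - x) \<le> G y"
proof -
  show "1 - int i \<le> x \<Longrightarrow> x \<le> y \<Longrightarrow> y \<le> int i \<Longrightarrow> G x + (y - x) \<le> G y"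
    by (rule ascending_run[where a = "1 - int i" and b = "int i"]) (use ngt_TB_runs(1)[OF assms] in auto)
  show "int i + 1 \<le> x \<Longrightarrow> x \<le> y \<Longrightarrow> y \<le> 2 * int n - int i \<Longrightarrow> G x + (y - x) \<le> G y"
    by (rule ascending_run[where a = "int i + 1" and b = "2 * int n - int i"]) (use ngt_TB_runs(2)[OF assms] in auto)
qed

text \<open>
  The form in which the value \<open>\<plusminus>1\<close> of an inner product is used.
\<close>

lemma of_bool_cases:
  "(1::int) \<le> of_bool A - of_bool B - of_bool C + of_bool D \<Longrightarrow> A \<or> D"
  "of_bool A - of_bool B - of_bool C + of_bool D \<le> (- 1::int) \<Longrightarrow> C \<or> B"
  by (auto simp: of_bool_def split: if_splits)

text \<open>
  Let \<open>H\<close> be the inverse of \<open>G\<close>, and let \<open>H (j + 1)\<close> be the first position of a block for \<open>G\<close>. By the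
  symmetry about \<open>n + 1/2\<close> and monotonicity, \<open>H (j + 1) \<le> n\<close>. If the block were a translate of
  \<open>[1 - i, i]\<close>, then \<open>G (1 - i) \<le> 0\<close> would force a translation by at least \<open>2n\<close>, and
  \<open>H (j + 1)\<close> would be too large. So the block is a translate of \<open>[i + 1, 2n - i]\<close>, and
  \<open>G (i + 1) \<le> n\<close> shows that it is that block itself. Thus \<open>G\<close> maps \<open>i + 1\<close> to \<open>j + 1\<close> and, by
  symmetry, \<open>2n - i\<close> to \<open>2n - j\<close>; as both \<open>G\<close> and \<open>H\<close> are increasing in between, the two
  blocks have the same length and \<open>G\<close> is the identity there.
\<close>

lemma ngt_TB_first_case:
  assumes G: "affine_perm n G" and dG: "descents TB n G = {i}" and dH: "descents TB n (finv G) = {j}" 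
    and ij: "0 < i" "i < n" "0 < j" "j < n"
    and p: "2 * int n dvd finv G (int j + 1) - (int i + 1) \<or> 2 * int n dvd finv G (int j + 1) - (1 - int i)"
  shows "i = j" "\<And>m. int i + 1 \<le> m \<Longrightarrow> m \<le> 2 * int n - int i \<Longrightarrow> G m = m"
proof -
  let ?H = "finv G" let ?N = "2 * int n"
  have H: "affine_perm n ?H" using affine_perm_inv[OF G] .
  note rG = ngt_TB_ascend[OF G dG less_imp_le[OF ij(2)]]
  note rH = ngt_TB_ascend[OF H dH less_imp_le[OF ij(4)]]
  have half: "F (int n) \<le> int n" if F: "affine_perm n F" "descents TB n F = {k}" "0 < k" "k < n" for F k
  proof -
    have "F (int n) < F (int n + 1)" using ngt_TB_ascend(2)[OF F(1,2), of "int n" "int n + 1"] that by simp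
    moreover have "F (int n + 1) = 2 * int n + 1 - F (int n)" using affine_perm_reflect[OF F(1), of 1 "int n"] by simp
    ultimately show ?thesis by linarith
  qed
  have Hle: "?H (int j + 1) \<le> int n"
    using rH(2)[of "int j + 1" "int n"] half[OF H dH] ij by linarith
  have one: "F 1 \<ge> 1" if F: "affine_perm n F" "descents TB n F = {k}" "0 < k" "k < n" for F k
  proof -
    have "F 0 < F 1" using ngt_TB_ascend(1)[OF F(1,2), of 0 1] that by simp
    then show ?thesis using affine_perm_mirror[OF F(1), of 1] by simp
  qed
  have "\<not> ?N dvd ?H (int j + 1) - (1 - int i)"
  proof
    assume "?N dvd ?H (int j + 1) - (1 - int i)"
    then obtain s where s: "?H (int j + 1) = 1 - int i + ?N * s" by (rule dvd_diffE)
    have "G (1 - int i + ?N * s) = int j + 1" using s affine_perm_f_inv[OF G, of "int j + 1"] by simp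
    then have g: "G (1 - int i) + ?N * s = int j + 1" using affine_perm_shift[OF G] by simp
    have "G (1 - int i) \<le> G 0" using rG(1)[of "1 - int i" 0] ij by simp
    also have "\<dots> \<le> 0" using one[OF G dG ij(1,2)] affine_perm_mirror[OF G, of 1] by simp
    finally have "?N * s > 0" using g by linarith
    then have "s \<ge> 1" using ij by (simp add: zero_less_mult_iff)
    then have "?N * s \<ge> ?N" using mult_left_mono[of 1 s ?N] by simp
    then show False using s Hle ij by linarith
  qed
  then obtain s where s: "?H (int j + 1) = int i + 1 + ?N * s" using p by (auto elim: dvd_diffE)
  have g: "G (int i + 1) + ?N * s = int j + 1" 
    using s affine_perm_f_inv[OF G, of "int j + 1"] affine_perm_shift[OF G, of "int i + 1" s] by simp
  have "G (int i + 1) \<le> int n" using rG(2)[of "int i + 1" "int n"] half[OF G dG] ij by linarith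
  then have 1: "?N * s \<ge> int j + 1 - int n" using g by linarith
  have 2: "?N * s \<le> int n - int i - 1" using s Hle by linarith
  have "\<bar>?N * s\<bar> < ?N" using 1 2 ij by linarith
  then have s0: "s = 0" using small_dvd_iff[of "?N * s" n] ij by simp
  have Gi: "G (int i + 1) = int j + 1" "?H (int j + 1) = int i + 1" using g s s0 by auto
  have Gl: "G (?N - int i) = ?N - int j" "?H (?N - int j) = ?N - int i"
    using affine_perm_reflect[OF G, of 1 "int i + 1"] affine_perm_reflect[OF H, of 1 "int j + 1"] Gi by (simp_all add: algebra_simps)
  have "G (int i + 1) + (?N - int i - (int i + 1)) \<le> G (?N - int i)" 
    using rG(2)[of "int i + 1" "?N - int i"] ij by simp
  moreover have "?H (int j + 1) + (?N - int j - (int j + 1)) \<le> ?H (?N - int j)" 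
    using rH(2)[of "int j + 1" "?N - int j"] ij by simp
  ultimately show e: "i = j" using Gi Gl by linarith
  show "G m = m" if "int i + 1 \<le> m" "m \<le> 2 * int n - int i" for m
  proof -
    have "G (int i + 1) + (m - (int i + 1)) \<le> G m" "G m + (?N - int i - m) \<le> G (?N - int i)"
      using rG(2)[of "int i + 1" m] rG(2)[of m "?N - int i"] that by simp_all
    then show ?thesis using Gi Gl e by linarith
  qed
qed

definition fixes_bottom :: "nat \<Rightarrow> (int \<Rightarrow> int) \<Rightarrow> nat \<Rightarrow> bool" where
  "fixes_bottom n G i \<longleftrightarrow> (\<forall>m. int i + 1 \<le> m \<and> m \<le> 2 * int n - int i \<longrightarrow> G m = m)"

text \<open>
  The inner product is a difference \<open>\<phi> (H (j + 1)) - \<phi> (H j)\<close>, where \<open>\<phi>\<close> is \<open>1\<close> at the first and \<open>-1\<close>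
  at the last positions of blocks and \<open>0\<close> elsewhere. So it is \<open>1\<close> only if \<open>H (j + 1)\<close> is
  a first position or \<open>H j\<close> is a last one, and the reversal of the diagram turns the second case into
  the first.
\<close>

lemma ngt_TB_fixes:
  assumes G: "affine_perm n G" and ng: "ngt TB n G i j"
  shows "i = j \<and> (fixes_bottom n G i \<or> fixes_bottom n (flip n G) (n - i))"
proof -
  let ?H = "finv G" let ?N = "2 * int n"
  have ij: "0 < i" "i < n" "0 < j" "j < n" using ng by (auto simp: ngt_def norm_two_nodes_def)
  have d: "descents TB n G = {i}" "descents TB n ?H = {j}" using ng by (auto simp: ngt_def)
  \<comment> \<open>\<open>phi\<close> is \<open>1\<close> at first positions of blocks and \<open>-1\<close> at last ones.\<close>
  define phi where "phi m = pairing n (int i + 1) m - pairing n (int i) m" for m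
  have "phi (?H (int j + 1)) - phi (?H (int j)) = 1" using ng ij by (simp add: ngt_def root_pairing_def node_simps phi_def)
  then have phi: "phi (?H (int j + 1)) \<ge> 1 \<or> phi (?H (int j)) \<le> - 1" by linarith
  have phi_eq: "phi m = of_bool (?N dvd int i + 1 - m) - of_bool (?N dvd int i + 1 + m - 1)
      - of_bool (?N dvd int i - m) + of_bool (?N dvd int i + m - 1)" for m
    by (simp only: phi_def pairing_def)
  have p1: "?N dvd m - (int i + 1) \<or> ?N dvd m - (1 - int i)" if "phi m \<ge> 1" for m
  proof -
    have "?N dvd int i + 1 - m \<or> ?N dvd int i + m - 1"
      using that unfolding phi_eq by (rule of_bool_cases(1))
    moreover have "m - (1 - int i) = int i + m - 1" by simp
    ultimately show ?thesis using dvd_diff_commute[of ?N m "int i + 1"] by metis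
  qed
  have p2: "?N dvd m - int i \<or> ?N dvd m + int i" if "phi m \<le> - 1" for m
  proof -
    have "?N dvd int i - m \<or> ?N dvd int i + 1 + m - 1"
      using that unfolding phi_eq by (rule of_bool_cases(2))
    moreover have "int i + 1 + m - 1 = m + int i" by simp
    ultimately show ?thesis using dvd_diff_commute[of ?N m "int i"] by metis
  qed
  show ?thesis using phi
  proof
    assume "phi (?H (int j + 1)) \<ge> 1"
    from ngt_TB_first_case[OF G d ij p1[OF this]] show ?thesis by (auto simp: fixes_bottom_def)
  next
    assume "phi (?H (int j)) \<le> - 1"
    from p2[OF this] have q: "?N dvd ?H (int j) - int i \<or> ?N dvd ?H (int j) + int i" .
    let ?F = "flip n G"
    have F: "affine_perm n ?F" using affine_perm_flip[OF G] .
    have ngF: "ngt TB n ?F (n - i) (n - j)" using ngt_flip[OF G ng] .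
    have fF: "finv ?F (int (n - j) + 1) = int n + 1 - ?H (int j)"
      using ij by (simp add: finv_flip[OF G] flip_def)
    have "?N dvd finv ?F (int (n - j) + 1) - (int (n - i) + 1) \<or> ?N dvd finv ?F (int (n - j) + 1) - (1 - int (n - i))"
      using q
    proof
      assume "?N dvd ?H (int j) - int i"
      then have "?N dvd - (?H (int j) - int i)" by (simp only: dvd_minus_iff)
      moreover have "- (?H (int j) - int i) = finv ?F (int (n - j) + 1) - (int (n - i) + 1)"
        using fF ij by simp
      ultimately show ?thesis by metis
    next
      assume "?N dvd ?H (int j) + int i"
      then have "?N dvd ?N - (?H (int j) + int i)" by simp
      moreover have "?N - (?H (int j) + int i) = finv ?F (int (n - j) + 1) - (1 - int (n - i))" 
        using fF ij by simp
      ultimately show ?thesis by metis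
    qed
    from ngt_TB_first_case[OF F _ _ _ _ _ _ this] ngF ij
    have "n - i = n - j" "fixes_bottom n ?F (n - i)" 
      unfolding ngt_def fixes_bottom_def by (simp_all add: norm_two_nodes_def)
    then show ?thesis using ij by auto
  qed
qed

section \<open>Bunches and levels\<close>

lemma bunch_append_less: "j < length p \<Longrightarrow> bunch u (p @ q) j = bunch u p j"
  by (simp add: bunch_def)

lemma bunch_append_last: "bunch u (p @ [q]) (length p) = {u + sum_list p + 1..u + sum_list p + q}"
  by (simp add: bunch_def add.assoc)

lemma sum_list_take_mono: "j \<le> k \<Longrightarrow> sum_list (take j p) \<le> sum_list (take k (p :: nat list))"
proof -
  assume "j \<le> k"
  then have "take k p = take j p @ take (k - j) (drop j p)" by (metis le_add_diff_inverse take_add)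
  then show ?thesis by simp
qed

lemma bunch_bounds: 
  assumes "k \<in> bunch u p j" shows "u < k" "k \<le> u + sum_list p"
proof -
  have "sum_list (take (j + 1) p) \<le> sum_list p"
    using sum_list_take_mono[of "j + 1" "max (j + 1) (length p)" p] by simp
  then show "u < k" "k \<le> u + sum_list p" using assms by (auto simp: bunch_def)
qed

lemma bunch_disjoint:
  assumes "k \<in> bunch u p j" "k \<in> bunch u p j'" shows "j = j'"
proof -
  have False if "k \<in> bunch u p j" "k \<in> bunch u p j'" "j < j'" for j j'
    using sum_list_take_mono[of "j + 1" j' p] that by (auto simp: bunch_def)
  then show ?thesis using assms by (metis linorder_neqE_nat)
qed

lemma bunch_cover:
  assumes "u < k" "k \<le> u + sum_list p" shows "\<exists>j<length p. k \<in> bunch u p j"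
  using assms(2)
proof (induction p rule: rev_induct)
  case Nil then show ?case using assms(1) by simp
next
  case (snoc q p)
  show ?case
  proof (cases "k \<le> u + sum_list p")
    case True
    then obtain j where "j < length p" "k \<in> bunch u p j" using snoc by blast
    then show ?thesis using bunch_append_less[of j p u "[q]"] by (intro exI[of _ j]) simp
  next
    case False
    then have "k \<in> bunch u (p @ [q]) (length p)" using snoc.prems unfolding bunch_append_last by simp
    then show ?thesis by (intro exI[of _ "length p"]) simp
  qed
qed

text \<open>
  A bunch with an element is a nonempty interval, so its minimum and maximum are its end points.
\<close>

lemma bunch_rev_eq:
  assumes "k \<in> bunch u p j" 
  shows "bunch_rev u p j k = (u + sum_list (take j p) + 1) + (u + sum_list (take (j + 1) p)) - k"
proof -
  have "u + sum_list (take j p) + 1 \<le> u + sum_list (take (j + 1) p)" using assms unfolding bunch_def by auto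
  then have "Min (bunch u p j) = u + sum_list (take j p) + 1" "Max (bunch u p j) = u + sum_list (take (j + 1) p)"
    unfolding bunch_def by (auto intro!: Min_eqI Max_eqI)
  then show ?thesis unfolding bunch_rev_def by simp
qed

lemma bunch_rev_in:
  assumes "k \<in> bunch u p j" shows "bunch_rev u p j k \<in> bunch u p j" "bunch_rev u p j (bunch_rev u p j k) = k"
proof -
  show 1: "bunch_rev u p j k \<in> bunch u p j" using assms bunch_rev_eq[OF assms] by (auto simp: bunch_def)
  show "bunch_rev u p j (bunch_rev u p j k) = k"
    using bunch_rev_eq[OF 1] bunch_rev_eq[OF assms] assms by (auto simp: bunch_def)
qed

text \<open>
  A nondecreasing sequence is cut into its level sets: \<open>u\<close> zeros, followed by intervals of lengths \<open>p\<close>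
  with the values \<open>t + 1\<close>. Appending a value either lengthens the last interval or opens a new one.
\<close>

lemma level_decomposition:
  fixes f :: "nat \<Rightarrow> nat"
  assumes "\<And>a b. 1 \<le> a \<Longrightarrow> a \<le> b \<Longrightarrow> b \<le> N \<Longrightarrow> f a \<le> f b"
  shows "\<exists>u p t. u + sum_list p = N \<and> (\<forall>q\<in>set p. 1 \<le> q) \<and> length t = length p \<and> sorted_wrt (<) t \<and>
    (\<forall>k. 1 \<le> k \<and> k \<le> u \<longrightarrow> f k = 0) \<and> (\<forall>j<length p. \<forall>k\<in>bunch u p j. f k = Suc (t ! j))"
  using assms
proof (induction N)
  case 0
  show ?case by (intro exI[of _ 0] exI[of _ "[]"]) simp
next
  case (Suc N)
  then obtain u p t where IH: "u + sum_list p = N" "\<forall>q\<in>set p. 1 \<le> q" "length t = length p" "sorted_wrt (<) t"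
    "\<forall>k. 1 \<le> k \<and> k \<le> u \<longrightarrow> f k = 0" "\<forall>j<length p. \<forall>k\<in>bunch u p j. f k = Suc (t ! j)" 
    by (metis le_SucI)
  show ?case
  proof (cases "f (Suc N)")
    case 0
    then have "\<forall>k. 1 \<le> k \<and> k \<le> Suc N \<longrightarrow> f k = 0" using Suc.prems[of _ "Suc N"] by simp
    then show ?thesis by (intro exI[of _ "Suc N"] exI[of _ "[]"]) simp
  next
    case (Suc s)
    show ?thesis
    proof (cases "p \<noteq> [] \<and> last t = s")
      case True
      then obtain p' q where p: "p = p' @ [q]" by (metis rev_exhaust)
      with IH(3) True obtain t' where t: "t = t' @ [s]" "length t' = length p'"
        by (metis append_butlast_last_id length_append_singleton list.size(3) nat.inject nat.simps(3))
      have last: "bunch u (p' @ [q + 1]) (length p') = insert (Suc N) (bunch u p (length p'))"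
        unfolding p bunch_append_last using IH(1) p by auto
      have "f k = Suc (t ! j)" if "j < length (p' @ [q+1])" "k \<in> bunch u (p' @ [q + 1]) j" for j k
      proof (cases "j < length p'")
        case True
        then have "k \<in> bunch u p j" using that(2) by (simp add: bunch_append_less p)
        then show ?thesis using IH(6) True p by auto
      next
        case False
        then have "j = length p'" using that(1) by simp
        then show ?thesis using that(2) last IH(6) p t Suc by (auto simp: nth_append)
      qed
      then show ?thesis using IH p
        by (intro exI[of _ u] exI[of _ "p' @ [q + 1]"] exI[of _ t]) simp
    next
      case False
      have "\<forall>a\<in>set t. a < s"
      proof (cases "p = []")
        case True then show ?thesis using IH(3) by simp
      next
        case ne: False
        then obtain p' q where p: "p = p' @ [q]" by (metis rev_exhaust)
        then have "N \<in> bunch u p (length p')" using IH(1,2) unfolding p bunch_append_last by auto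
        then have "f N = Suc (t ! length p')" using IH(6) p by auto
        moreover have "t ! length p' = last t" using IH(3) p by (metis last_conv_nth length_append_singleton diff_Suc_1 length_0_conv nat.simps(3))
        moreover have "f N \<le> f (Suc N)" using Suc.prems[of N "Suc N"] IH(1) p IH(2) by auto
        ultimately have lt: "last t < s" using Suc False ne by simp
        obtain t' where t: "t = t' @ [last t]" using ne IH(3) by (metis append_butlast_last_id length_0_conv)
        have "\<forall>a\<in>set t'. a < last t" using IH(4) t by (metis sorted_wrt_append list.set_intros(1))
        then show ?thesis using lt t by (metis Un_iff empty_iff insert_iff list.set(1) list.set(2) order.strict_trans set_append)
      qed
      then have srt: "sorted_wrt (<) (t @ [s])" using IH(4) by (simp add: sorted_wrt_append)
      have last: "bunch u (p @ [1]) (length p) = {Suc N}" unfolding bunch_append_last using IH(1) by auto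
      have "f k = Suc ((t @ [s]) ! j)" if "j < length (p @ [1])" "k \<in> bunch u (p @ [1]) j" for j k
      proof (cases "j < length p")
        case True
        then show ?thesis using that(2) IH(3,6) by (simp add: bunch_append_less nth_append)
      next
        case False
        then have "j = length p" using that(1) by simp
        then show ?thesis using that(2) last IH(3) Suc by (simp add: nth_append)
      qed
      then show ?thesis using IH srt
        by (intro exI[of _ u] exI[of _ "p @ [1]"] exI[of _ "t @ [s]"]) auto
    qed
  qed
qed

text \<open>
  The permutation of a \<open>B\<close>-positive element, see \<open>B_positive_iff\<close>.
\<close>

definition perm_B_positive :: "nat \<Rightarrow> nat \<Rightarrow> nat \<Rightarrow> nat list \<Rightarrow> nat list \<Rightarrow> (int \<Rightarrow> int) \<Rightarrow> bool" where
  "perm_B_positive n u v p t G \<longleftrightarrow> B_data n u v p t \<and>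
    (\<forall>k. 1 \<le> k \<and> k \<le> u \<or> n - v < k \<and> k \<le> n \<longrightarrow> G (int k) = int k) \<and>
    (\<forall>j<length p. \<forall>k\<in>bunch u p j. G (int k) = 2 * int n * (int (t ! j) + 1) + 1 - int (bunch_rev u p j k))"

text \<open>
  The value of a bijection of an interval is the number of smaller values. Here these are the values at
  \<open>[lo, m)\<close>, in the same level as \<open>m\<close>, and at \<open>(hi, a]\<close>, in the higher levels.
\<close>

lemma level_rank:
  fixes g :: "int \<Rightarrow> int"
  assumes inj: "inj_on g {1 - a..a}" and into: "g ` {1 - a..a} \<subseteq> {1 - a..a}"
    and m: "lo \<le> m" "m \<le> hi" and r: "1 - a \<le> lo" "hi \<le> a"
    and low: "\<And>x. 1 - a \<le> x \<Longrightarrow> x < m \<Longrightarrow> g x < g m \<longleftrightarrow> lo \<le> x"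
    and up: "\<And>x. m < x \<Longrightarrow> x \<le> a \<Longrightarrow> g x < g m \<longleftrightarrow> hi < x"
  shows "g m = 1 - (lo + hi - m)"
proof -
  let ?A = "{1 - a..a}"
  have surj: "g ` ?A = ?A" using endo_inj_surj[OF _ into inj] by simp
  have S: "{x\<in>?A. g x < g m} = {lo..<m} \<union> {hi<..a}"
  proof (intro equalityI subsetI)
    fix x assume x: "x \<in> {x\<in>?A. g x < g m}"
    consider "x < m" | "x = m" | "m < x" by linarith
    then show "x \<in> {lo..<m} \<union> {hi<..a}" using x low[of x] up[of x] by cases auto
  next
    fix x assume x: "x \<in> {lo..<m} \<union> {hi<..a}"
    then show "x \<in> {x\<in>?A. g x < g m}" using m r low[of x] up[of x] by auto
  qed
  have mA: "m \<in> ?A" using m r by simp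
  then have gm: "g m \<in> ?A" using into by blast
  have "g ` {x\<in>?A. g x < g m} = {1 - a..<g m}"
  proof
    show "g ` {x\<in>?A. g x < g m} \<subseteq> {1 - a..<g m}"
    proof
      fix y assume "y \<in> g ` {x\<in>?A. g x < g m}"
      then obtain x where "x \<in> ?A" "y = g x" "g x < g m" by blast
      moreover from this have "g x \<in> ?A" using into by blast
      ultimately show "y \<in> {1 - a..<g m}" by simp
    qed
    show "{1 - a..<g m} \<subseteq> g ` {x\<in>?A. g x < g m}"
    proof
      fix y assume y: "y \<in> {1 - a..<g m}"
      then have "y \<in> ?A" using gm by auto
      then obtain x where "x \<in> ?A" "y = g x" using surj by (metis imageE)
      then show "y \<in> g ` {x\<in>?A. g x < g m}" using y by auto
    qed
  qed
  then have "card {1 - a..<g m} = card {x\<in>?A. g x < g m}"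
    using card_image[OF inj_on_subset[OF inj]] by (metis (no_types, lifting) mem_Collect_eq subsetI)
  also have "\<dots> = card {lo..<m} + card {hi<..a}" unfolding S
    using m by (intro card_Un_disjoint) auto
  finally have "nat (g m - (1 - a)) = nat ((m - lo) + (a - hi))" using m r by (simp add: nat_add_distrib)
  then have "g m - (1 - a) = (m - lo) + (a - hi)" using m r gm by (simp add: eq_nat_nat_iff)
  then show ?thesis by simp
qed

text \<open>
  Since \<open>G\<close> fixes the lower block \<open>[i + 1, 2n - i]\<close>, it preserves the upper block \<open>A = [1 - i, i]\<close> up
  to multiples of \<open>2n\<close>. Write \<open>G m = gg m + 2n lv m\<close> with \<open>gg m \<in> A\<close>. Monotonicity of \<open>G\<close> makes the
  level \<open>lv\<close> nondecreasing, and makes \<open>gg\<close> increasing within a level; monotonicity of the inverse of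
  \<open>G\<close> makes \<open>gg\<close> decreasing from one level to the next. These order relations determine \<open>gg\<close>:
  a level set \<open>[lo, hi]\<close> is mapped to \<open>[1 - hi, 1 - lo]\<close>. Bunches are the level sets of positive
  level. The last of them has at least two elements, as otherwise the inner product would be \<open>0\<close>.
\<close>

lemma ngt_TB_perm_B_positive:
  assumes G: "affine_perm n G" and n: "3 \<le> n" and ng: "ngt TB n G i i" and fb: "fixes_bottom n G i"
  shows "\<exists>u p t. perm_B_positive n u (n - i) p t G"
proof -
  let ?N = "2 * int n" and ?A = "{1 - int i..int i}" and ?H = "finv G"
  have H: "affine_perm n ?H" using affine_perm_inv[OF G] .
  have i: "0 < i" "i < n" using ng by (auto simp: ngt_def norm_two_nodes_def)
  have d: "descents TB n G = {i}" "descents TB n ?H = {i}" using ng by (auto simp: ngt_def)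
  have incG: "G x + (y - x) \<le> G y" if "1 - int i \<le> x" "x \<le> y" "y \<le> int i" for x y
    using ngt_TB_ascend(1)[OF G d(1)] i that by simp
  have incH: "?H x + (y - x) \<le> ?H y" if "1 - int i \<le> x" "x \<le> y" "y \<le> int i" for x y
    using ngt_TB_ascend(1)[OF H d(2)] i that by simp
  \<comment> \<open>The offset \<open>i - 1\<close> makes the representatives of residues range over \<open>[1 - i, 2n - i]\<close>.\<close>
  define lv where "lv m = (G m + int i - 1) div ?N" for m
  define gg where "gg m = G m - ?N * lv m" for m
  have Geq: "G m = gg m + ?N * lv m" for m by (simp add: gg_def)
  have gA: "gg m \<in> ?A" if "m \<in> ?A" for m
  proof (rule ccontr)
    assume "\<not> ?thesis"
    moreover have "gg m + int i - 1 = (G m + int i - 1) mod ?N"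
      using minus_mult_div_eq_mod[of "G m + int i - 1" ?N] unfolding gg_def lv_def by linarith
    then have "0 \<le> gg m + int i - 1" "gg m + int i - 1 < ?N" using n by auto
    ultimately have "int i + 1 \<le> gg m" "gg m \<le> ?N - int i" by auto
    then have "G (gg m) = gg m" using fb by (simp add: fixes_bottom_def)
    then have "G m = G (gg m + ?N * lv m)" using affine_perm_shift[OF G] Geq by metis
    then have me: "m - gg m = ?N * lv m" using affine_perm_inj[OF G] by simp
    have "\<bar>m - gg m\<bar> < ?N" using that \<open>int i + 1 \<le> gg m\<close> \<open>gg m \<le> ?N - int i\<close> by auto
    then have "m - gg m = 0" using small_dvd_iff[of "m - gg m" n] me by simp
    then show False using that \<open>int i + 1 \<le> gg m\<close> by simp
  qed
  have lvu: "lv m = s" if "G m = g + ?N * s" "g \<in> ?A" for m g s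
  proof -
    have "G m + int i - 1 = (g + int i - 1) + s * ?N" using that(1) by (simp add: algebra_simps)
    moreover have "(g + int i - 1) div ?N = 0" using that(2) i by (intro div_pos_pos_trivial) auto
    moreover have "(g + int i - 1 + s * ?N) div ?N = s + (g + int i - 1) div ?N"
      using n by (intro div_mult_self1) simp
    ultimately show ?thesis unfolding lv_def by (simp only: add_0_right)
  qed
  have lvmono: "lv x \<le> lv y" if "x \<in> ?A" "y \<in> ?A" "x \<le> y" for x y
    unfolding lv_def using incG[of x y] that n by (intro zdiv_mono1) auto
  have Hg: "?H (gg m) = m - ?N * lv m" for m
  proof -
    have "G (m - ?N * lv m) = gg m" using affine_perm_shift[OF G, of m "- lv m"] Geq[of m] by simp
    then show ?thesis using affine_perm_inv_f[OF G] by metis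
  qed
  have ginj: "inj_on gg ?A"
  proof (rule inj_onI)
    fix x y assume xy: "x \<in> ?A" "y \<in> ?A" "gg x = gg y"
    then have "x - y = ?N * (lv x - lv y)" using Hg[of x] Hg[of y] by (simp add: algebra_simps)
    moreover have "\<bar>x - y\<bar> < ?N" using xy i by auto
    ultimately show "x = y" using small_dvd_iff[of "x - y" n] by (metis dvd_triv_left eq_iff_diff_eq_0)
  qed
  have gdec: "gg x > gg y" if "x \<in> ?A" "y \<in> ?A" "lv x < lv y" for x y
  proof (rule ccontr)
    assume "\<not> ?thesis"
    then have "?H (gg x) \<le> ?H (gg y)" using incH[of "gg x" "gg y"] gA that by simp
    then have "?N * (lv y - lv x) \<le> y - x" using Hg by (simp add: algebra_simps)
    moreover have "?N \<le> ?N * (lv y - lv x)" using that(3) mult_left_mono[of 1 "lv y - lv x" ?N] by simp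
    ultimately have "?N \<le> y - x" by (rule order_trans[rotated])
    then show False using that i by auto
  qed
  have rank: "gg m = 1 - (lo + hi - m)" 
    if m: "lo \<le> m" "m \<le> hi" and r: "1 - int i \<le> lo" "hi \<le> int i" 
      and eq: "\<And>x. lo \<le> x \<Longrightarrow> x \<le> hi \<Longrightarrow> lv x = lv m"
      and ne: "\<And>x. x \<in> ?A \<Longrightarrow> x < lo \<or> hi < x \<Longrightarrow> lv x \<noteq> lv m" for m lo hi
  proof (rule level_rank[OF ginj _ m r])
    show "gg ` ?A \<subseteq> ?A" using gA by blast
    have mA: "m \<in> ?A" using m r by simp
    show "gg x < gg m \<longleftrightarrow> lo \<le> x" if "1 - int i \<le> x" "x < m" for x
    proof (cases "lo \<le> x")
      case True
      then have "lv x = lv m" using eq[of x] that m by auto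
      moreover have "G x < G m" using incG[of x m] that mA by simp
      ultimately show ?thesis using True by (simp add: Geq)
    next
      case False
      then have "lv x < lv m" using ne[of x] lvmono[of x m] that mA by (simp add: less_le)
      then have "gg x > gg m" using gdec[of x m] mA that by simp
      then show ?thesis using False by simp
    qed
    show "gg x < gg m \<longleftrightarrow> hi < x" if "m < x" "x \<le> int i" for x
    proof (cases "hi < x")
      case False
      then have "lv x = lv m" using eq[of x] that m by auto
      moreover have "G m < G x" using incG[of m x] that mA by simp
      ultimately show ?thesis using False by (simp add: Geq)
    next
      case True
      then have "lv m < lv x" using ne[of x] lvmono[of m x] that mA by (simp add: less_le)
      then have "gg x < gg m" using gdec[of m x] mA that by simp
      then show ?thesis using True by simp
    qed
  qed
  have lvmirror: "lv (1 - m) = - lv m" if "m \<in> ?A" for m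
  proof (rule lvu)
    show "G (1 - m) = (1 - gg m) + ?N * (- lv m)" using affine_perm_mirror[OF G, of m] Geq[of m] by simp
    show "1 - gg m \<in> ?A" using gA[OF that] by simp
  qed
  have lvpos: "0 \<le> lv m" if "1 \<le> m" "m \<le> int i" for m
  proof -
    have "lv (1 - m) \<le> lv m" using lvmono[of "1 - m" m] that by simp
    then show ?thesis using lvmirror[of m] that by simp
  qed
  define f where "f k = nat (lv (int k))" for k
  have lvf: "lv (int k) = int (f k)" if "1 \<le> k" "k \<le> i" for k using lvpos[of "int k"] that by (simp add: f_def)
  have fm: "f a \<le> f b" if "1 \<le> a" "a \<le> b" "b \<le> i" for a b
    using lvmono[of "int a" "int b"] that by (simp add: f_def)
  obtain u p t where D: "u + sum_list p = i" "\<forall>q\<in>set p. 1 \<le> q" "length t = length p" "sorted_wrt (<) t"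
    "\<forall>k. 1 \<le> k \<and> k \<le> u \<longrightarrow> f k = 0" "\<forall>j<length p. \<forall>k\<in>bunch u p j. f k = Suc (t ! j)"
    using level_decomposition[of i f] fm by blast
  have fpos: "f k > 0" if "u < k" "k \<le> i" for k
    using bunch_cover[of u k p] that D(1,6) by auto
  have Gtop: "G (int k) = int k" if k: "1 \<le> k" "k \<le> u" for k
  proof -
    have z: "lv x = 0" if "1 - int u \<le> x" "x \<le> int u" for x
    proof (cases "1 \<le> x")
      case True
      then show ?thesis using lvf[of "nat x"] D(5) that D(1) by simp
    next
      case False
      then show ?thesis using lvf[of "nat (1 - x)"] D(5) that D(1) lvmirror[of "1 - x"] by simp
    qed
    have nz: "lv x \<noteq> 0" if "x \<in> ?A" "x < 1 - int u \<or> int u < x" for x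
    proof (cases "1 \<le> x")
      case True
      then show ?thesis using lvf[of "nat x"] fpos[of "nat x"] that by simp
    next
      case False
      then show ?thesis using lvf[of "nat (1 - x)"] fpos[of "nat (1 - x)"] that lvmirror[of "1 - x"] by simp
    qed
    have l0: "lv (int k) = 0" using z[of "int k"] k by simp
    have "gg (int k) = 1 - (1 - int u + int u - int k)"
      by (rule rank) (use k D(1) z nz l0 in auto)
    then show ?thesis using Geq[of "int k"] l0 by simp
  qed
  have distinct: "t ! j \<noteq> t ! j'" if "j < length p" "j' < length p" "j \<noteq> j'" for j j'
    using D(3,4) that by (metis linorder_neqE_nat order_less_irrefl sorted_wrt_iff_nth_less)
  have Gbunch: "G (int k) = ?N * (int (t ! j) + 1) + 1 - int (bunch_rev u p j k)"
    if j: "j < length p" and k: "k \<in> bunch u p j" for j k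
  proof -
    let ?lo = "u + sum_list (take j p) + 1" and ?hi = "u + sum_list (take (j + 1) p)"
    have b: "bunch u p j = {?lo..?hi}" by (simp add: bunch_def)
    have kk: "?lo \<le> k" "k \<le> ?hi" using k b by auto
    have "?hi \<in> bunch u p j" using kk b by auto
    then have hi: "?hi \<le> i" using bunch_bounds D(1) by metis
    have lvin: "lv x = int (t ! j) + 1" if "int ?lo \<le> x" "x \<le> int ?hi" for x
    proof -
      have "nat x \<in> bunch u p j" using that b by auto
      then show ?thesis using lvf[of "nat x"] D(6) j that hi by auto
    qed
    have lvout: "lv x \<noteq> int (t ! j) + 1" if x: "x \<in> ?A" "x < int ?lo \<or> int ?hi < x" for x
    proof (cases "1 \<le> x")
      case True
      have nb: "nat x \<notin> bunch u p j" using x b True by auto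
      have "f (nat x) \<noteq> Suc (t ! j)"
      proof (cases "nat x \<le> u")
        case True
        then show ?thesis using D(5) \<open>1 \<le> x\<close> by simp
      next
        case False
        moreover have "nat x \<le> i" using x(1) by auto
        ultimately obtain j' where "j' < length p" "nat x \<in> bunch u p j'" using bunch_cover[of u "nat x" p] D(1) by auto
        then show ?thesis using nb D(6) distinct[OF j] by (metis Suc_inject)
      qed
      then show ?thesis using lvf[of "nat x"] True x(1) by auto
    next
      case False
      then have "lv x \<le> 0" using lvmirror[of "1 - x"] lvpos[of "1 - x"] x(1) by simp
      then show ?thesis by simp
    qed
    have lk: "lv (int k) = int (t ! j) + 1" using lvin[of "int k"] kk by simp
    have "gg (int k) = 1 - (int ?lo + int ?hi - int k)"
      by (rule rank) (use kk hi lvin lvout lk in \<open>simp_all del: of_nat_add\<close>)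
    moreover have "int (bunch_rev u p j k) = int ?lo + int ?hi - int k" 
      using bunch_rev_eq[OF k] kk by linarith
    ultimately show ?thesis using Geq[of "int k"] lk by simp
  qed
  have Gi1: "G (int i + 1) = int i + 1" using fb i by (simp add: fixes_bottom_def)
  have "i \<in> descents TB n G" using d(1) by simp
  then have "G (int i) > int i + 1" using Gi1 by (simp add: descents_def node_simps)
  then have "i \<notin> {1..u}" using Gtop[of i] by auto
  then have pne: "p \<noteq> []" using D(1) i by auto
  then obtain p' q where p: "p = p' @ [q]" by (metis rev_exhaust)
  have "2 \<le> q"
  proof (rule ccontr)
    assume "\<not> 2 \<le> q"
    then have q: "q = 1" using D(2) p by auto
    have b: "bunch u p (length p') = {i}" unfolding p q bunch_append_last using D(1) p q by auto
    then have ib: "i \<in> bunch u p (length p')" by simp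
    have "bunch_rev u p (length p') i = i" using bunch_rev_in(1)[OF ib] b by simp
    then obtain s where s: "G (int i) = ?N * s + 1 - int i" using Gbunch[OF _ ib] p by auto
    have "G (1 - int i + ?N * s) = int i" 
      using affine_perm_shift[OF G, of "1 - int i" s] affine_perm_mirror[OF G, of "int i"] s by simp
    then have Hi: "?H (int i) = 1 - int i + ?N * s" using affine_perm_inv_f[OF G] by metis
    have Hi1: "?H (int i + 1) = int i + 1" using Gi1 affine_perm_inv_f[OF G] by metis
    have e1: "pairing n (int i) (?H (int i)) = - 1"
      unfolding Hi pairing_commute[of n "int i"] pairing_shift
      using even_not_dvd(2)[of n "int i"] by (simp add: pairing_def)
    have ndi: "\<not> ?N dvd 2 * int i" using i zdvd_imp_le[of ?N "2 * int i"] by auto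
    have e2: "pairing n (int i) (int i + 1) = 0" 
      using i ndi by (simp add: pairing_def small_dvd_iff)
    have e3: "pairing n (int i + 1) (?H (int i)) = 0"
      unfolding Hi pairing_commute[of n "int i + 1"] pairing_shift
      using i ndi dvd_minus_iff[of ?N "2 * int i"] by (simp add: pairing_def small_dvd_iff)
    have e4: "pairing n (int i + 1) (int i + 1) = 1"
      using even_not_dvd(1)[of n "int i + 1"] by (simp add: pairing_def)
    have "root_pairing TB n ?H i i = 0" 
      using e1 e2 e3 e4 Hi1 i by (simp add: root_pairing_def node_simps)
    then show False using ng by (simp add: ngt_def)
  qed
  then have "B_data n u (n - i) p t" using D p i by (auto simp: B_data_def)
  moreover have "G (int k) = int k" if "n - (n - i) < k" "k \<le> n" for k 
    using fb that i by (simp add: fixes_bottom_def)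
  ultimately have "perm_B_positive n u (n - i) p t G" using Gtop Gbunch unfolding perm_B_positive_def by blast
  then show ?thesis by blast
qed

section \<open>The group of affine signed permutations\<close>

lemma sum_eps: "j \<in> {1..n} \<Longrightarrow> (\<Sum>k\<in>{1..n}. z k * eps j k) = z j"
  "j \<in> {1..n} \<Longrightarrow> (\<Sum>k\<in>{1..n}. eps j k * z k) = z j"
  by (simp_all add: eps_def sum.delta' if_distrib[of "\<lambda>x. _ * x"] if_distrib[of "\<lambda>x. x * _"] cong: if_cong)

lemma eps_eq_iff: "eps k = eps l \<longleftrightarrow> k = l"
  by (metis eps_def zero_neq_one)

lemma eps_neq_minus: "eps k \<noteq> (\<lambda>j. - eps l j)"
proof
  assume "eps k = (\<lambda>j. - eps l j)"
  then have "eps k k = - eps l k" by metis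
  then show False by (simp add: eps_def split: if_splits)
qed

lemma minus_eps_eq_iff: "(\<lambda>j. - eps k j) = (\<lambda>j. - eps l j) \<longleftrightarrow> k = l"
proof
  assume "(\<lambda>j. - eps k j) = (\<lambda>j. - eps l j)"
  then have "- eps k k = - eps l k" by metis
  then show "k = l" by (simp add: eps_def split: if_splits)
qed simp

text \<open>
  The vector \<open>[\<plusminus>\<epsilon>\<^sub>k, c]\<close> of a position. Its value at the point with \<open>k\<close>-th coordinate \<open>(n + 1/2 - k)/2n\<close>,
  which lies in the fundamental alcove of every type, is \<open>(n + 1/2 - m)/2n\<close>; so smaller positions belong
  to larger values.
\<close>

definition position_vec :: "nat \<Rightarrow> int \<Rightarrow> avec" where
  "position_vec n m = (let q = (m - 1) div (2 * int n); r = (m - 1) mod (2 * int n) in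
     if r < int n then (eps (nat (r + 1)), - q) else (\<lambda>k. - eps (nat (2 * int n - r)) k, - q))"

lemma div_mod_unique:
  assumes "x = (d::int) * q + r" "0 \<le> r" "r < d" shows "x div d = q" "x mod d = r"
  using assms by auto

lemma position_vec_low: assumes "k \<in> {1..n}" shows "position_vec n (int k + 2 * int n * q) = (eps k, - q)"
proof -
  have "int k + 2 * int n * q - 1 = 2 * int n * q + (int k - 1)" by simp
  from div_mod_unique[OF this] assms 
  have "(int k + 2 * int n * q - 1) div (2 * int n) = q" "(int k + 2 * int n * q - 1) mod (2 * int n) = int k - 1" by auto
  then show ?thesis using assms by (simp add: position_vec_def Let_def)
qed

lemma position_vec_high: assumes "k \<in> {1..n}" shows "position_vec n (2 * int n * q + 1 - int k) = (\<lambda>j. - eps k j, 1 - q)"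
proof -
  have "2 * int n * q + 1 - int k - 1 = 2 * int n * (q - 1) + (2 * int n - int k)" by (simp add: algebra_simps)
  from div_mod_unique[OF this] assms 
  have "(2 * int n * q + 1 - int k - 1) div (2 * int n) = q - 1" "(2 * int n * q + 1 - int k - 1) mod (2 * int n) = 2 * int n - int k" by auto
  then show ?thesis using assms by (simp add: position_vec_def Let_def)
qed

lemma position_cases:
  assumes "1 \<le> n"
  obtains (low) k q where "k \<in> {1..n}" "m = int k + 2 * int n * q"
  | (high) k q where "k \<in> {1..n}" "m = 2 * int n * q + 1 - int k"
proof -
  define q r where "q = (m - 1) div (2 * int n)" and "r = (m - 1) mod (2 * int n)"
  have m: "m = r + 1 + 2 * int n * q" unfolding q_def r_def
    using mod_mult_div_eq[of "m - 1" "2 * int n"] by linarith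
  have r: "0 \<le> r" "r < 2 * int n" using assms unfolding r_def by auto
  show thesis
  proof (cases "r < int n")
    case True
    then show ?thesis using low[of "nat (r + 1)" q] m r by simp
  next
    case False
    have "m = 2 * int n * (q + 1) + 1 - int (nat (2 * int n - r))" using m r by (simp add: algebra_simps)
    then show ?thesis using high[of "nat (2 * int n - r)" "q + 1"] r False by auto
  qed
qed

lemma position_vec_mirror: assumes "1 \<le> n" shows "position_vec n (1 - m) = (\<lambda>k. - fst (position_vec n m) k, 1 - snd (position_vec n m))"
proof (rule position_cases[OF assms, of m])
  fix k q assume k: "k \<in> {1..n}" and m: "m = int k + 2 * int n * q"
  then have "1 - m = 2 * int n * (- q) + 1 - int k" by simp
  then have "position_vec n (1 - m) = (\<lambda>j. - eps k j, 1 + q)" using position_vec_high[OF k, of "- q"] by (simp only: diff_minus_eq_add)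
  then show ?thesis unfolding m position_vec_low[OF k] by simp
next
  fix k q assume k: "k \<in> {1..n}" and m: "m = 2 * int n * q + 1 - int k"
  then have "1 - m = int k + 2 * int n * (- q)" by simp
  then have "position_vec n (1 - m) = (eps k, q)" using position_vec_low[OF k, of "- q"] by simp
  then show ?thesis unfolding m position_vec_high[OF k] by simp
qed

lemma position_vec_shift: assumes "1 \<le> n" shows "position_vec n (m + 2 * int n) = (fst (position_vec n m), snd (position_vec n m) - 1)"
proof (rule position_cases[OF assms, of m])
  fix k q assume k: "k \<in> {1..n}" and m: "m = int k + 2 * int n * q"
  then have e: "m + 2 * int n = int k + 2 * int n * (q + 1)" by (simp add: algebra_simps)
  show ?thesis unfolding e unfolding m position_vec_low[OF k] by simp
next
  fix k q assume k: "k \<in> {1..n}" and m: "m = 2 * int n * q + 1 - int k"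
  then have e: "m + 2 * int n = 2 * int n * (q + 1) + 1 - int k" by (simp add: algebra_simps)
  show ?thesis unfolding e unfolding m position_vec_high[OF k] by simp
qed

lemma position_vec_inj: assumes "1 \<le> n" "position_vec n a = position_vec n b" shows "a = b"
proof (rule position_cases[OF assms(1), of a]; rule position_cases[OF assms(1), of b])
qed (use assms(2) in \<open>auto simp: position_vec_low position_vec_high eps_eq_iff eps_neq_minus eps_neq_minus[symmetric] minus_eps_eq_iff\<close>)

lemma signed_permsE:
  assumes "w \<in> signed_perms n"
  obtains sg \<sigma> where "w = (\<lambda>z k. sg k * z (\<sigma> k))" "\<sigma> permutes {1..n}" "\<And>k. sg k \<in> {1, -1}"
    "\<And>k. k \<notin> {1..n} \<Longrightarrow> sg k = 1"
proof -
  from assms obtain sg \<sigma> where *: "w = (\<lambda>z k. sg k * z (\<sigma> k))" "\<sigma> permutes {1..n}" 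
    "\<forall>k\<in>{1..n}. sg k \<in> {1, -1}" "\<forall>k. k \<notin> {1..n} \<longrightarrow> sg k = 1" 
    unfolding signed_perms_def by blast
  then have "sg k \<in> {1, -1}" for k by (cases "k \<in> {1..n}") auto
  then show ?thesis using that * by blast
qed

lemma signed_permsI:
  assumes "\<sigma> permutes {1..n}" "\<And>k. sg k \<in> {1, -1}" "\<And>k. k \<notin> {1..n} \<Longrightarrow> sg k = 1"
  shows "(\<lambda>z k. sg k * z (\<sigma> k)) \<in> signed_perms n"
  unfolding signed_perms_def using assms by blast

lemma signed_perms_id: "id \<in> signed_perms n"
  using signed_permsI[OF permutes_id, of "\<lambda>k. 1" n] by (simp add: id_def)

lemma signed_perms_comp: 
  assumes "w \<in> signed_perms n" "v \<in> signed_perms n" shows "w \<circ> v \<in> signed_perms n"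
proof -
  obtain s \<sigma> where w: "w = (\<lambda>z k. s k * z (\<sigma> k))" "\<sigma> permutes {1..n}" "\<And>k. s k \<in> {1, -1}"
    "\<And>k. k \<notin> {1..n} \<Longrightarrow> s k = 1" using signed_permsE[OF assms(1)] by blast
  obtain r \<tau> where v: "v = (\<lambda>z k. r k * z (\<tau> k))" "\<tau> permutes {1..n}" "\<And>k. r k \<in> {1, -1}"
    "\<And>k. k \<notin> {1..n} \<Longrightarrow> r k = 1" using signed_permsE[OF assms(2)] by blast
  have "(\<lambda>z k. (s k * r (\<sigma> k)) * z ((\<tau> \<circ> \<sigma>) k)) \<in> signed_perms n"
  proof (rule signed_permsI)
    show "\<tau> \<circ> \<sigma> permutes {1..n}" using permutes_compose[OF w(2) v(2)] .
    show "s k * r (\<sigma> k) \<in> {1, - 1}" for k using w(3)[of k] v(3)[of "\<sigma> k"] by auto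
    show "s k * r (\<sigma> k) = 1" if "k \<notin> {1..n}" for k 
      using w(4)[OF that] v(4)[OF that] permutes_not_in[OF w(2) that] by simp
  qed
  then show ?thesis using w(1) v(1) by (simp add: comp_def mult.assoc)
qed

lemma signed_perms_inverse:
  assumes "w \<in> signed_perms n" obtains v where "v \<in> signed_perms n" "v \<circ> w = id" "w \<circ> v = id"
proof -
  obtain s \<sigma> where w: "w = (\<lambda>z k. s k * z (\<sigma> k))" "\<sigma> permutes {1..n}" "\<And>k. s k \<in> {1, -1}"
    "\<And>k. k \<notin> {1..n} \<Longrightarrow> s k = 1" using signed_permsE[OF assms(1)] by blast
  let ?\<tau> = "inv_into UNIV \<sigma>"
  have t: "?\<tau> permutes {1..n}" using permutes_inv[OF w(2)] .
  have sq: "s k * s k = 1" for k using w(3)[of k] by auto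
  have 1: "(\<lambda>z k. s (?\<tau> k) * z (?\<tau> k)) \<in> signed_perms n"
  proof (rule signed_permsI[OF t])
    show "s (?\<tau> k) = 1" if "k \<notin> {1..n}" for k using w(4) that permutes_not_in[OF t that] by simp
  qed (use w(3) in auto)
  have e: "s k * (s k * x) = x" for k x using sq[of k] by (metis mult.assoc mult_1)
  show ?thesis
    by (rule that[OF 1]) (auto simp: w(1) fun_eq_iff e permutes_inverses[OF w(2)])
qed

lemma signed_perms_linear:
  assumes "w \<in> signed_perms n"
  shows "w (\<lambda>k. x k + y k) k = w x k + w y k" "w (\<lambda>k. - x k) k = - w x k" "w (\<lambda>k. c * x k) k = c * w x k"
    "w (\<lambda>k. x k - y k) k = w x k - w y k" "w (\<lambda>k. 0) k = 0"
  by (rule signed_permsE[OF assms], simp add: algebra_simps)+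

lemma signed_perms_orth:
  assumes "w \<in> signed_perms n"
  shows "(\<Sum>k\<in>{1..n}. w x k * w y k) = (\<Sum>k\<in>{1..n}. x k * y k)"
proof -
  obtain s \<sigma> where w: "w = (\<lambda>z k. s k * z (\<sigma> k))" "\<sigma> permutes {1..n}" "\<And>k. s k \<in> {1, -1}"
    "\<And>k. k \<notin> {1..n} \<Longrightarrow> s k = 1" using signed_permsE[OF assms(1)] by blast
  have sq: "s k * s k = 1" for k using w(3)[of k] by auto
  have "w x k * w y k = (s k * s k) * (x (\<sigma> k) * y (\<sigma> k))" for k unfolding w(1) by (simp only: mult_ac)
  then have "(\<Sum>k\<in>{1..n}. w x k * w y k) = (\<Sum>k\<in>{1..n}. x (\<sigma> k) * y (\<sigma> k))" by (simp add: sq)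
  also have "\<dots> = (\<Sum>k\<in>{1..n}. x k * y k)" using sum.permute[OF w(2), of "\<lambda>k. x k * y k"] by (simp add: comp_def)
  finally show ?thesis .
qed

lemma signed_perms_supp:
  assumes "w \<in> signed_perms n" "\<And>k. k \<notin> {1..n} \<Longrightarrow> b k = 0" "k \<notin> {1..n}" shows "w b k = 0"
  by (rule signed_permsE[OF assms(1)]) (use assms(2,3) permutes_not_in in fastforce)

lemma signed_perms_eps:
  assumes "w \<in> signed_perms n" "l \<in> {1..n}"
  obtains k where "k \<in> {1..n}" "w (eps l) = eps k \<or> w (eps l) = (\<lambda>j. - eps k j)"
proof -
  obtain s \<sigma> where w: "w = (\<lambda>z k. s k * z (\<sigma> k))" "\<sigma> permutes {1..n}" "\<And>k. s k \<in> {1, -1}"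
    "\<And>k. k \<notin> {1..n} \<Longrightarrow> s k = 1" using signed_permsE[OF assms(1)] by blast
  let ?k = "inv_into UNIV \<sigma> l"
  have k: "?k \<in> {1..n}" using permutes_in_image[OF permutes_inv[OF w(2)]] assms(2) by simp
  have "\<sigma> j = l \<longleftrightarrow> j = ?k" for j using permutes_inv_eq[OF w(2)] by metis
  then have "w (eps l) = (\<lambda>j. s ?k * eps ?k j)" unfolding w(1) by (auto simp: eps_def fun_eq_iff)
  then show ?thesis using that[OF k] w(3)[of ?k] by auto
qed

text \<open>
  An element of \<open>W\<close> fixes the coordinates outside \<open>{1..n}\<close>, so it is determined by the images of
  \<open>\<epsilon>\<^sub>1, \<dots>, \<epsilon>\<^sub>n\<close>.
\<close>

lemma signed_perms_eqI:
  assumes "w \<in> signed_perms n" "v \<in> signed_perms n" "\<And>l. l \<in> {1..n} \<Longrightarrow> w (eps l) = v (eps l)"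
  shows "w = v"
proof -
  obtain s \<sigma> where w: "w = (\<lambda>z k. s k * z (\<sigma> k))" "\<sigma> permutes {1..n}" "\<And>k. s k \<in> {1, -1}"
    "\<And>k. k \<notin> {1..n} \<Longrightarrow> s k = 1" using signed_permsE[OF assms(1)] by blast
  obtain r \<tau> where v: "v = (\<lambda>z k. r k * z (\<tau> k))" "\<tau> permutes {1..n}" "\<And>k. r k \<in> {1, -1}"
    "\<And>k. k \<notin> {1..n} \<Longrightarrow> r k = 1" using signed_permsE[OF assms(2)] by blast
  have "s k * z (\<sigma> k) = r k * z (\<tau> k)" for z k
  proof (cases "k \<in> {1..n}")
    case True
    then have "\<sigma> k \<in> {1..n}" using permutes_in_image[OF w(2)] by simp
    from assms(3)[OF this] have "s k * eps (\<sigma> k) (\<sigma> k) = r k * eps (\<sigma> k) (\<tau> k)" 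
      unfolding w(1) v(1) by metis
    then show ?thesis using w(3)[of k] v(3)[of k] by (auto simp: eps_def split: if_splits)
  next
    case False
    then show ?thesis using w(4) v(4) permutes_not_in[OF w(2)] permutes_not_in[OF v(2)] by simp
  qed
  then show ?thesis unfolding w(1) v(1) by simp
qed

lemma carrier_W: "x \<in> carrier (W_aff n) \<longleftrightarrow> (\<forall>k. k \<notin> {1..n} \<longrightarrow> fst x k = 0) \<and> snd x \<in> signed_perms n"
  by (cases x) (simp add: W_aff_def)

lemma mult_W: "x \<otimes>\<^bsub>W_aff n\<^esub> y = (\<lambda>k. fst x k + snd x (fst y) k, snd x \<circ> snd y)"
  by (cases x; cases y) (simp add: W_aff_def)

lemma one_W: "\<one>\<^bsub>W_aff n\<^esub> = (\<lambda>k. 0, id)"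
  by (simp add: W_aff_def)

lemma group_W: "group (W_aff n)"
proof (rule groupI)
  show "x \<otimes>\<^bsub>W_aff n\<^esub> y \<in> carrier (W_aff n)" if "x \<in> carrier (W_aff n)" "y \<in> carrier (W_aff n)" for x y
    using that signed_perms_comp signed_perms_supp by (auto simp: carrier_W mult_W)
  show "\<one>\<^bsub>W_aff n\<^esub> \<in> carrier (W_aff n)" by (simp add: carrier_W one_W signed_perms_id)
  show "x \<otimes>\<^bsub>W_aff n\<^esub> y \<otimes>\<^bsub>W_aff n\<^esub> z = x \<otimes>\<^bsub>W_aff n\<^esub> (y \<otimes>\<^bsub>W_aff n\<^esub> z)" 
    if "x \<in> carrier (W_aff n)" "y \<in> carrier (W_aff n)" "z \<in> carrier (W_aff n)" for x y z
    using that signed_perms_linear(1)[of "snd x" n "fst y" "snd y (fst z)"] by (auto simp: carrier_W mult_W fun_eq_iff)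
  show "\<one>\<^bsub>W_aff n\<^esub> \<otimes>\<^bsub>W_aff n\<^esub> x = x" for x by (simp add: mult_W one_W)
  show "\<exists>y\<in>carrier (W_aff n). y \<otimes>\<^bsub>W_aff n\<^esub> x = \<one>\<^bsub>W_aff n\<^esub>" if "x \<in> carrier (W_aff n)" for x
  proof -
    have x: "snd x \<in> signed_perms n" "\<And>k. k \<notin> {1..n} \<Longrightarrow> fst x k = 0" using that by (auto simp: carrier_W)
    obtain v where v: "v \<in> signed_perms n" "v \<circ> snd x = id" using signed_perms_inverse[OF x(1)] by blast
    show ?thesis
    proof (rule bexI[of _ "(\<lambda>k. - v (fst x) k, v)"])
      show "(\<lambda>k. - v (fst x) k, v) \<otimes>\<^bsub>W_aff n\<^esub> x = \<one>\<^bsub>W_aff n\<^esub>" using v by (simp add: mult_W one_W)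
      show "(\<lambda>k. - v (fst x) k, v) \<in> carrier (W_aff n)" using v(1) signed_perms_supp[OF v(1) x(2)] by (simp add: carrier_W)
    qed
  qed
qed

lemma form_eq: "form X n x y = (if X = TB then 2 else 1) * (\<Sum>k\<in>{1..n}. x k * y k)"
  by (simp add: form_def)

lemma act_eq: "act X n x p = (snd x (fst p), snd p - form X n (snd x (fst p)) (fst x))"
  by (cases x; cases p) (simp add: act_def)

lemma act_mult:
  assumes "x \<in> carrier (W_aff n)" "y \<in> carrier (W_aff n)"
  shows "act X n (x \<otimes>\<^bsub>W_aff n\<^esub> y) p = act X n x (act X n y p)"
proof -
  have x: "snd x \<in> signed_perms n" using assms by (simp add: carrier_W)
  have "form X n (snd x (snd y (fst p))) (\<lambda>k. fst x k + snd x (fst y) k) 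
      = form X n (snd x (snd y (fst p))) (fst x) + form X n (snd y (fst p)) (fst y)"
    using signed_perms_orth[OF x, of "snd y (fst p)" "fst y"] by (simp add: form_eq sum.distrib distrib_left)
  then show ?thesis by (simp add: act_eq mult_W)
qed

lemma act_one: "act X n \<one>\<^bsub>W_aff n\<^esub> p = p"
  by (simp add: act_eq one_W form_eq)

text \<open>
  A signed permutation maps \<open>\<epsilon>\<^sub>l\<close> to some \<open>\<plusminus>\<epsilon>\<^sub>k\<close>, and every vector \<open>[\<plusminus>\<epsilon>\<^sub>k, c]\<close>
  has a position.
\<close>

lemma act_position_vec:
  assumes n: "1 \<le> n" and x: "x \<in> carrier (W_aff n)" shows "\<exists>m'. act TC n x (position_vec n m) = position_vec n m'"
proof -
  have w: "snd x \<in> signed_perms n" using x by (simp add: carrier_W)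
  have ex: "\<exists>m'. p = position_vec n m'" if "k \<in> {1..n}" "fst p = eps k \<or> fst p = (\<lambda>j. - eps k j)" for k p
  proof -
    have "p = position_vec n (int k + 2 * int n * (- snd p)) \<or> p = position_vec n (2 * int n * (1 - snd p) + 1 - int k)"
      unfolding position_vec_low[OF that(1)] position_vec_high[OF that(1)] using that(2) by (auto simp: prod_eq_iff)
    then show ?thesis by blast
  qed
  have neg: "snd x (\<lambda>j. - z j) = (\<lambda>j. - snd x z j)" for z
    by (rule ext) (rule signed_perms_linear(2)[OF w])
  obtain l where l: "l \<in> {1..n}" "fst (position_vec n m) = eps l \<or> fst (position_vec n m) = (\<lambda>j. - eps l j)"
  proof (rule position_cases[OF n, of m])
    fix k q assume k: "k \<in> {1..n}" and m: "m = int k + 2 * int n * q"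
    show thesis by (rule that[OF k]) (simp add: m position_vec_low[OF k])
  next
    fix k q assume k: "k \<in> {1..n}" and m: "m = 2 * int n * q + 1 - int k"
    show thesis by (rule that[OF k]) (simp add: m position_vec_high[OF k])
  qed
  obtain k where k: "k \<in> {1..n}" "snd x (eps l) = eps k \<or> snd x (eps l) = (\<lambda>j. - eps k j)"
    using signed_perms_eps[OF w l(1)] by blast
  have "fst (act TC n x (position_vec n m)) = eps k \<or> fst (act TC n x (position_vec n m)) = (\<lambda>j. - eps k j)"
    using l(2) k(2) neg[of "eps l"] by (auto simp: act_eq)
  then show ?thesis by (rule ex[OF k(1)])
qed

text \<open>
  The action of type \<open>C\<close> serves for all types: it is also that of type \<open>D\<close>, and it agrees with the one of
  type \<open>B\<close> after the rescaling \<open>to_TC\<close>.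
\<close>

definition aperm :: "nat \<Rightarrow> aelt \<Rightarrow> int \<Rightarrow> int" where
  "aperm n x m = (THE m'. position_vec n m' = act TC n x (position_vec n m))"

lemma position_vec_aperm:
  assumes n: "1 \<le> n" and x: "x \<in> carrier (W_aff n)" shows "position_vec n (aperm n x m) = act TC n x (position_vec n m)"
proof -
  obtain m' where m': "position_vec n m' = act TC n x (position_vec n m)" using act_position_vec[OF assms] by metis
  show ?thesis unfolding aperm_def by (rule theI[of _ m']) (use m' position_vec_inj[OF n] in auto)
qed

lemma aperm_eqI:
  assumes "1 \<le> n" "x \<in> carrier (W_aff n)" "act TC n x (position_vec n m) = position_vec n m'" shows "aperm n x m = m'"
  by (rule position_vec_inj[OF assms(1)]) (simp only: position_vec_aperm[OF assms(1,2)] assms(3))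

lemma mult_closed_W: 
  assumes "x \<in> carrier (W_aff n)" "y \<in> carrier (W_aff n)" shows "x \<otimes>\<^bsub>W_aff n\<^esub> y \<in> carrier (W_aff n)"
  using assms group.is_monoid[OF group_W] by (rule monoid.m_closed[rotated])

lemma aperm_mult:
  assumes n: "1 \<le> n" and x: "x \<in> carrier (W_aff n)" and y: "y \<in> carrier (W_aff n)"
  shows "aperm n (x \<otimes>\<^bsub>W_aff n\<^esub> y) = aperm n x \<circ> aperm n y"
proof (rule ext, rule aperm_eqI[OF n mult_closed_W[OF x y]])
  fix m
  show "act TC n (x \<otimes>\<^bsub>W_aff n\<^esub> y) (position_vec n m) = position_vec n ((aperm n x \<circ> aperm n y) m)"
    by (simp only: act_mult[OF x y] position_vec_aperm[OF n x] position_vec_aperm[OF n y] comp_apply)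
qed

lemma one_closed_W: "\<one>\<^bsub>W_aff n\<^esub> \<in> carrier (W_aff n)"
  using group.is_monoid[OF group_W] by (rule monoid.one_closed)

lemma aperm_one: assumes n: "1 \<le> n" shows "aperm n \<one>\<^bsub>W_aff n\<^esub> = id"
  by (rule ext, rule aperm_eqI[OF n one_closed_W]) (simp only: act_one id_apply)

lemma inv_closed_W: "x \<in> carrier (W_aff n) \<Longrightarrow> inv\<^bsub>W_aff n\<^esub> x \<in> carrier (W_aff n)"
  by (rule group.inv_closed[OF group_W])

lemma aperm_inv_cancel:
  assumes n: "1 \<le> n" and x: "x \<in> carrier (W_aff n)"
  shows "aperm n x \<circ> aperm n (inv\<^bsub>W_aff n\<^esub> x) = id" "aperm n (inv\<^bsub>W_aff n\<^esub> x) \<circ> aperm n x = id"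
  unfolding aperm_mult[OF n x inv_closed_W[OF x], symmetric] aperm_mult[OF n inv_closed_W[OF x] x, symmetric]
    group.r_inv[OF group_W x] group.l_inv[OF group_W x] by (rule aperm_one[OF n])+

lemma affine_perm_aperm:
  assumes n: "1 \<le> n" and x: "x \<in> carrier (W_aff n)" shows "affine_perm n (aperm n x)"
  unfolding affine_perm_def
proof (intro conjI allI)
  show "bij (aperm n x)" by (rule o_bij[OF aperm_inv_cancel(2,1)[OF n x]])
  have w: "snd x \<in> signed_perms n" using x by (simp add: carrier_W)
  have neg: "snd x (\<lambda>j. - z j) = (\<lambda>j. - snd x z j)" for z
    by (rule ext) (rule signed_perms_linear(2)[OF w])
  show "aperm n x (1 - m) = 1 - aperm n x m" for m
    by (rule aperm_eqI[OF n x]) 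
      (simp add: position_vec_mirror[OF n] position_vec_aperm[OF n x] act_eq neg form_eq sum_negf)
  show "aperm n x (m + 2 * int n) = aperm n x m + 2 * int n" for m
    by (rule aperm_eqI[OF n x]) (simp add: position_vec_shift[OF n] position_vec_aperm[OF n x] act_eq)
qed

lemma aperm_inv:
  assumes n: "1 \<le> n" and x: "x \<in> carrier (W_aff n)" shows "aperm n (inv\<^bsub>W_aff n\<^esub> x) = finv (aperm n x)"
  by (rule finv_eqI[OF affine_perm_aperm[OF n x], symmetric])
    (use fun_cong[OF aperm_inv_cancel(1)[OF n x]] in simp)

lemma aperm_inj:
  assumes n: "1 \<le> n" and x: "x \<in> carrier (W_aff n)" "y \<in> carrier (W_aff n)" and e: "aperm n x = aperm n y"
  shows "x = y"
proof -
  have w: "snd x \<in> signed_perms n" "snd y \<in> signed_perms n" using x by (auto simp: carrier_W)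
  have a: "act TC n x (eps k, 0) = act TC n y (eps k, 0)" if "k \<in> {1..n}" for k
    using position_vec_aperm[OF n x(1), of "int k"] position_vec_aperm[OF n x(2), of "int k"] e position_vec_low[OF that, of 0] by simp
  then have s: "snd x = snd y" by (intro signed_perms_eqI[OF w]) (simp add: act_eq)
  obtain v where v: "v \<in> signed_perms n" "snd x \<circ> v = id" using signed_perms_inverse[OF w(1)] by blast
  have "fst x k = fst y k" if "k \<in> {1..n}" for k
  proof -
    from signed_perms_eps[OF v(1) that]
    obtain l where l: "l \<in> {1..n}" "v (eps k) = eps l \<or> v (eps k) = (\<lambda>j. - eps l j)" .
    have vx: "snd x (v (eps k)) = eps k" using fun_cong[OF v(2), of "eps k"] by simp
    have "snd x (eps l) = eps k \<or> snd x (eps l) = (\<lambda>j. - eps k j)"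
      using l(2)
    proof
      assume "v (eps k) = eps l"
      then show ?thesis using vx by simp
    next
      assume "v (eps k) = (\<lambda>j. - eps l j)"
      then have "- snd x (eps l) j = eps k j" for j
        using vx signed_perms_linear(2)[OF w(1), of "eps l" j] by simp
      then have "snd x (eps l) j = - eps k j" for j by (metis minus_minus)
      then show ?thesis by blast
    qed
    moreover have "form TC n (snd x (eps l)) (fst x) = form TC n (snd x (eps l)) (fst y)" 
      using a[OF l(1)] s by (simp add: act_eq)
    ultimately show ?thesis using sum_eps(2)[OF that] by (auto simp: form_eq sum_negf)
  qed
  moreover have "fst x k = fst y k" if "k \<notin> {1..n}" for k using x that by (simp add: carrier_W)
  ultimately have "fst x = fst y" by blast
  then show ?thesis using s by (simp add: prod_eq_iff)
qed

section \<open>Reflections as permutations\<close>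

lemma sB_zero: assumes "1 \<le> n" shows "sB n 0 = (eps 1, \<lambda>z k. (if k = 1 then - 1 else 1) * z k)"
proof -
  have 1: "1 \<in> {1..n}" using assms by simp
  have f: "form TB n z (\<lambda>k. - eps 1 k) = - 2 * z 1" for z
    using sum_eps(1)[OF 1, of z] by (simp add: form_def sum_negf)
  have e: "form TB n (\<lambda>k. - eps 1 k) (\<lambda>k. - eps 1 k) = 2" unfolding f by (simp add: eps_def)
  have d: "2 * form TB n z (\<lambda>k. - eps 1 k) div form TB n (\<lambda>k. - eps 1 k) (\<lambda>k. - eps 1 k) = - 2 * z 1" for z
    unfolding e unfolding f by simp
  have "sB n 0 = (\<lambda>k. eps 1 k, \<lambda>z k. z k - (- 2 * z 1) * - eps 1 k)"
    unfolding sB_def simple_root_def by (simp add: nu_def e d del: One_nat_def) (simp add: f del: One_nat_def)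
  then show ?thesis by (auto simp: eps_def fun_eq_iff)
qed

lemma sB_last: assumes "1 \<le> n" shows "sB n n = (\<lambda>k. 0, \<lambda>z k. (if k = n then - 1 else 1) * z k)"
proof -
  have 1: "n \<in> {1..n}" using assms by simp
  have f: "form TB n z (eps n) = 2 * z n" for z
    using sum_eps(1)[OF 1, of z] by (simp add: form_def)
  have e: "form TB n (eps n) (eps n) = 2" unfolding f by (simp add: eps_def)
  have d: "2 * form TB n z (eps n) div form TB n (eps n) (eps n) = 2 * z n" for z
    unfolding e unfolding f by simp
  have "sB n n = (\<lambda>k. 0, \<lambda>z k. z k - (2 * z n) * eps n k)"
    unfolding sB_def simple_root_def using assms by (simp add: nu_def d)
  then show ?thesis by (auto simp: eps_def fun_eq_iff)
qed

lemma sB_mid: assumes "0 < i" "i < n" shows "sB n i = (\<lambda>k. 0, \<lambda>z k. z (Transposition.transpose i (i + 1) k))"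
proof -
  let ?a = "\<lambda>k. eps i k - eps (i + 1) k"
  have 1: "i \<in> {1..n}" "i + 1 \<in> {1..n}" using assms by auto
  have f: "form TB n z ?a = 2 * (z i - z (i + 1))" for z
    using sum_eps(1)[OF 1(1), of z] sum_eps(1)[OF 1(2), of z] by (simp add: form_def right_diff_distrib sum_subtractf)
  have e: "form TB n ?a ?a = 4" unfolding f by (simp add: eps_def)
  have d: "2 * form TB n z ?a div form TB n ?a ?a = z i - z (i + 1)" for z
    unfolding e unfolding f by simp
  have "sB n i = (\<lambda>k. 0, \<lambda>z k. z k - (z i - z (i + 1)) * ?a k)"
    unfolding sB_def simple_root_def using assms d by (simp add: nu_def)
  moreover have "z k - (z i - z (i + 1)) * ?a k = z (Transposition.transpose i (i + 1) k)" for z k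
    by (simp add: eps_def Transposition.transpose_def)
  ultimately show ?thesis by simp
qed

lemma sB_carrier: assumes "1 \<le> n" "i \<le> n" shows "sB n i \<in> carrier (W_aff n)"
proof -
  consider "i = 0" | "0 < i" "i < n" | "i = n" using assms by linarith
  then show ?thesis
  proof cases
    case 1
    have "(\<lambda>z k. (if k = 1 then - 1 else 1) * z (id k)) \<in> signed_perms n"
      using assms by (intro signed_permsI permutes_id) auto
    then show ?thesis using 1 assms by (simp add: carrier_W sB_zero eps_def)
  next
    case 2
    have "(\<lambda>z k. 1 * z (Transposition.transpose i (i + 1) k)) \<in> signed_perms n"
      using 2 by (intro signed_permsI permutes_swap_id) auto
    then show ?thesis using 2 by (simp add: carrier_W sB_mid)
  next
    case 3
    have "(\<lambda>z k. (if k = n then - 1 else 1) * z (id k)) \<in> signed_perms n"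
      using assms by (intro signed_permsI permutes_id) auto
    then show ?thesis using 3 assms by (simp add: carrier_W sB_last)
  qed
qed

text \<open>
  On the window \<open>{1..n}\<close> a reflection of type \<open>B\<close> acts as a transposition of neighbours; at the two ends
  only one of the neighbours is in the window.
\<close>

lemma affine_refl_window:
  assumes "1 \<le> m" "m \<le> int n" "0 \<le> i" "i \<le> int n"
  shows "affine_refl n i (i + 1) m = (if m = i then m + 1 else if m = i + 1 then m - 1 else m)"
proof -
  have 1: "2 * int n dvd m + (i + 1) - 1 \<longleftrightarrow> m = int n \<and> i = int n"
  proof -
    have "2 * int n dvd m + (i + 1) - 1 \<longleftrightarrow> 2 * int n dvd m + i - 2 * int n"
      using dvd_diff_left_iff[of "2 * int n" "2 * int n" "m + i"] by simp
    then show ?thesis using assms small_dvd_iff[of "m + i - 2 * int n" n] by auto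
  qed
  have "2 * int n dvd m - i \<longleftrightarrow> m = i" "2 * int n dvd m - (i + 1) \<longleftrightarrow> m = i + 1" "2 * int n dvd m + i - 1 \<longleftrightarrow> m + i = 1"
    using assms by (auto simp: small_dvd_iff)
  then show ?thesis using assms 1 unfolding affine_refl_def by auto
qed

lemma aperm_sB: assumes n: "3 \<le> n" "i \<le> n" shows "aperm n (sB n i) = affine_refl n (int i) (int i + 1)"
proof (rule affine_perm_eqI)
  have n1: "1 \<le> n" using n by simp
  have c: "sB n i \<in> carrier (W_aff n)" using sB_carrier[OF n1 n(2)] .
  show "1 \<le> n" by fact
  show "affine_perm n (aperm n (sB n i))" using affine_perm_aperm[OF n1 c] .
  show "affine_perm n (affine_refl n (int i) (int i + 1))" using affine_perm_end_swap[OF n(1)] .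
  fix m assume m: "1 \<le> m" "m \<le> int n"
  define l where "l = nat m"
  have l: "m = int l" "l \<in> {1..n}" using m by (auto simp: l_def)
  have pm: "position_vec n m = (eps l, 0)" using position_vec_low[OF l(2), of 0] l by simp
  have w: "affine_refl n (int i) (int i + 1) m = (if m = int i then m + 1 else if m = int i + 1 then m - 1 else m)"
    using affine_refl_window[OF m] n by simp
  show "aperm n (sB n i) m = affine_refl n (int i) (int i + 1) m"
  proof (rule aperm_eqI[OF n1 c])
    consider "i = 0" | "0 < i" "i < n" | "i = n" using n by linarith
    then show "act TC n (sB n i) (position_vec n m) = position_vec n (affine_refl n (int i) (int i + 1) m)"
    proof cases
      case 1
      have s: "(\<Sum>k\<in>{1..n}. z k * eps 1 k) = z 1" for z using sum_eps(1)[of 1 n z] n1 by simp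
      show ?thesis
      proof (cases "l = 1")
        case True
        have "position_vec n 0 = (\<lambda>j. - eps 1 j, 1)" using position_vec_high[of 1 n 0] n1 by simp
        then show ?thesis using True 1 l pm w s by (auto simp: act_eq sB_zero[OF n1] form_eq eps_def fun_eq_iff)
      next
        case False
        then show ?thesis using 1 l pm w s by (auto simp: act_eq sB_zero[OF n1] form_eq eps_def fun_eq_iff)
      qed
    next
      case 2
      have r: "affine_refl n (int i) (int i + 1) m = int (Transposition.transpose i (i + 1) l)"
        using w l by (auto simp: Transposition.transpose_def)
      have t: "Transposition.transpose i (i + 1) l \<in> {1..n}" using 2 l by (auto simp: Transposition.transpose_def)
      have "eps l (Transposition.transpose i (i + 1) k) = eps (Transposition.transpose i (i + 1) l) k" for k
        by (auto simp: eps_def Transposition.transpose_def)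
      then show ?thesis using position_vec_low[OF t, of 0] unfolding r pm
        by (simp add: act_eq sB_mid[OF 2] form_eq)
    next
      case 3
      show ?thesis
      proof (cases "l = n")
        case True
        have "position_vec n (int n + 1) = (\<lambda>j. - eps n j, 0)" using position_vec_high[of n n 1] n1 by simp
        then show ?thesis using True 3 l pm w by (auto simp: act_eq sB_last[OF n1] form_eq eps_def fun_eq_iff)
      next
        case False
        then show ?thesis using 3 l pm w by (auto simp: act_eq sB_last[OF n1] form_eq eps_def fun_eq_iff)
      qed
    qed
  qed
qed

lemma srefl_carrier: assumes "rank_ok X n" "i \<le> n" shows "srefl X n i \<in> carrier (W_aff n)"
proof -
  have n: "1 \<le> n" using rank_ok_ge3 assms by fastforce
  show ?thesis using n assms sB_carrier[OF n] by (auto simp: srefl_def intro!: mult_closed_W)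
qed

lemma aperm_srefl: assumes X: "rank_ok X n" and i: "i \<le> n" shows "aperm n (srefl X n i) = simple_perm X n i"
proof -
  have n: "3 \<le> n" "1 \<le> n" using rank_ok_ge3[OF X] by auto
  have c: "sB n i \<in> carrier (W_aff n)" if "i \<le> n" for i using sB_carrier[OF n(2) that] .
  consider (z) "i = 0" "X \<noteq> TB" | (l) "i = n" "X = TD" "i \<noteq> 0" | (m) "\<not> (i = 0 \<and> X \<noteq> TB)" "\<not> (i = n \<and> X = TD)" by blast
  then show ?thesis
  proof cases
    case z
    have "srefl X n i = sB n 0 \<otimes>\<^bsub>W_aff n\<^esub> sB n 1 \<otimes>\<^bsub>W_aff n\<^esub> sB n 0" using z by (simp add: srefl_def)
    then have "aperm n (srefl X n i) = end_swap n 0 \<circ> affine_refl n 1 2 \<circ> end_swap n 0"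
      using n c by (simp add: aperm_mult mult_closed_W aperm_sB)
    also have "\<dots> = affine_refl n 0 2"
      using refl_conj[OF affine_perm_end_swap[OF n(1)], of 0 1 2] end_swap_invol[OF n(1), of 0]
        end_swap_small(1)[OF n(1), of 1] end_swap_small(1)[OF n(1), of 2] n by (auto simp: fun_eq_iff)
    also have "\<dots> = affine_refl n (-1) 1" 
      using refl_mirror[of n "-1" 1] n by (simp add: small_dvd_iff)
    also have "\<dots> = simple_perm X n i" using z by (simp add: simple_perm_def node_simps)
    finally show ?thesis .
  next
    case l
    have i1: "int (n - 1) = int n - 1" using n by simp
    have n4: "4 \<le> n" using X l by (simp add: rank_ok_def)
    have "srefl X n i = sB n n \<otimes>\<^bsub>W_aff n\<^esub> sB n (n - 1) \<otimes>\<^bsub>W_aff n\<^esub> sB n n" using l by (simp add: srefl_def)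
    then have "aperm n (srefl X n i) = end_swap n n \<circ> affine_refl n (int n - 1) (int n) \<circ> end_swap n n"
      using n c by (simp add: aperm_mult mult_closed_W aperm_sB i1)
    also have "\<dots> = affine_refl n (int n - 1) (int n + 1)"
      using refl_conj[OF affine_perm_end_swap[OF n(1)], of n "int n - 1" "int n"] end_swap_invol[OF n(1), of n]
        end_swap_small(2)[OF n(1), of "int n - 1"] end_swap_small(2)[OF n(1), of "int n"] n by (auto simp: fun_eq_iff)
    also have "\<dots> = simple_perm X n i" using l by (simp add: simple_perm_def node_simps)
    finally show ?thesis .
  next
    case m
    then have "srefl X n i = sB n i" by (auto simp: srefl_def)
    then show ?thesis using aperm_sB[OF n(1) i] m by (auto simp: simple_perm_def node_simps)
  qed
qed

section \<open>Words and the exchange condition\<close>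

lemma word_elt_carrier: "rank_ok X n \<Longrightarrow> set is \<subseteq> {0..n} \<Longrightarrow> word_elt X n is \<in> carrier (W_aff n)"
  by (induction "is") (auto simp: one_closed_W srefl_carrier mult_closed_W)

lemma mult_assoc_W:
  assumes "x \<in> carrier (W_aff n)" "y \<in> carrier (W_aff n)" "z \<in> carrier (W_aff n)"
  shows "x \<otimes>\<^bsub>W_aff n\<^esub> y \<otimes>\<^bsub>W_aff n\<^esub> z = x \<otimes>\<^bsub>W_aff n\<^esub> (y \<otimes>\<^bsub>W_aff n\<^esub> z)"
  using group.is_monoid[OF group_W] assms by (rule monoid.m_assoc)

lemma word_elt_append:
  assumes "rank_ok X n" "set is \<subseteq> {0..n}" "set js \<subseteq> {0..n}"
  shows "word_elt X n (is @ js) = word_elt X n js \<otimes>\<^bsub>W_aff n\<^esub> word_elt X n is"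
  using assms(2)
proof (induction "is")
  case Nil
  then show ?case using word_elt_carrier[OF assms(1,3)] group.is_monoid[OF group_W] by (simp add: monoid.r_one)
next
  case (Cons i "is")
  then show ?case using assms by (simp add: mult_assoc_W word_elt_carrier srefl_carrier)
qed

lemma srefl_square:
  assumes "rank_ok X n" "i \<le> n" shows "srefl X n i \<otimes>\<^bsub>W_aff n\<^esub> srefl X n i = \<one>\<^bsub>W_aff n\<^esub>"
proof -
  have n: "1 \<le> n" using rank_ok_ge3 assms by fastforce
  note c = srefl_carrier[OF assms]
  show ?thesis
    by (rule aperm_inj[OF n mult_closed_W[OF c c] one_closed_W])
      (simp add: aperm_mult[OF n c c] aperm_one[OF n] aperm_srefl[OF assms] fun_eq_iff simple_perm_invol[OF assms(1)])
qed

lemma srefl_inv: assumes "rank_ok X n" "i \<le> n" shows "inv\<^bsub>W_aff n\<^esub> (srefl X n i) = srefl X n i"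
  using group.inv_equality[OF group_W srefl_square[OF assms]] srefl_carrier[OF assms] by simp

lemma word_elt_rev:
  assumes X: "rank_ok X n" and "set is \<subseteq> {0..n}"
  shows "word_elt X n (rev is) = inv\<^bsub>W_aff n\<^esub> (word_elt X n is)"
  using assms(2)
proof (induction "is")
  case Nil
  then show ?case using group.is_monoid[OF group_W] by (simp add: monoid.inv_one)
next
  case (Cons i "is")
  then have i: "i \<le> n" "set is \<subseteq> {0..n}" by auto
  have "word_elt X n (rev (i # is)) = word_elt X n [i] \<otimes>\<^bsub>W_aff n\<^esub> word_elt X n (rev is)"
    using i X word_elt_append[OF X, of "rev is" "[i]"] by simp
  also have "\<dots> = srefl X n i \<otimes>\<^bsub>W_aff n\<^esub> inv\<^bsub>W_aff n\<^esub> (word_elt X n is)"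
    using Cons i monoid.l_one[OF group.is_monoid[OF group_W] srefl_carrier[OF X i(1)]] by simp
  also have "\<dots> = inv\<^bsub>W_aff n\<^esub> (word_elt X n (i # is))"
    using group.inv_mult_group[OF group_W word_elt_carrier[OF X i(2)] srefl_carrier[OF X i(1)]] srefl_inv[OF X i(1)] by simp
  finally show ?case .
qed

lemma mult_srefl_cancel:
  assumes "rank_ok X n" "i \<le> n" "x \<in> carrier (W_aff n)"
  shows "x \<otimes>\<^bsub>W_aff n\<^esub> srefl X n i \<otimes>\<^bsub>W_aff n\<^esub> srefl X n i = x"
  using assms srefl_carrier[OF assms(1,2)] srefl_square[OF assms(1,2)] monoid.r_one[OF group.is_monoid[OF group_W]]
  by (simp add: mult_assoc_W)

lemma descents_srefl_right:
  assumes X: "rank_ok X n" and i: "i \<le> n" and x: "x \<in> carrier (W_aff n)"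
  shows "i \<in> descents X n (aperm n (x \<otimes>\<^bsub>W_aff n\<^esub> srefl X n i)) \<longleftrightarrow> i \<notin> descents X n (aperm n x)"
proof -
  have n: "1 \<le> n" using rank_ok_ge3 X by fastforce
  have ne: "aperm n x (node_lo X n i) \<noteq> aperm n x (node_hi X n i)"
    using affine_perm_inj[OF affine_perm_aperm[OF n x]] lo_hi_less[of X n i] by auto
  show ?thesis using ne i
    by (simp add: descents_def aperm_mult[OF n x srefl_carrier[OF X i]] aperm_srefl[OF X i] simple_perm_lo simple_perm_hi[OF X] not_less le_less)
qed

text \<open>
  Follow the root \<open>\<alpha>\<^sub>i\<close> through the word until it becomes negative; the letter responsible for it is
  deleted and \<open>s\<^sub>i\<close> is put in front instead.
\<close>

lemma word_exchange:
  assumes X: "rank_ok X n" and i: "i \<le> n"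
  shows "set is \<subseteq> {0..n} \<Longrightarrow> i \<in> descents X n (aperm n (word_elt X n is)) \<Longrightarrow>
    \<exists>js. set js \<subseteq> {0..n} \<and> length is = Suc (length js) \<and> word_elt X n (i # js) = word_elt X n is"
proof (induction "is" rule: rev_induct)
  case Nil
  have n: "1 \<le> n" using rank_ok_ge3 X by fastforce
  show ?case using Nil lo_hi_less[of X n i] by (simp add: aperm_one[OF n] descents_def)
next
  case (snoc j "is")
  have n: "1 \<le> n" using rank_ok_ge3 X by fastforce
  have j: "j \<le> n" "set is \<subseteq> {0..n}" using snoc.prems by auto
  let ?x = "word_elt X n is"
  have x: "?x \<in> carrier (W_aff n)" using word_elt_carrier[OF X j(2)] .
  note cj = srefl_carrier[OF X j(1)] and ci = srefl_carrier[OF X i]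
  have app: "word_elt X n (is @ [j]) = srefl X n j \<otimes>\<^bsub>W_aff n\<^esub> ?x"
    using word_elt_append[OF X j(2), of "[j]"] j cj by (simp add: monoid.l_one[OF group.is_monoid[OF group_W]])
  show ?case
  proof (cases "i \<in> descents X n (aperm n ?x)")
    case True
    then obtain js where js: "set js \<subseteq> {0..n}" "length is = Suc (length js)" "word_elt X n (i # js) = ?x"
      using snoc.IH[OF j(2)] by blast
    have "word_elt X n ((i # js) @ [j]) = word_elt X n (is @ [j])"
      using word_elt_append[OF X _, of "i # js" "[j]"] word_elt_append[OF X j(2), of "[j]"] js i j by simp
    then show ?thesis using js j by (intro exI[of _ "js @ [j]"]) simp
  next
    case False
    have "simple_perm X n j \<circ> aperm n ?x = aperm n ?x \<circ> simple_perm X n i"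
    proof (rule simple_perm_exchange[OF X i j(1) affine_perm_aperm[OF n x]])
      show "aperm n ?x (node_lo X n i) \<le> aperm n ?x (node_hi X n i)" using False i by (simp add: descents_def)
      show "simple_perm X n j (aperm n ?x (node_hi X n i)) < simple_perm X n j (aperm n ?x (node_lo X n i))"
        using snoc.prems(2) unfolding app aperm_mult[OF n cj x] aperm_srefl[OF X j(1)] by (simp add: descents_def)
    qed
    then have "aperm n (srefl X n j \<otimes>\<^bsub>W_aff n\<^esub> ?x) = aperm n (?x \<otimes>\<^bsub>W_aff n\<^esub> srefl X n i)"
      unfolding aperm_mult[OF n cj x] aperm_mult[OF n x ci] aperm_srefl[OF X j(1)] aperm_srefl[OF X i] .
    then have "srefl X n j \<otimes>\<^bsub>W_aff n\<^esub> ?x = ?x \<otimes>\<^bsub>W_aff n\<^esub> srefl X n i"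
      using aperm_inj[OF n mult_closed_W[OF cj x] mult_closed_W[OF x ci]] by blast
    then show ?thesis using app j by (intro exI[of _ "is"]) simp
  qed
qed

text \<open>
  Otherwise the rest of the word would have the descent \<open>i\<close>, and the exchange condition would
  produce a word for \<open>x\<close> that is shorter by two letters.
\<close>

lemma reduced_hd_desc:
  assumes X: "rank_ok X n" and r: "reduced_word X n x (i # is)"
  shows "i \<in> descents X n (aperm n x)"
proof (rule ccontr)
  assume nd: "i \<notin> descents X n (aperm n x)"
  have i: "i \<le> n" "set is \<subseteq> {0..n}" and x: "x = word_elt X n is \<otimes>\<^bsub>W_aff n\<^esub> srefl X n i" 
    using r by (auto simp: reduced_word_def)
  have c: "word_elt X n is \<in> carrier (W_aff n)" using word_elt_carrier[OF X i(2)] .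
  have "i \<in> descents X n (aperm n (word_elt X n is))"
    using descents_srefl_right[OF X i(1) c] nd x by simp
  then obtain js where js: "set js \<subseteq> {0..n}" "length is = Suc (length js)" "word_elt X n (i # js) = word_elt X n is"
    using word_exchange[OF X i(1,2)] by blast
  have "word_elt X n js = x" 
    using mult_srefl_cancel[OF X i(1) word_elt_carrier[OF X js(1)]] js(3) x by simp
  then have "length (i # is) \<le> length js" using r js(1) by (auto simp: reduced_word_def)
  then show False using js(2) by simp
qed

lemma reduced_word_starting:
  assumes X: "rank_ok X n" and r: "reduced_word X n x is" and i: "i \<in> descents X n (aperm n x)"
  shows "\<exists>js. reduced_word X n x (i # js)"
proof -
  have "set is \<subseteq> {0..n}" "word_elt X n is = x" using r by (auto simp: reduced_word_def)
  then obtain js where "set js \<subseteq> {0..n}" "length is = Suc (length js)" "word_elt X n (i # js) = x"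
    using word_exchange[OF X, of i "is"] i by (auto simp: descents_def)
  then have "reduced_word X n x (i # js)" using r i by (auto simp: reduced_word_def descents_def)
  then show ?thesis by blast
qed

lemma reduced_word_rev:
  assumes X: "rank_ok X n" and x: "x \<in> carrier (W_aff n)" and r: "reduced_word X n x is"
  shows "reduced_word X n (inv\<^bsub>W_aff n\<^esub> x) (rev is)"
  unfolding reduced_word_def
proof (intro conjI allI impI)
  have s: "set is \<subseteq> {0..n}" and w: "word_elt X n is = x" 
    and m: "\<And>js. set js \<subseteq> {0..n} \<Longrightarrow> word_elt X n js = x \<Longrightarrow> length is \<le> length js"
    using r by (auto simp: reduced_word_def)
  show "set (rev is) \<subseteq> {0..n}" using s by simp
  show "word_elt X n (rev is) = inv\<^bsub>W_aff n\<^esub> x" using word_elt_rev[OF X s] w by simp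
  fix js assume js: "set js \<subseteq> {0..n} \<and> word_elt X n js = inv\<^bsub>W_aff n\<^esub> x"
  then have "word_elt X n (rev js) = x" using word_elt_rev[OF X, of js] group.inv_inv[OF group_W x] by simp
  then show "length (rev is) \<le> length js" using m[of "rev js"] js by simp
qed

lemma reduced_word_exists:
  assumes "set is \<subseteq> {0..n}" "word_elt X n is = x" shows "\<exists>js. reduced_word X n x js"
proof -
  let ?P = "\<lambda>js. set js \<subseteq> {0..n} \<and> word_elt X n js = x"
  have "?P is" using assms by simp
  from ex_has_least_nat[of ?P, OF this, of length] show ?thesis unfolding reduced_word_def by blast
qed

lemma affine_weyl_iff:
  assumes X: "rank_ok X n" shows "x \<in> affine_weyl X n \<longleftrightarrow> (\<exists>is. set is \<subseteq> {0..n} \<and> word_elt X n is = x)"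
proof
  assume "x \<in> affine_weyl X n"
  then show "\<exists>is. set is \<subseteq> {0..n} \<and> word_elt X n is = x"
    unfolding affine_weyl_def
  proof (induction rule: generate.induct)
    case one
    show ?case by (intro exI[of _ "[]"]) simp
  next
    case (incl h)
    then obtain i where "i \<le> n" "h = srefl X n i" by auto
    then show ?case using monoid.l_one[OF group.is_monoid[OF group_W] srefl_carrier[OF X]]
      by (intro exI[of _ "[i]"]) simp
  next
    case (inv h)
    then obtain i where "i \<le> n" "h = srefl X n i" by auto
    then show ?case using monoid.l_one[OF group.is_monoid[OF group_W] srefl_carrier[OF X]] srefl_inv[OF X]
      by (intro exI[of _ "[i]"]) simp
  next
    case (eng a b)
    then obtain u v where "set u \<subseteq> {0..n}" "word_elt X n u = a" "set v \<subseteq> {0..n}" "word_elt X n v = b" by blast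
    then show ?case using word_elt_append[OF X] by (intro exI[of _ "v @ u"]) simp
  qed
next
  assume "\<exists>is. set is \<subseteq> {0..n} \<and> word_elt X n is = x"
  then obtain "is" where "set is \<subseteq> {0..n}" "word_elt X n is = x" by blast
  then show "x \<in> affine_weyl X n"
  proof (induction "is" arbitrary: x)
    case Nil then show ?case by (auto simp: affine_weyl_def intro: generate.one)
  next
    case (Cons i "is")
    then have "word_elt X n is \<in> generate (W_aff n) (srefl X n ` {0..n})" "srefl X n i \<in> srefl X n ` {0..n}"
      by (auto simp: affine_weyl_def)
    then have "word_elt X n is \<otimes>\<^bsub>W_aff n\<^esub> srefl X n i \<in> generate (W_aff n) (srefl X n ` {0..n})"
      by (intro generate.eng[OF _ generate.incl])
    then show ?case using Cons.prems(2) by (simp add: affine_weyl_def)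
  qed
qed

section \<open>Roots and the characterization of minimal NGT\<close>

definition neg_avec :: "avec \<Rightarrow> avec" where "neg_avec p = (\<lambda>k. - fst p k, - snd p)"

text \<open>
  The forms of types \<open>B\<close> and \<open>C\<close> differ by the factor \<open>2\<close>; doubling the nonaffine part turns the action of
  type \<open>B\<close> into that of type \<open>C\<close>.
\<close>

definition to_TC :: "affine_type \<Rightarrow> avec \<Rightarrow> avec" where
  "to_TC X p = (if X = TB then (\<lambda>k. 2 * fst p k, snd p) else p)"

text \<open>
  The simple root of a node, made comparable by \<open>to_TC\<close>, is this multiple of the difference of the
  vectors at its two positions.
\<close>

definition root_scale :: "affine_type \<Rightarrow> nat \<Rightarrow> nat \<Rightarrow> int" where
  "root_scale X n i = (if X = TB \<and> 0 < i \<and> i < n then 2 else 1)"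

definition pair_root :: "nat \<Rightarrow> int \<Rightarrow> int \<Rightarrow> int \<Rightarrow> avec" where
  "pair_root n c a b = (\<lambda>k. c * (fst (position_vec n a) k - fst (position_vec n b) k), c * (snd (position_vec n a) - snd (position_vec n b)))"

lemma to_TC_inj: "to_TC X p = to_TC X q \<longleftrightarrow> p = q"
  by (auto simp: to_TC_def prod_eq_iff fun_eq_iff split: if_splits)

lemma neg_avec_inj: "neg_avec p = neg_avec q \<longleftrightarrow> p = q"
  by (auto simp: neg_avec_def prod_eq_iff fun_eq_iff)

lemma to_TC_neg: "to_TC X (neg_avec p) = neg_avec (to_TC X p)"
  by (auto simp: to_TC_def neg_avec_def)

lemma position_vec_special: 
  assumes "3 \<le> n" 
  shows "position_vec n 0 = (\<lambda>k. - eps 1 k, 1)" "position_vec n (-1) = (\<lambda>k. - eps 2 k, 1)" "position_vec n (int n + 1) = (\<lambda>k. - eps n k, 0)"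
  using position_vec_high[of 1 n 0] position_vec_high[of 2 n 0] position_vec_high[of n n 1] assms by auto

lemma position_vec_nat: "1 \<le> i \<Longrightarrow> i \<le> n \<Longrightarrow> position_vec n (int i) = (eps i, 0)"
  using position_vec_low[of i n 0] by simp

lemma to_TC_simple_root:
  assumes X: "rank_ok X n" and i: "i \<le> n"
  shows "to_TC X (simple_root X n i) = pair_root n (root_scale X n i) (node_lo X n i) (node_hi X n i)"
proof -
  have n: "3 \<le> n" using rank_ok_ge3 X by blast
  have s: "position_vec n (int i + 1) = (eps (i + 1), 0)" if "i < n" for i using position_vec_nat[of "i + 1" n] that by (simp add: add.commute)
  have n1: "position_vec n (int n - 1) = (eps (n - 1), 0)" using position_vec_nat[of "n - 1" n] n by (simp add: of_nat_diff)
  consider "i = 0" | "0 < i" "i < n" | "i = n" using i by linarith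
  then show ?thesis
  proof cases
    case 1
    have p: "position_vec n 1 = (eps 1, 0)" using position_vec_nat[of 1 n] n by simp
    show ?thesis using 1 n p by (cases X) (auto simp: to_TC_def simple_root_def pair_root_def root_scale_def node_simps position_vec_special[OF n])
  next
    case 2
    then show ?thesis using n s[OF 2(2)] position_vec_nat[of i n] by (cases X) (auto simp: to_TC_def simple_root_def pair_root_def root_scale_def node_simps)
  next
    case 3
    show ?thesis using 3 n n1 position_vec_nat[of n n] by (cases X) (auto simp: to_TC_def simple_root_def pair_root_def root_scale_def node_simps position_vec_special[OF n])
  qed
qed

lemma act_to_TC: 
  assumes x: "x \<in> carrier (W_aff n)" shows "to_TC X (act X n x p) = act TC n x (to_TC X p)"
proof -
  have w: "snd x \<in> signed_perms n" using x by (simp add: carrier_W)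
  have d: "snd x (\<lambda>k. 2 * fst p k) = (\<lambda>k. 2 * snd x (fst p) k)" by (rule ext) (rule signed_perms_linear(3)[OF w])
  show ?thesis by (cases X) (auto simp: to_TC_def act_eq d form_eq sum_distrib_left mult.assoc)
qed

lemma act_pair_root:
  assumes n: "1 \<le> n" and x: "x \<in> carrier (W_aff n)"
  shows "act TC n x (pair_root n c a b) = pair_root n c (aperm n x a) (aperm n x b)"
proof -
  have w: "snd x \<in> signed_perms n" using x by (simp add: carrier_W)
  have d: "snd x (\<lambda>k. c * (z k - y k)) = (\<lambda>k. c * (snd x z k - snd x y k))" for z y
    by (rule ext) (simp add: signed_perms_linear(3,4)[OF w])
  have f: "form TC n (\<lambda>k. c * (z k - y k)) b = c * (form TC n z b - form TC n y b)" for z y b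
    by (simp add: form_eq sum_distrib_left sum_subtractf algebra_simps)
  show ?thesis unfolding pair_root_def position_vec_aperm[OF n x] act_eq fst_conv snd_conv d f by (simp add: algebra_simps)
qed

lemma act_neg: 
  assumes x: "x \<in> carrier (W_aff n)" shows "act X n x (neg_avec p) = neg_avec (act X n x p)"
proof -
  have w: "snd x \<in> signed_perms n" using x by (simp add: carrier_W)
  have d: "snd x (\<lambda>k. - fst p k) = (\<lambda>k. - snd x (fst p) k)" by (rule ext) (rule signed_perms_linear(2)[OF w])
  show ?thesis by (simp add: neg_avec_def act_eq d form_eq sum_negf)
qed

lemma pair_root_swap: "pair_root n c b a = neg_avec (pair_root n c a b)"
  by (simp add: pair_root_def neg_avec_def fun_eq_iff algebra_simps)

lemma to_TC_act_simple_root: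
  assumes X: "rank_ok X n" and i: "i \<le> n" and x: "x \<in> carrier (W_aff n)"
  shows "to_TC X (act X n x (simple_root X n i)) = 
     pair_root n (root_scale X n i) (aperm n x (node_lo X n i)) (aperm n x (node_hi X n i))"
proof -
  have n: "1 \<le> n" using rank_ok_ge3 X by fastforce
  show ?thesis unfolding act_to_TC[OF x] to_TC_simple_root[OF X i] act_pair_root[OF n x] ..
qed

lemma srefl_simple_root:
  assumes X: "rank_ok X n" and i: "i \<le> n"
  shows "act X n (srefl X n i) (simple_root X n i) = neg_avec (simple_root X n i)"
proof -
  have "to_TC X (act X n (srefl X n i) (simple_root X n i)) = to_TC X (neg_avec (simple_root X n i))"
    unfolding to_TC_act_simple_root[OF X i srefl_carrier[OF X i]] to_TC_neg to_TC_simple_root[OF X i] aperm_srefl[OF X i]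
      simple_perm_lo simple_perm_hi[OF X] by (rule pair_root_swap)
  then show ?thesis by (simp only: to_TC_inj)
qed

lemma act_inv_cancel:
  assumes "x \<in> carrier (W_aff n)" shows "act X n x (act X n (inv\<^bsub>W_aff n\<^esub> x) p) = p" "act X n (inv\<^bsub>W_aff n\<^esub> x) (act X n x p) = p"
  using act_mult[OF assms inv_closed_W[OF assms], of X p] act_mult[OF inv_closed_W[OF assms] assms, of X p]
    group.r_inv[OF group_W assms] group.l_inv[OF group_W assms] act_one[of X n p] by simp_all

lemma act_inj:
  assumes "x \<in> carrier (W_aff n)" "act X n x p = act X n x q" shows "p = q"
  using act_inv_cancel(2)[OF assms(1)] assms(2) by metis

lemma hd_root_seq: "is \<noteq> [] \<Longrightarrow> hd (root_seq X n is) = simple_root X n (hd is)"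
  by (cases "is") auto

lemma root_seq_nonempty: "is \<noteq> [] \<Longrightarrow> root_seq X n is \<noteq> []"
  by (cases "is") auto

text \<open>
  The last root is \<open>x\<^sup>-\<^sup>1(-\<alpha>\<^sub>j)\<close> for the last letter \<open>j\<close>.
\<close>

lemma last_root_seq:
  assumes X: "rank_ok X n"
  shows "set is \<subseteq> {0..n} \<Longrightarrow> is \<noteq> [] \<Longrightarrow> 
    last (root_seq X n is) = act X n (inv\<^bsub>W_aff n\<^esub> (word_elt X n is)) (neg_avec (simple_root X n (last is)))"
proof (induction "is")
  case (Cons i "is")
  have i: "i \<le> n" "set is \<subseteq> {0..n}" using Cons.prems by auto
  note ci = srefl_carrier[OF X i(1)] and cw = word_elt_carrier[OF X i(2)]
  have iv: "inv\<^bsub>W_aff n\<^esub> (word_elt X n (i # is)) = srefl X n i \<otimes>\<^bsub>W_aff n\<^esub> inv\<^bsub>W_aff n\<^esub> (word_elt X n is)"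
    using group.inv_mult_group[OF group_W cw ci] srefl_inv[OF X i(1)] by simp
  show ?case
  proof (cases "is = []")
    case True
    have "act X n (srefl X n i) (neg_avec (simple_root X n i)) = simple_root X n i"
      unfolding act_neg[OF ci] srefl_simple_root[OF X i(1)] by (simp add: neg_avec_def)
    then show ?thesis using True srefl_inv[OF X i(1)] monoid.l_one[OF group.is_monoid[OF group_W] ci] by simp
  next
    case False
    have "last (root_seq X n (i # is)) = act X n (srefl X n i) (last (root_seq X n is))"
      using root_seq_nonempty[OF False] by (simp add: last_map)
    also have "\<dots> = act X n (inv\<^bsub>W_aff n\<^esub> (word_elt X n (i # is))) (neg_avec (simple_root X n (last (i # is))))"
      unfolding iv act_mult[OF ci inv_closed_W[OF cw]] using Cons.IH[OF i(2) False] False by simp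
    finally show ?thesis .
  qed
qed simp

lemma pairing_nat:
  assumes "k \<in> {1..n}" "l \<in> {1..n}" shows "pairing n (int k) (int l) = of_bool (k = l)"
proof -
  have "\<not> 2 * int n dvd int k + int l - 1" using assms zdvd_imp_le[of "2 * int n" "int k + int l - 1"] by auto
  then show ?thesis using assms by (auto simp: pairing_def small_dvd_iff)
qed

lemma dot_position_vec:
  assumes n: "1 \<le> n" shows "(\<Sum>k\<in>{1..n}. fst (position_vec n a) k * fst (position_vec n b) k) = pairing n a b"
proof -
  have *: "\<exists>s k. k \<in> {1..n} \<and> fst (position_vec n a) = (\<lambda>j. s * eps k j) \<and> (\<forall>b. pairing n a b = s * pairing n (int k) b)" for a
  proof (rule position_cases[OF n, of a])
    fix k q assume k: "k \<in> {1..n}" and a: "a = int k + 2 * int n * q"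
    then show ?thesis by (intro exI[of _ 1] exI[of _ k]) (simp add: position_vec_low[OF k] pairing_shift)
  next
    fix k q assume k: "k \<in> {1..n}" and a: "a = 2 * int n * q + 1 - int k"
    have a': "a = 1 - int k + 2 * int n * q" using a by simp
    have "pairing n a b = - pairing n (int k) b" for b unfolding a' pairing_shift pairing_mirror ..
    then show ?thesis using k a by (intro exI[of _ "- 1"] exI[of _ k]) (simp add: position_vec_high[OF k])
  qed
  obtain s k where a: "k \<in> {1..n}" "fst (position_vec n a) = (\<lambda>j. s * eps k j)" "\<And>b. pairing n a b = s * pairing n (int k) b" using *[of a] by blast
  obtain r l where b: "l \<in> {1..n}" "fst (position_vec n b) = (\<lambda>j. r * eps l j)" "\<And>a. pairing n b a = r * pairing n (int l) a" using *[of b] by blast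
  have "(\<Sum>k\<in>{1..n}. fst (position_vec n a) k * fst (position_vec n b) k) = s * r * (\<Sum>j\<in>{1..n}. eps k j * eps l j)"
    unfolding a(2) b(2) by (simp add: sum_distrib_left mult_ac)
  also have "\<dots> = s * r * of_bool (k = l)" using sum_eps(2)[OF a(1), of "eps l"] by (simp add: eps_def)
  also have "\<dots> = pairing n a b"
    using a(3)[of b] b(3)[of "int k"] pairing_commute[of n "int k" b] pairing_nat[OF b(1) a(1)] by auto
  finally show ?thesis .
qed

lemma dot_pair_root:
  assumes n: "1 \<le> n" 
  shows "(\<Sum>k\<in>{1..n}. fst (pair_root n c a b) k * fst (pair_root n d p q) k) = 
     c * d * (pairing n a p - pairing n a q - pairing n b p + pairing n b q)"
proof -
  have "(\<Sum>k\<in>{1..n}. fst (pair_root n c a b) k * fst (pair_root n d p q) k) = 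
    (\<Sum>k\<in>{1..n}. c * d * (fst (position_vec n a) k * fst (position_vec n p) k - fst (position_vec n a) k * fst (position_vec n q) k
       - fst (position_vec n b) k * fst (position_vec n p) k + fst (position_vec n b) k * fst (position_vec n q) k))"
    by (intro sum.cong refl) (simp add: pair_root_def algebra_simps)
  also have "\<dots> = c * d * (pairing n a p - pairing n a q - pairing n b p + pairing n b q)"
    unfolding sum_distrib_left[symmetric] sum.distrib sum_subtractf dot_position_vec[OF n] ..
  finally show ?thesis .
qed

text \<open>
  An integral vector of norm two has exactly two nonzero coordinates, both of them \<open>\<plusminus>1\<close>.
\<close>

lemma norm_two_root:
  assumes s: "(\<Sum>k\<in>{1..n}. z k * z k) = (2::int)" and z: "\<And>k. k \<notin> {1..n} \<Longrightarrow> z k = 0"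
  shows "z \<in> roots X n"
proof -
  have nn: "0 \<le> z k * z k" for k by simp
  have one: "a \<in> {1, -1}" if "a \<noteq> 0" "a * a \<le> 2" for a :: int
  proof -
    have "\<bar>a\<bar> < 2"
    proof (rule ccontr)
      assume "\<not> \<bar>a\<bar> < 2"
      then have "2 * 2 \<le> \<bar>a\<bar> * \<bar>a\<bar>" by (intro mult_mono) auto
      then show False using that by (simp add: abs_mult_self_eq)
    qed
    then show ?thesis using that by auto
  qed
  have "\<exists>i\<in>{1..n}. z i \<noteq> 0" 
  proof (rule ccontr)
    assume "\<not> ?thesis" then have "(\<Sum>k\<in>{1..n}. z k * z k) = 0" by simp
    then show False using s by simp
  qed
  then obtain i where i: "i \<in> {1..n}" "z i \<noteq> 0" by blast
  have si: "z i * z i + (\<Sum>k\<in>{1..n} - {i}. z k * z k) = 2" using s sum.remove[OF _ i(1), of "\<lambda>k. z k * z k"] by simp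
  have "0 \<le> (\<Sum>k\<in>{1..n} - {i}. z k * z k)" by (intro sum_nonneg) simp
  then have zi: "z i \<in> {1, -1}" using one[OF i(2)] si by linarith
  then have s1: "(\<Sum>k\<in>{1..n} - {i}. z k * z k) = 1" using si by auto
  have "\<exists>j\<in>{1..n} - {i}. z j \<noteq> 0" 
  proof (rule ccontr)
    assume "\<not> ?thesis" then have "(\<Sum>k\<in>{1..n} - {i}. z k * z k) = 0" by simp
    then show False using s1 by simp
  qed
  then obtain j where j: "j \<in> {1..n} - {i}" "z j \<noteq> 0" by blast
  have sj: "z j * z j + (\<Sum>k\<in>{1..n} - {i} - {j}. z k * z k) = 1" using s1 sum.remove[OF _ j(1), of "\<lambda>k. z k * z k"] by simp
  have r0: "0 \<le> (\<Sum>k\<in>{1..n} - {i} - {j}. z k * z k)" by (intro sum_nonneg) simp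
  then have zj: "z j \<in> {1, -1}" using one[OF j(2)] sj by linarith
  then have "(\<Sum>k\<in>{1..n} - {i} - {j}. z k * z k) = 0" using sj by auto
  then have "\<forall>k\<in>{1..n} - {i} - {j}. z k * z k = 0" by (subst (asm) sum_nonneg_eq_0_iff) auto
  then have rest: "z k = 0" if "k \<noteq> i" "k \<noteq> j" for k using z[of k] that by (cases "k \<in> {1..n}") auto
  have "z = (\<lambda>k. z i * eps i k + z j * eps j k)" using rest j(1) by (auto simp: eps_def fun_eq_iff)
  then show ?thesis using zi zj i j unfolding roots_def by blast
qed

lemma simple_root_inj:
  assumes n: "3 \<le> n" and i: "i \<le> n" "i' \<le> n" and e: "simple_root X n i = simple_root X n i'"
  shows "i = i'"
proof -
  have pos: "0 < fst (simple_root X n i) i" if "1 \<le> i" "i \<le> n" for i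
    using that n by (cases X) (auto simp: simple_root_def eps_def)
  have neg: "fst (simple_root X n i) i' \<le> 0" if "i < i'" "i' \<le> n" for i i'
    using that n by (cases X) (auto simp: simple_root_def eps_def)
  have False if "i < i'" "i' \<le> n" "simple_root X n i = simple_root X n i'" for i i'
    using pos[of i'] neg[OF that(1,2)] that by simp
  then show ?thesis using i e by (metis linorder_neqE_nat)
qed

lemma rev_last: "v \<noteq> [] \<Longrightarrow> rev v = last v # rev (butlast v)"
  by (induction v rule: rev_induct) auto

text \<open>
  Descents on the two sides are the possible first and last letters of reduced words, and simple roots are
  distinct; so a common first and last root of all reduced words amounts to a single descent on either
  side. For the first root \<open>\<alpha>\<close> and the last root \<open>\<beta>\<close> of equal length, \<open>\<alpha> + \<beta>\<close> has this length as
  well iff \<open>2(\<alpha>, \<beta>) = -(\<alpha>, \<alpha>)\<close>. At a node outside \<open>norm_two_nodes\<close> this is impossible: in type \<open>B\<close> the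
  left-hand side is even and the right-hand side is odd in units of the norm of \<open>\<epsilon>\<^sub>k\<close>, and in type \<open>C\<close> the roots
  are \<open>\<plusminus>2\<epsilon>\<^sub>k\<close>, whose inner products are \<open>0\<close> or \<open>\<plusminus>4\<close>. At the other nodes it says that the inner
  product is \<open>-1\<close>, and then the sum is a root by \<open>norm_two_root\<close>.
\<close>

lemma minimal_NGT_iff:
  assumes X: "rank_ok X n" and x: "x \<in> carrier (W_aff n)"
  shows "minimal_NGT X n x \<longleftrightarrow> x \<in> affine_weyl X n \<and> (\<exists>i j. ngt X n (aperm n x) i j)"
proof -
  have n: "3 \<le> n" "1 \<le> n" using rank_ok_ge3[OF X] by auto
  let ?G = "aperm n x" and ?y = "inv\<^bsub>W_aff n\<^esub> x" let ?H = "finv ?G"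
  have y: "?y \<in> carrier (W_aff n)" using inv_closed_W[OF x] .
  have aH: "aperm n ?y = ?H" using aperm_inv[OF n(2) x] .
  define A where "A i = simple_root X n i" for i
  define B where "B j = act X n ?y (neg_avec (simple_root X n j))" for j
  define c :: int where "c = (if X = TB then 2 else 1)"
  define dot where "dot u v = (\<Sum>k\<in>{1..n}. u k * v k)" for u v :: vec
  have formd: "form X n u v = c * dot u v" for u v by (simp add: form_eq c_def dot_def)
  have embf: "fst (to_TC X p) k = c * fst p k" "snd (to_TC X p) = snd p" for p k by (auto simp: to_TC_def c_def)
  have eA: "to_TC X (A i) = pair_root n (root_scale X n i) (node_lo X n i) (node_hi X n i)" if "i \<le> n" for i
    unfolding A_def using to_TC_simple_root[OF X that] .
  have eB: "to_TC X (B j) = pair_root n (root_scale X n j) (?H (node_hi X n j)) (?H (node_lo X n j))" if "j \<le> n" for j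
    unfolding B_def act_neg[OF y] to_TC_neg to_TC_act_simple_root[OF X that y] aH pair_root_swap[of n "root_scale X n j" "?H (node_hi X n j)"] ..
  define np where "np i = pairing n (node_lo X n i) (node_hi X n i)" for i
  have self: "pairing n a a = 1" for a using even_not_dvd(1)[of n a] by (simp add: pairing_def)
  have dd: "c * c * dot (fst p) (fst q) = (\<Sum>k\<in>{1..n}. fst (to_TC X p) k * fst (to_TC X q) k)" for p q
    by (simp add: embf(1) dot_def sum_distrib_left mult_ac)
  have AA: "c * c * dot (fst (A i)) (fst (A i)) = root_scale X n i * root_scale X n i * (2 - 2 * np i)" if "i \<le> n" for i
  proof -
    have "c * c * dot (fst (A i)) (fst (A i)) = root_scale X n i * root_scale X n i * (1 - np i - pairing n (node_hi X n i) (node_lo X n i) + 1)"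
      unfolding dd eA[OF that] dot_pair_root[OF n(2)] self np_def ..
    then show ?thesis by (simp add: np_def pairing_commute[of n "node_hi X n i" "node_lo X n i"])
  qed
  have BB: "c * c * dot (fst (B j)) (fst (B j)) = root_scale X n j * root_scale X n j * (2 - 2 * np j)" if "j \<le> n" for j
  proof -
    have "c * c * dot (fst (B j)) (fst (B j)) = root_scale X n j * root_scale X n j * (1 - pairing n (node_hi X n j) (node_lo X n j) - np j + 1)"
      unfolding dd eB[OF that] dot_pair_root[OF n(2)] pairing_invariant[OF affine_perm_inv[OF affine_perm_aperm[OF n(2) x]]] self np_def ..
    then show ?thesis by (simp add: np_def pairing_commute[of n "node_hi X n j" "node_lo X n j"])
  qed
  have AB: "c * c * dot (fst (A i)) (fst (B j)) = - (root_scale X n i * root_scale X n j * root_pairing X n ?H i j)" if "i \<le> n" "j \<le> n" for i j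
    unfolding dd eA[OF that(1)] eB[OF that(2)] dot_pair_root[OF n(2)] root_pairing_def
    by (simp only: right_diff_distrib distrib_left minus_add_distrib minus_diff_eq)
  have dsum: "dot (\<lambda>k. u k + v k) (\<lambda>k. u k + v k) = dot u u + dot v v + 2 * dot u v" for u v
    by (simp add: dot_def distrib_left distrib_right sum.distrib sum_distrib_left mult.commute)
  have np_mid: "np i = 0" if "i \<in> norm_two_nodes X n" for i
  proof -
    have *: "pairing n (int i) (int i + 1) = 0" if "0 < i" "i < n" for i
      using pairing_nat[of i n "i + 1"] that by (simp add: add.commute)
    have z: "pairing n (- 1) 1 = 0" using pairing_mirror[of n 2 1] pairing_nat[of 2 n 1] n by simp
    have l: "pairing n (int n - 1) (int n + 1) = 0"
    proof -
      have 1: "int n + 1 = (1 - int n) + 2 * int n * 1" by simp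
      show ?thesis unfolding pairing_commute[of n "int n - 1"] unfolding 1 pairing_shift pairing_mirror 
        using pairing_nat[of n n "n - 1"] n by (simp add: of_nat_diff)
    qed
    show ?thesis using that * z l n unfolding np_def
      by (cases X) (auto simp: norm_two_nodes_def node_simps)
  qed
  have nonmid: "np i = - 1 \<and> X \<noteq> TD \<and> (X = TC \<longrightarrow> i = n) \<and> (X = TB \<longrightarrow> i = 0 \<or> i = n)" if "i \<le> n" "i \<notin> norm_two_nodes X n" for i
  proof -
    have z: "pairing n 0 1 = - 1" using pairing_mirror[of n 1 1] self[of 1] by simp
    have l: "pairing n (int n) (int n + 1) = - 1"
    proof -
      have 1: "int n + 1 = (1 - int n) + 2 * int n * 1" by simp
      show ?thesis unfolding pairing_commute[of n "int n"] unfolding 1 pairing_shift pairing_mirror by (simp add: self)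
    qed
    show ?thesis using that z l n unfolding np_def
      by (cases X; cases "i = 0") (auto simp: norm_two_nodes_def node_simps)
  qed
  have rm: "root_scale X n i = c" if "i \<in> norm_two_nodes X n" for i using that by (cases X) (auto simp: norm_two_nodes_def root_scale_def c_def)
  have midle: "i \<le> n" if "i \<in> norm_two_nodes X n" for i using that by (cases X) (auto simp: norm_two_nodes_def)
  have c0: "c = 1 \<or> c = 2" by (simp add: c_def)
  have key: "((\<lambda>k. fst (A i) k + fst (B j) k, snd (A i) + snd (B j)) \<in> affine_roots X n \<and>
       form X n (fst (A i)) (fst (A i)) = form X n (fst (B j)) (fst (B j)) \<and>
       form X n (\<lambda>k. fst (A i) k + fst (B j) k) (\<lambda>k. fst (A i) k + fst (B j) k) = form X n (fst (A i)) (fst (A i)))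
     \<longleftrightarrow> i \<in> norm_two_nodes X n \<and> j \<in> norm_two_nodes X n \<and> root_pairing X n ?H i j = 1" (is "?L \<longleftrightarrow> ?R") if ij: "i \<le> n" "j \<le> n" for i j
  proof
    assume ?R
    then have m: "i \<in> norm_two_nodes X n" "j \<in> norm_two_nodes X n" "root_pairing X n ?H i j = 1" by auto
    have cc: "c * c \<noteq> 0" using c0 by auto
    have "c * c * dot (fst (A i)) (fst (A i)) = c * c * 2" using AA[OF ij(1)] np_mid[OF m(1)] rm[OF m(1)] by simp
    then have dA: "dot (fst (A i)) (fst (A i)) = 2" using cc by simp
    have "c * c * dot (fst (B j)) (fst (B j)) = c * c * 2" using BB[OF ij(2)] np_mid[OF m(2)] rm[OF m(2)] by simp
    then have dB: "dot (fst (B j)) (fst (B j)) = 2" using cc by simp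
    have "c * c * dot (fst (A i)) (fst (B j)) = c * c * (- 1)" using AB[OF ij] m(3) rm[OF m(1)] rm[OF m(2)] by simp
    then have dAB: "dot (fst (A i)) (fst (B j)) = - 1" using cc by (simp only: mult_cancel_left) simp
    let ?z = "\<lambda>k. fst (A i) k + fst (B j) k"
    have dz: "dot ?z ?z = 2" unfolding dsum using dA dB dAB by simp
    have "?z \<in> roots X n"
    proof (rule norm_two_root)
      show "(\<Sum>k\<in>{1..n}. ?z k * ?z k) = 2" using dz by (simp add: dot_def)
      fix k assume k: "k \<notin> {1..n}"
      have pz: "fst (position_vec n a) k = 0" for a
        by (rule position_cases[OF n(2), of a]) (use k in \<open>auto simp: position_vec_low position_vec_high eps_def\<close>)
      have "c * fst (A i) k = 0" "c * fst (B j) k = 0"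
        unfolding embf(1)[symmetric] eA[OF ij(1)] eB[OF ij(2)] by (simp_all add: pair_root_def pz)
      then show "?z k = 0" using c0 by auto
    qed
    moreover have "nu X n ?z = c" using dz c0 by (auto simp: nu_def formd)
    moreover have "c dvd snd (A i)"
      unfolding embf(2)[of "A i", symmetric] eA[OF ij(1)] rm[OF m(1)] pair_root_def by simp
    moreover have "c dvd snd (B j)"
      unfolding embf(2)[of "B j", symmetric] eB[OF ij(2)] rm[OF m(2)] pair_root_def by simp
    ultimately have z: "?z \<in> roots X n" "nu X n ?z = c" "c dvd snd (A i) + snd (B j)" by auto
    then obtain t where "snd (A i) + snd (B j) = c * t" by (auto elim: dvdE)
    then have "(?z, snd (A i) + snd (B j)) \<in> affine_roots X n" using z unfolding affine_roots_def by auto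
    then show ?L using dz dA dB by (simp add: formd)
  next
    assume ?L
    then have e: "dot (fst (A i)) (fst (A i)) = dot (fst (B j)) (fst (B j))" 
       "2 * dot (fst (A i)) (fst (B j)) = - dot (fst (A i)) (fst (A i))" 
      using c0 unfolding formd dsum by auto
    have e1: "root_scale X n i * root_scale X n i * (2 - 2 * np i) = root_scale X n j * root_scale X n j * (2 - 2 * np j)"
      using AA[OF ij(1)] BB[OF ij(2)] e(1) by simp
    have e2: "2 * (root_scale X n i * root_scale X n j * root_pairing X n ?H i j) = root_scale X n i * root_scale X n i * (2 - 2 * np i)"
    proof -
      have "2 * (c * c * dot (fst (A i)) (fst (B j))) = - (c * c * dot (fst (A i)) (fst (A i)))"
        using e(2) by (simp add: algebra_simps)
      then show ?thesis using AA[OF ij(1)] AB[OF ij] by simp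
    qed
    have rn: "root_scale X n i = 1" if "i \<notin> norm_two_nodes X n" "i \<le> n" for i using nonmid[OF that(2,1)] that by (cases X) (auto simp: root_scale_def norm_two_nodes_def)
    show ?R
    proof (cases "i \<in> norm_two_nodes X n")
      case True
      have jm: "j \<in> norm_two_nodes X n"
      proof (rule ccontr)
        assume j: "j \<notin> norm_two_nodes X n"
        then have "c * c * 2 = 4" using e1 rm[OF True] np_mid[OF True] nonmid[OF ij(2) j] rn[OF j ij(2)] by simp
        then show False using c0 by auto
      qed
      have "2 * (c * c * root_pairing X n ?H i j) = c * c * 2" using e2 rm[OF True] rm[OF jm] np_mid[OF True] by simp
      then show ?thesis using True jm c0 by auto
    next
      case False
      have jm: "j \<notin> norm_two_nodes X n"
      proof
        assume j: "j \<in> norm_two_nodes X n"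
        then have "c * c * 2 = 4" using e1 rm[OF j] np_mid[OF j] nonmid[OF ij(1) False] rn[OF False ij(1)] by simp
        then show False using c0 by auto
      qed
      have rp: "root_pairing X n ?H i j = 2" using e2 rn[OF False ij(1)] rn[OF jm ij(2)] nonmid[OF ij(1) False] by simp
      have op: "pairing n (node_hi X n i) b = - pairing n (node_lo X n i) b" if "i \<le> n" "i \<notin> norm_two_nodes X n" for i b
      proof -
        have 1: "int n + 1 = (1 - int n) + 2 * int n * 1" by simp
        have "pairing n (int n + 1) b = - pairing n (int n) b" unfolding 1 pairing_shift pairing_mirror ..
        moreover have "pairing n 1 b = - pairing n 0 b" using pairing_mirror[of n 0 b] by simp
        ultimately show ?thesis using nonmid[OF that] n by (cases X) (auto simp: node_simps)
      qed
      have Hh: "\<exists>q. ?H (node_hi X n j) = 1 - ?H (node_lo X n j) + 2 * int n * q"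
      proof -
        note H = affine_perm_inv[OF affine_perm_aperm[OF n(2) x]]
        have "?H (int n + 1) = 1 - ?H (int n) + 2 * int n * 1" using affine_perm_reflect[OF H, of 1 "int n"] by simp
        moreover have "?H 1 = 1 - ?H 0 + 2 * int n * 0" using affine_perm_mirror[OF H, of 0] by simp
        ultimately show ?thesis using nonmid[OF ij(2) jm] n by (cases X) (auto simp: node_simps)
      qed
      then obtain q where q: "?H (node_hi X n j) = 1 - ?H (node_lo X n j) + 2 * int n * q" by blast
      have "pairing n a (?H (node_hi X n j)) = - pairing n a (?H (node_lo X n j))" for a
        unfolding q pairing_commute[of n a] pairing_shift pairing_mirror ..
      then have "root_pairing X n ?H i j = 4 * pairing n (node_lo X n i) (?H (node_lo X n j))"
        by (simp add: root_pairing_def op[OF ij(1) False])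
      then have False using rp by presburger
      then show ?thesis ..
    qed
  qed
  have Ainj: "i = i'" if "A i = A i'" "i \<le> n" "i' \<le> n" for i i'
    using simple_root_inj[OF n(1) that(2,3)] that(1) by (simp add: A_def)
  show ?thesis
  proof
    assume "minimal_NGT X n x"
    then obtain \<alpha> a \<beta> b where xa: "x \<in> affine_weyl X n" and 
      r: "\<And>is. reduced_word X n x is \<Longrightarrow> is \<noteq> [] \<and> hd (root_seq X n is) = (\<alpha>, a) \<and> last (root_seq X n is) = (\<beta>, b)"
      and e: "(\<lambda>k. \<alpha> k + \<beta> k, a + b) \<in> affine_roots X n" "form X n \<alpha> \<alpha> = form X n \<beta> \<beta>"
        "form X n (\<lambda>k. \<alpha> k + \<beta> k) (\<lambda>k. \<alpha> k + \<beta> k) = form X n \<alpha> \<alpha>"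
      unfolding minimal_NGT_def by blast
    obtain w where w: "reduced_word X n x w" 
      using xa reduced_word_exists unfolding affine_weyl_iff[OF X] by blast
    have right: "(\<alpha>, a) = A (hd v) \<and> hd v \<in> descents X n ?G" if "reduced_word X n x v" for v
      using r[OF that] hd_root_seq[of v X n] that reduced_hd_desc[OF X, of x "hd v" "tl v"] by (auto simp: A_def)
    have left: "(\<beta>, b) = B (last v) \<and> last v \<in> descents X n ?H" if "reduced_word X n x v" for v
    proof -
      have v: "v \<noteq> []" "set v \<subseteq> {0..n}" "word_elt X n v = x" using r[OF that] that by (auto simp: reduced_word_def)
      have "reduced_word X n ?y (last v # rev (butlast v))"
        using reduced_word_rev[OF X x that] v(1) by (simp add: rev_last)
      then have "last v \<in> descents X n ?H" using reduced_hd_desc[OF X] aH by metis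
      then show ?thesis using r[OF that] last_root_seq[OF X v(2,1)] v(3) by (simp add: B_def)
    qed
    let ?i = "hd w" and ?j = "last w"
    have ij: "?i \<le> n" "?j \<le> n" using right[OF w] left[OF w] by (auto simp: descents_def)
    have "i = ?i" if di: "i \<in> descents X n ?G" for i
    proof -
      obtain js where "reduced_word X n x (i # js)" using reduced_word_starting[OF X w di] by blast
      from right[OF this] have "(\<alpha>, a) = A i" by simp
      then have "A i = A ?i" using right[OF w] by simp
      then show ?thesis using Ainj[of i ?i] di ij by (simp add: descents_def)
    qed
    then have dG: "descents X n ?G = {?i}" using right[OF w] by blast
    have "j = ?j" if dj: "j \<in> descents X n ?H" for j
    proof -
      have rw: "reduced_word X n ?y (rev w)" using reduced_word_rev[OF X x w] .
      have "j \<in> descents X n (aperm n ?y)" using dj aH by simp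
      then obtain js where "reduced_word X n ?y (j # js)" using reduced_word_starting[OF X rw] by blast
      then have "reduced_word X n x (rev js @ [j])" 
        using reduced_word_rev[OF X y, of "j # js"] group.inv_inv[OF group_W x] by simp
      from left[OF this] have "(\<beta>, b) = B j" by simp
      then have "B j = B ?j" using left[OF w] by simp
      then have "neg_avec (A j) = neg_avec (A ?j)" unfolding B_def A_def by (rule act_inj[OF y])
      then have "A j = A ?j" by (simp only: neg_avec_inj)
      then show ?thesis using Ainj[of j ?j] dj ij by (simp add: descents_def)
    qed
    then have dH: "descents X n ?H = {?j}" using left[OF w] by blast
    have fs: "\<alpha> = fst (A ?i)" "a = snd (A ?i)" "\<beta> = fst (B ?j)" "b = snd (B ?j)"
      using right[OF w] left[OF w] by (metis fst_conv snd_conv)+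
    have "?i \<in> norm_two_nodes X n \<and> ?j \<in> norm_two_nodes X n \<and> root_pairing X n ?H ?i ?j = 1"
      using key[OF ij] e unfolding fs by blast
    then have "ngt X n ?G ?i ?j" using dG dH by (simp add: ngt_def)
    then show "x \<in> affine_weyl X n \<and> (\<exists>i j. ngt X n ?G i j)" using xa by blast
  next
    assume "x \<in> affine_weyl X n \<and> (\<exists>i j. ngt X n ?G i j)"
    then obtain i j where xa: "x \<in> affine_weyl X n" and ng: "ngt X n ?G i j" by blast
    then have d: "descents X n ?G = {i}" "descents X n ?H = {j}" by (auto simp: ngt_def)
    then have ij: "i \<le> n" "j \<le> n" by (auto simp: descents_def)
    have words: "v \<noteq> [] \<and> hd (root_seq X n v) = A i \<and> last (root_seq X n v) = B j" if v: "reduced_word X n x v" for v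
    proof -
      have ne: "v \<noteq> []"
      proof
        assume "v = []"
        then have "x = \<one>\<^bsub>W_aff n\<^esub>" using v by (simp add: reduced_word_def)
        then have "?G = id" using aperm_one[OF n(2)] by simp
        moreover have "i \<in> descents X n ?G" using d(1) by simp
        ultimately show False using lo_hi_less[of X n i] by (simp add: descents_def)
      qed
      have "hd v \<in> descents X n ?G" using reduced_hd_desc[OF X, of x "hd v" "tl v"] v ne by simp
      then have "hd v = i" unfolding d(1) by simp
      moreover have "reduced_word X n ?y (last v # rev (butlast v))"
        using reduced_word_rev[OF X x v] ne by (simp add: rev_last)
      from reduced_hd_desc[OF X this] have "last v = j" unfolding aH d(2) by simp
      ultimately show ?thesis using ne hd_root_seq[OF ne] last_root_seq[OF X _ ne] v by (simp add: A_def B_def reduced_word_def)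
    qed
    have k: "(\<lambda>k. fst (A i) k + fst (B j) k, snd (A i) + snd (B j)) \<in> affine_roots X n"
       "form X n (fst (A i)) (fst (A i)) = form X n (fst (B j)) (fst (B j))"
       "form X n (\<lambda>k. fst (A i) k + fst (B j) k) (\<lambda>k. fst (A i) k + fst (B j) k) = form X n (fst (A i)) (fst (A i))"
      using key[OF ij] ng by (auto simp: ngt_def)
    have rw: "\<forall>is. reduced_word X n x is \<longrightarrow> is \<noteq> [] \<and> 
        hd (root_seq X n is) = (fst (A i), snd (A i)) \<and> last (root_seq X n is) = (fst (B j), snd (B j))"
    proof (intro allI impI)
      fix v assume v: "reduced_word X n x v"
      show "v \<noteq> [] \<and> hd (root_seq X n v) = (fst (A i), snd (A i)) \<and> last (root_seq X n v) = (fst (B j), snd (B j))"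
        unfolding prod.collapse by (rule words[OF v])
    qed
    show "minimal_NGT X n x" unfolding minimal_NGT_def
      by (rule conjI[OF xa], rule exI[of _ "fst (A i)"], rule exI[of _ "snd (A i)"], rule exI[of _ "fst (B j)"],
          rule exI[of _ "snd (B j)"], rule conjI[OF rw conjI[OF k(1) conjI[OF k(2,3)]]])
  qed
qed

section \<open>The affine Weyl groups inside the group of type B\<close>

text \<open>
  Without descents the permutation is increasing; the mirrors bound its values on the window from both
  sides.
\<close>

lemma no_descents_id:
  assumes n: "1 \<le> n" and G: "affine_perm n G" and d: "descents TB n G = {}" shows "G = id"
proof (rule affine_perm_eqI[OF G affine_perm_id n])
  have k: "G (int k) < G (int k + 1)" if "k \<le> n" for k
  proof -
    have "k \<notin> descents TB n G" using d by blast
    then show ?thesis using that affine_perm_inj[OF G, of "int k" "int k + 1"] by (simp add: descents_def node_simps)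
  qed
  have asc: "G x + (y - x) \<le> G y" if "1 \<le> x" "x \<le> y" "y \<le> int n" for x y
  proof (rule ascending_run[where a = 1 and b = "int n"])
    show "G m < G (m + 1)" if "1 \<le> m" "m < int n" for m using k[of "nat m"] that by simp
  qed (use that in auto)
  have "G 0 < G 1" using k[of 0] by simp
  then have 1: "1 \<le> G 1" using affine_perm_mirror[OF G, of 0] by simp
  have 2: "G (int n) \<le> int n" using k[of n] affine_perm_reflect[OF G, of 1 "int n"] by simp
  fix m assume m: "1 \<le> m" "m \<le> int n"
  show "G m = id m" using asc[of 1 m] asc[of m "int n"] m 1 2 by simp
qed

text \<open>
  Removing a descent of type \<open>B\<close> moves larger values to larger positions, closer to the identity.
\<close>

definition displacement :: "nat \<Rightarrow> (int \<Rightarrow> int) \<Rightarrow> int" where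
  "displacement n G = (\<Sum>k\<in>{1..n}. (G (int k) - int k)\<^sup>2)"

lemma displacement_decreases:
  assumes n: "3 \<le> n" and G: "affine_perm n G" and i: "i \<in> descents TB n G"
  shows "displacement n (G \<circ> simple_perm TB n i) < displacement n G"
proof -
  have i: "i \<le> n" "G (int i) > G (int i + 1)" using i by (auto simp: descents_def node_simps)
  have S: "simple_perm TB n i = affine_refl n (int i) (int i + 1)" by (simp add: simple_perm_def node_simps)
  have w: "simple_perm TB n i (int l) = (if l = i then int l + 1 else if l = i + 1 then int l - 1 else int l)" if "l \<in> {1..n}" for l
    unfolding S using affine_refl_window[of "int l" n "int i"] that i(1) by auto
  consider "i = 0" | "0 < i" "i < n" | "i = n" using i by linarith
  then show ?thesis
  proof cases
    case 1
    have one: "1 \<in> {1..n}" using n by simp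
    have r: "(\<Sum>k\<in>{1..n} - {1}. (G (simple_perm TB n i (int k)) - int k)\<^sup>2) = (\<Sum>k\<in>{1..n} - {1}. (G (int k) - int k)\<^sup>2)"
      using w 1 by (intro sum.cong) auto
    have "G 0 = 1 - G 1" using affine_perm_mirror[OF G, of 1] by simp
    moreover have "G 1 \<le> 0" using i 1 calculation by simp
    moreover have "(- G 1)\<^sup>2 < (G 1 - 1)\<^sup>2" using calculation(2) by (simp add: power2_eq_square algebra_simps)
    ultimately have "(G 0 - 1)\<^sup>2 < (G 1 - 1)\<^sup>2" by simp
    then show ?thesis unfolding displacement_def comp_apply sum.remove[OF _ one, simplified] 
      using r w[OF one] 1 sum.remove[OF _ one, of "\<lambda>k. (G (simple_perm TB n i (int k)) - int k)\<^sup>2"]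
        sum.remove[OF _ one, of "\<lambda>k. (G (int k) - int k)\<^sup>2"] by simp
  next
    case 2
    have m: "i \<in> {1..n}" "i + 1 \<in> {1..n} - {i}" using 2 by auto
    have r: "(\<Sum>k\<in>{1..n} - {i} - {i + 1}. (G (simple_perm TB n i (int k)) - int k)\<^sup>2) = (\<Sum>k\<in>{1..n} - {i} - {i + 1}. (G (int k) - int k)\<^sup>2)"
      using w by (intro sum.cong) auto
    have "(G (int i + 1) - int i)\<^sup>2 + (G (int i) - (int i + 1))\<^sup>2 < (G (int i) - int i)\<^sup>2 + (G (int i + 1) - (int i + 1))\<^sup>2"
      using i(2) by (simp add: power2_eq_square algebra_simps)
    moreover have "simple_perm TB n i (int i) = int i + 1" "simple_perm TB n i (int (i + 1)) = int i"
      using w[OF m(1)] w[of "i + 1"] m(2) by auto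
    ultimately show ?thesis unfolding displacement_def comp_apply
      using r sum.remove[OF _ m(1), of "\<lambda>k. (G (simple_perm TB n i (int k)) - int k)\<^sup>2"]
        sum.remove[OF _ m(1), of "\<lambda>k. (G (int k) - int k)\<^sup>2"]
        sum.remove[OF _ m(2), of "\<lambda>k. (G (simple_perm TB n i (int k)) - int k)\<^sup>2"]
        sum.remove[OF _ m(2), of "\<lambda>k. (G (int k) - int k)\<^sup>2"] by (simp add: add.commute)
  next
    case 3
    have m: "n \<in> {1..n}" using n by simp
    have r: "(\<Sum>k\<in>{1..n} - {n}. (G (simple_perm TB n i (int k)) - int k)\<^sup>2) = (\<Sum>k\<in>{1..n} - {n}. (G (int k) - int k)\<^sup>2)"
      using w 3 by (intro sum.cong) auto
    have e: "G (int n + 1) = 2 * int n + 1 - G (int n)" using affine_perm_reflect[OF G, of 1 "int n"] by simp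
    define d where "d = G (int n) - int n"
    have "1 \<le> d" using i(2) 3 e d_def by simp
    then have "(1 - d)\<^sup>2 < d\<^sup>2" by (simp add: power2_eq_square algebra_simps)
    moreover have e2: "G (int n + 1) - int n = 1 - d" using e d_def by simp
    ultimately have "(G (int n + 1) - int n)\<^sup>2 < (G (int n) - int n)\<^sup>2" unfolding e2 d_def[symmetric] by simp
    then show ?thesis unfolding displacement_def comp_apply
      using r w[OF m] 3 sum.remove[OF _ m, of "\<lambda>k. (G (simple_perm TB n i (int k)) - int k)\<^sup>2"]
        sum.remove[OF _ m, of "\<lambda>k. (G (int k) - int k)\<^sup>2"] by simp
  qed
qed

lemma rank_ok_TB: "3 \<le> n \<Longrightarrow> rank_ok TB n" and rank_ok_TC: "3 \<le> n \<Longrightarrow> rank_ok TC n" and rank_ok_TD: "4 \<le> n \<Longrightarrow> rank_ok TD n"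
  by (simp_all add: rank_ok_def)

text \<open>
  Removing descents of type \<open>B\<close> one by one ends at the identity.
\<close>

lemma W_generated:
  assumes n: "3 \<le> n"
  shows "x \<in> carrier (W_aff n) \<Longrightarrow> \<exists>is. set is \<subseteq> {0..n} \<and> word_elt TB n is = x"
proof (induction "nat (displacement n (aperm n x))" arbitrary: x rule: less_induct)
  case less
  have n1: "1 \<le> n" using n by simp
  note G = affine_perm_aperm[OF n1 less.prems]
  show ?case
  proof (cases "descents TB n (aperm n x) = {}")
    case True
    then have "aperm n x = aperm n \<one>\<^bsub>W_aff n\<^esub>" using no_descents_id[OF n1 G] aperm_one[OF n1] by simp
    then have "x = \<one>\<^bsub>W_aff n\<^esub>" using aperm_inj[OF n1 less.prems one_closed_W] by blast
    then show ?thesis by (intro exI[of _ "[]"]) simp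
  next
    case False
    then obtain i where i: "i \<in> descents TB n (aperm n x)" by blast
    then have il: "i \<le> n" by (simp add: descents_def)
    note c = srefl_carrier[OF rank_ok_TB[OF n] il]
    let ?y = "x \<otimes>\<^bsub>W_aff n\<^esub> srefl TB n i"
    have y: "?y \<in> carrier (W_aff n)" using mult_closed_W[OF less.prems c] .
    have "displacement n (aperm n ?y) < displacement n (aperm n x)"
      unfolding aperm_mult[OF n1 less.prems c] aperm_srefl[OF rank_ok_TB[OF n] il]
      by (rule displacement_decreases[OF n G i])
    moreover have "0 \<le> displacement n (aperm n ?y)" unfolding displacement_def by (intro sum_nonneg) simp
    ultimately have "nat (displacement n (aperm n ?y)) < nat (displacement n (aperm n x))" by simp
    then obtain "is" where "set is \<subseteq> {0..n}" "word_elt TB n is = ?y" using less.hyps[OF _ y] by blast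
    then show ?thesis using il mult_srefl_cancel[OF rank_ok_TB[OF n] il less.prems]
      by (intro exI[of _ "i # is"]) simp
  qed
qed

lemma affine_weyl_carrier:
  assumes "rank_ok X n" "x \<in> affine_weyl X n" shows "x \<in> carrier (W_aff n)"
proof -
  obtain "is" where "set is \<subseteq> {0..n}" "word_elt X n is = x" using assms affine_weyl_iff[OF assms(1)] by blast
  then show ?thesis using word_elt_carrier[OF assms(1)] by auto
qed

lemma affine_weyl_TB: "3 \<le> n \<Longrightarrow> affine_weyl TB n = carrier (W_aff n)"
  using affine_weyl_iff[OF rank_ok_TB] W_generated affine_weyl_carrier[OF rank_ok_TB] by blast

text \<open>
  Modulo two, this is the homomorphism that counts the letters \<open>0\<close>.
\<close>

definition translation_sum :: "nat \<Rightarrow> aelt \<Rightarrow> int" where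
  "translation_sum n x = (\<Sum>k\<in>{1..n}. fst x k)"

text \<open>
  A homomorphism: it is \<open>-1\<close> to the number of letters \<open>0\<close> and \<open>n\<close>, since each of them changes one sign
  and the other letters change none.
\<close>

definition sign_product :: "nat \<Rightarrow> aelt \<Rightarrow> int" where
  "sign_product n x = (\<Prod>k\<in>{1..n}. snd x (\<lambda>_. 1) k)"

lemma translation_sum_mult:
  assumes "x \<in> carrier (W_aff n)"
  shows "even (translation_sum n (x \<otimes>\<^bsub>W_aff n\<^esub> y)) \<longleftrightarrow> (even (translation_sum n x) \<longleftrightarrow> even (translation_sum n y))"
proof -
  have wx: "snd x \<in> signed_perms n" using assms by (simp add: carrier_W)
  obtain s \<sigma> where w: "snd x = (\<lambda>z k. s k * z (\<sigma> k))" "\<sigma> permutes {1..n}" "\<And>k. s k \<in> {1, -1}"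
    "\<And>k. k \<notin> {1..n} \<Longrightarrow> s k = 1" using signed_permsE[OF wx] by blast
  have "even (snd x (fst y) k - fst y (\<sigma> k))" for k using w(3)[of k] by (auto simp: w(1))
  then have "even (\<Sum>k\<in>{1..n}. snd x (fst y) k - fst y (\<sigma> k))" by (intro dvd_sum)
  moreover have "(\<Sum>k\<in>{1..n}. fst y (\<sigma> k)) = translation_sum n y"
    unfolding translation_sum_def using sum.permute[OF w(2), of "fst y"] by (simp add: comp_def)
  ultimately have "even (\<Sum>k\<in>{1..n}. snd x (fst y) k) \<longleftrightarrow> even (translation_sum n y)" 
    by (simp add: sum_subtractf)
  moreover have "translation_sum n (x \<otimes>\<^bsub>W_aff n\<^esub> y) = translation_sum n x + (\<Sum>k\<in>{1..n}. snd x (fst y) k)"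
    by (simp add: translation_sum_def mult_W sum.distrib)
  ultimately show ?thesis by auto
qed

lemma sign_product_mult:
  assumes "x \<in> carrier (W_aff n)"
  shows "sign_product n (x \<otimes>\<^bsub>W_aff n\<^esub> y) = sign_product n x * sign_product n y"
proof -
  have wx: "snd x \<in> signed_perms n" using assms by (simp add: carrier_W)
  obtain s \<sigma> where w: "snd x = (\<lambda>z k. s k * z (\<sigma> k))" "\<sigma> permutes {1..n}" "\<And>k. s k \<in> {1, -1}"
    "\<And>k. k \<notin> {1..n} \<Longrightarrow> s k = 1" using signed_permsE[OF wx] by blast
  have "sign_product n (x \<otimes>\<^bsub>W_aff n\<^esub> y) = (\<Prod>k\<in>{1..n}. s k * snd y (\<lambda>_. 1) (\<sigma> k))"
    by (simp add: sign_product_def mult_W w(1))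
  also have "\<dots> = (\<Prod>k\<in>{1..n}. s k) * (\<Prod>k\<in>{1..n}. snd y (\<lambda>_. 1) (\<sigma> k))" by (rule prod.distrib)
  also have "(\<Prod>k\<in>{1..n}. snd y (\<lambda>_. 1) (\<sigma> k)) = sign_product n y"
    unfolding sign_product_def using prod.permute[OF w(2), of "snd y (\<lambda>_. 1)"] by (simp add: comp_def)
  finally show ?thesis by (simp add: sign_product_def w(1))
qed

lemma translation_sum_sB: "1 \<le> n \<Longrightarrow> i \<le> n \<Longrightarrow> even (translation_sum n (sB n i)) \<longleftrightarrow> i \<noteq> 0"
proof -
  assume n: "1 \<le> n" "i \<le> n"
  consider "i = 0" | "0 < i" "i < n" | "i = n" "0 < i" using n by linarith
  then show ?thesis
  proof cases
    case 1
    have "(\<Sum>k\<in>{1..n}. 1 * eps 1 k) = 1" using sum_eps(1)[of 1 n "\<lambda>_. 1"] n by simp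
    then show ?thesis using 1 n by (simp add: translation_sum_def sB_zero)
  qed (use n in \<open>simp_all add: translation_sum_def sB_mid sB_last\<close>)
qed

lemma sign_product_sB: "1 \<le> n \<Longrightarrow> i \<le> n \<Longrightarrow> sign_product n (sB n i) = (if i = 0 \<or> i = n then - 1 else 1)"
proof -
  assume n: "1 \<le> n" "i \<le> n"
  have *: "(\<Prod>k\<in>{1..n}. if k = l then - 1 else 1) = (- 1 :: int)" if "l \<in> {1..n}" for l
    using prod.delta[of "{1..n}" l "\<lambda>_. - 1 :: int"] that by simp
  consider "i = 0" | "0 < i" "i < n" | "i = n" "0 < i" using n by linarith
  then show ?thesis
  proof cases
    case 1 then show ?thesis using *[of 1] n by (simp add: sign_product_def sB_zero del: One_nat_def)
  next
    case 2 then show ?thesis by (simp add: sign_product_def sB_mid)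
  next
    case 3 then show ?thesis using *[of n] n by (simp add: sign_product_def sB_last)
  qed
qed

lemma word_parity:
  assumes n: "3 \<le> n" and "set is \<subseteq> {0..n}"
  shows "even (count_list is 0) \<longleftrightarrow> even (translation_sum n (word_elt TB n is))"
    "even (count_list is n) \<longleftrightarrow> (even (translation_sum n (word_elt TB n is)) \<longleftrightarrow> sign_product n (word_elt TB n is) = 1)"
    "sign_product n (word_elt TB n is) \<in> {1, - 1}"
  using assms(2)
proof (induction "is")
  case Nil
  {
    case 1 show ?case by (simp add: one_W translation_sum_def)
  next
    case 2 show ?case by (simp add: one_W translation_sum_def sign_product_def)
  next
    case 3 show ?case by (simp add: one_W sign_product_def)
  }
next
  case (Cons i "is")
  have n1: "1 \<le> n" using n by simp
  have sr: "srefl TB n i = sB n i" by (simp add: srefl_def)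
  {
    case 1
    then have c: "word_elt TB n is \<in> carrier (W_aff n)" using word_elt_carrier[OF rank_ok_TB[OF n]] by auto
    show ?case using 1 Cons.IH(1) translation_sum_mult[OF c] translation_sum_sB[OF n1] by (auto simp: sr)
  next
    case 2
    then have c: "word_elt TB n is \<in> carrier (W_aff n)" using word_elt_carrier[OF rank_ok_TB[OF n]] by auto
    show ?case using 2 n Cons.IH(2,3) translation_sum_mult[OF c] translation_sum_sB[OF n1] sign_product_mult[OF c] sign_product_sB[OF n1]
      by (auto simp: sr)
  next
    case 3
    then have c: "word_elt TB n is \<in> carrier (W_aff n)" using word_elt_carrier[OF rank_ok_TB[OF n]] by auto
    show ?case using 3 Cons.IH(3) sign_product_mult[OF c] sign_product_sB[OF n1] by (auto simp: sr)
  }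
qed

lemma refls_parity:
  assumes n: "3 \<le> n" and x: "x \<in> carrier (W_aff n)"
  shows "even (top_refls n x) \<longleftrightarrow> even (translation_sum n x)"
    "even (bottom_refls n x) \<longleftrightarrow> (even (translation_sum n x) \<longleftrightarrow> sign_product n x = 1)"
    "sign_product n x \<in> {1, - 1}"
proof -
  obtain js where "reduced_word TB n x js" using W_generated[OF n x] reduced_word_exists by blast
  then have "reduced_word TB n x (SOME is. reduced_word TB n x is)" by (rule someI)
  then have w: "set (SOME is. reduced_word TB n x is) \<subseteq> {0..n}" "word_elt TB n (SOME is. reduced_word TB n x is) = x"
    by (auto simp: reduced_word_def)
  show "even (top_refls n x) \<longleftrightarrow> even (translation_sum n x)"
    "even (bottom_refls n x) \<longleftrightarrow> (even (translation_sum n x) \<longleftrightarrow> sign_product n x = 1)"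
    "sign_product n x \<in> {1, - 1}"
    unfolding top_refls_def bottom_refls_def using word_parity[OF n w(1)] unfolding w(2) by auto
qed

lemma refls_mult:
  assumes n: "3 \<le> n" and x: "x \<in> carrier (W_aff n)" and y: "y \<in> carrier (W_aff n)"
  shows "even (top_refls n (x \<otimes>\<^bsub>W_aff n\<^esub> y)) \<longleftrightarrow> (even (top_refls n x) \<longleftrightarrow> even (top_refls n y))"
    "even (bottom_refls n (x \<otimes>\<^bsub>W_aff n\<^esub> y)) \<longleftrightarrow> (even (bottom_refls n x) \<longleftrightarrow> even (bottom_refls n y))"
  using refls_parity[OF n x] refls_parity[OF n y] refls_parity[OF n mult_closed_W[OF x y]]
    translation_sum_mult[OF x, of y] sign_product_mult[OF x, of y] by auto

lemma refls_sB:
  assumes n: "3 \<le> n" "i \<le> n"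
  shows "even (top_refls n (sB n i)) \<longleftrightarrow> i \<noteq> 0" "even (bottom_refls n (sB n i)) \<longleftrightarrow> i \<noteq> n"
  using refls_parity[OF n(1) sB_carrier[OF _ n(2)]] translation_sum_sB[OF _ n(2)] sign_product_sB[OF _ n(2)] n by auto

lemma refls_one:
  assumes n: "3 \<le> n"
  shows "even (top_refls n \<one>\<^bsub>W_aff n\<^esub>)" "even (bottom_refls n \<one>\<^bsub>W_aff n\<^esub>)"
  using refls_parity[OF n one_closed_W] by (auto simp: translation_sum_def sign_product_def one_W)

lemma refls_srefl:
  assumes X: "rank_ok X n" "i \<le> n"
  shows "X \<noteq> TB \<Longrightarrow> even (top_refls n (srefl X n i))" "X = TD \<Longrightarrow> even (bottom_refls n (srefl X n i))"
proof -
  have n: "3 \<le> n" "1 \<le> n" using rank_ok_ge3[OF X(1)] by auto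
  note c = sB_carrier[OF n(2)]
  show "X \<noteq> TB \<Longrightarrow> even (top_refls n (srefl X n i))" "X = TD \<Longrightarrow> even (bottom_refls n (srefl X n i))"
    using n X(2) by (auto simp: srefl_def refls_mult[OF n(1)] refls_sB[OF n(1)] c mult_closed_W)
qed

lemma affine_weyl_even:
  assumes X: "rank_ok X n" and x: "x \<in> affine_weyl X n"
  shows "X \<noteq> TB \<Longrightarrow> even (top_refls n x)" "X = TD \<Longrightarrow> even (bottom_refls n x)"
proof -
  have n: "3 \<le> n" using rank_ok_ge3[OF X] .
  obtain "is" where "set is \<subseteq> {0..n}" "word_elt X n is = x" using x affine_weyl_iff[OF X] by blast
  then have "(X \<noteq> TB \<longrightarrow> even (top_refls n x)) \<and> (X = TD \<longrightarrow> even (bottom_refls n x))"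
  proof (induction "is" arbitrary: x)
    case Nil then show ?case using refls_one[OF n] by auto
  next
    case (Cons i "is")
    then have i: "i \<le> n" "set is \<subseteq> {0..n}" by auto
    show ?case using Cons.IH[OF i(2) refl] Cons.prems(2) refls_srefl[OF X i(1)] 
        refls_mult[OF n word_elt_carrier[OF X i(2)] srefl_carrier[OF X i(1)]] by auto
  qed
  then show "X \<noteq> TB \<Longrightarrow> even (top_refls n x)" "X = TD \<Longrightarrow> even (bottom_refls n x)" by auto
qed

lemma sB_square: assumes "3 \<le> n" "i \<le> n" shows "sB n i \<otimes>\<^bsub>W_aff n\<^esub> sB n i = \<one>\<^bsub>W_aff n\<^esub>"
  using srefl_square[OF rank_ok_TB[OF assms(1)] assms(2)] by (simp add: srefl_def)

text \<open>
  Conjugation by \<open>s\<^sub>c\<close> is the diagram automorphism that interchanges the two nodes of a fork.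
\<close>

lemma conj_srefl:
  assumes X: "rank_ok X n" "end_node X n c" and i: "i \<le> n"
  shows "sB n c \<otimes>\<^bsub>W_aff n\<^esub> srefl X n i \<otimes>\<^bsub>W_aff n\<^esub> sB n c = srefl X n (fork_swap n c i)"
proof -
  have n: "3 \<le> n" "1 \<le> n" using rank_ok_ge3[OF X(1)] by auto
  have c: "c \<le> n" using X(2) by (auto simp: end_node_def)
  have f: "fork_swap n c i \<le> n" using fork_swap_le[OF X(2) n(1) i] .
  note cc = sB_carrier[OF n(2) c] and ci = srefl_carrier[OF X(1) i] and cf = srefl_carrier[OF X(1) f]
  show ?thesis
  proof (rule aperm_inj[OF n(2) mult_closed_W[OF mult_closed_W[OF cc ci] cc] cf])
    have "end_swap n c (simple_perm X n i (end_swap n c m)) = simple_perm X n (fork_swap n c i) m" for m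
    proof -
      have "end_swap n c (simple_perm X n i (end_swap n c m)) = affine_refl n (end_swap n c (node_lo X n i)) (end_swap n c (node_hi X n i)) m"
        unfolding simple_perm_def
        using refl_conj[OF affine_perm_end_swap[OF n(1)], of c "node_lo X n i" "node_hi X n i" "end_swap n c m"] end_swap_invol[OF n(1)] by simp
      also have "\<dots> = simple_perm X n (fork_swap n c i) m"
        using end_swap_pair[OF X f] refl_mirror[OF lo_hi_not_dvd[OF X(1)]] 
        unfolding fork_swap_invol[OF n(1)] simple_perm_def by auto
      finally show ?thesis .
    qed
    then show "aperm n (sB n c \<otimes>\<^bsub>W_aff n\<^esub> srefl X n i \<otimes>\<^bsub>W_aff n\<^esub> sB n c) = aperm n (srefl X n (fork_swap n c i))"
      unfolding aperm_mult[OF n(2) mult_closed_W[OF cc ci] cc] aperm_mult[OF n(2) cc ci] aperm_sB[OF n(1) c]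
        aperm_srefl[OF X(1) i] aperm_srefl[OF X(1) f] by auto
  qed
qed

lemma affine_weyl_mult:
  "x \<in> affine_weyl X n \<Longrightarrow> y \<in> affine_weyl X n \<Longrightarrow> x \<otimes>\<^bsub>W_aff n\<^esub> y \<in> affine_weyl X n"
  unfolding affine_weyl_def by (rule generate.eng)

lemma affine_weyl_srefl: "i \<le> n \<Longrightarrow> srefl X n i \<in> affine_weyl X n"
  unfolding affine_weyl_def by (intro generate.incl) auto

text \<open>
  The group of type \<open>Y\<close> is generated by that of type \<open>X\<close> and \<open>s\<^sub>c\<close>, which normalizes it. So it
  consists of at most two cosets.
\<close>

lemma affine_weyl_index_two:
  assumes X: "rank_ok X n" "end_node X n c" and Y: "rank_ok Y n"
    and same: "\<And>i. i \<le> n \<Longrightarrow> i \<noteq> c \<Longrightarrow> srefl Y n i = srefl X n i" and at_end: "srefl Y n c = sB n c"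
    and x: "x \<in> affine_weyl Y n"
  shows "x \<in> affine_weyl X n \<or> x \<otimes>\<^bsub>W_aff n\<^esub> sB n c \<in> affine_weyl X n"
proof -
  have n: "3 \<le> n" "1 \<le> n" using rank_ok_ge3[OF X(1)] by auto
  have c: "c \<le> n" using X(2) by (auto simp: end_node_def)
  note cc = sB_carrier[OF n(2) c]
  let ?s = "sB n c"
  obtain "is" where "set is \<subseteq> {0..n}" "word_elt Y n is = x" using x affine_weyl_iff[OF Y] by blast
  then show ?thesis
  proof (induction "is" arbitrary: x)
    case Nil
    then show ?case using generate.one[of "W_aff n" "srefl X n ` {0..n}"] by (simp add: affine_weyl_def)
  next
    case (Cons i "is")
    then have i: "i \<le> n" "set is \<subseteq> {0..n}" and xe: "x = word_elt Y n is \<otimes>\<^bsub>W_aff n\<^esub> srefl Y n i" by auto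
    let ?y = "word_elt Y n is"
    have y: "?y \<in> carrier (W_aff n)" using word_elt_carrier[OF Y i(2)] .
    have yss: "?y \<otimes>\<^bsub>W_aff n\<^esub> ?s \<otimes>\<^bsub>W_aff n\<^esub> ?s = ?y"
      using mult_srefl_cancel[OF Y c y] at_end by simp
    have IH: "?y \<in> affine_weyl X n \<or> ?y \<otimes>\<^bsub>W_aff n\<^esub> ?s \<in> affine_weyl X n" using Cons.IH[OF i(2) refl] .
    show ?case
    proof (cases "i = c")
      case True
      then show ?thesis using IH xe at_end yss by auto
    next
      case False
      have t: "srefl Y n i = srefl X n i" using same[OF i(1) False] .
      note ct = srefl_carrier[OF X(1) i(1)]
      have f: "fork_swap n c i \<le> n" using fork_swap_le[OF X(2) n(1) i(1)] .
      show ?thesis using IH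
      proof
        assume "?y \<in> affine_weyl X n"
        then show ?thesis using affine_weyl_mult affine_weyl_srefl[OF i(1)] xe t by metis
      next
        assume h: "?y \<otimes>\<^bsub>W_aff n\<^esub> ?s \<in> affine_weyl X n"
        have "?s \<otimes>\<^bsub>W_aff n\<^esub> srefl X n (fork_swap n c i) = srefl X n i \<otimes>\<^bsub>W_aff n\<^esub> ?s"
        proof -
          have "srefl X n i \<otimes>\<^bsub>W_aff n\<^esub> ?s = ?s \<otimes>\<^bsub>W_aff n\<^esub> srefl X n (fork_swap n c i) \<otimes>\<^bsub>W_aff n\<^esub> ?s \<otimes>\<^bsub>W_aff n\<^esub> ?s"
            using conj_srefl[OF X f] fork_swap_invol[OF n(1)] by simp
          then show ?thesis using sB_square[OF n(1) c] cc srefl_carrier[OF X(1) f] monoid.r_one[OF group.is_monoid[OF group_W]]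
            by (simp add: mult_assoc_W mult_closed_W)
        qed
        then have "x \<otimes>\<^bsub>W_aff n\<^esub> ?s = (?y \<otimes>\<^bsub>W_aff n\<^esub> ?s) \<otimes>\<^bsub>W_aff n\<^esub> srefl X n (fork_swap n c i)"
          unfolding xe t using y ct cc srefl_carrier[OF X(1) f] by (simp add: mult_assoc_W)
        then show ?thesis using affine_weyl_mult[OF h affine_weyl_srefl[OF f]] by simp
      qed
    qed
  qed
qed

text \<open>
  One of \<open>x\<close> and \<open>x s\<^sub>0\<close> is in the group, and the parity tells which.
\<close>

lemma affine_weyl_TC:
  assumes n: "3 \<le> n" shows "x \<in> affine_weyl TC n \<longleftrightarrow> x \<in> carrier (W_aff n) \<and> even (top_refls n x)"
proof
  assume "x \<in> affine_weyl TC n"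
  then show "x \<in> carrier (W_aff n) \<and> even (top_refls n x)"
    using affine_weyl_carrier[OF rank_ok_TC[OF n]] affine_weyl_even[OF rank_ok_TC[OF n]] by auto
next
  assume x: "x \<in> carrier (W_aff n) \<and> even (top_refls n x)"
  have c: "sB n 0 \<in> carrier (W_aff n)" using sB_carrier n by simp
  have "x \<in> affine_weyl TC n \<or> x \<otimes>\<^bsub>W_aff n\<^esub> sB n 0 \<in> affine_weyl TC n"
    by (rule affine_weyl_index_two[OF rank_ok_TC[OF n] _ rank_ok_TB[OF n]])
      (use x affine_weyl_TB[OF n] in \<open>auto simp: end_node_def srefl_def\<close>)
  moreover have "odd (top_refls n (x \<otimes>\<^bsub>W_aff n\<^esub> sB n 0))"
    using x refls_mult(1)[OF n, of x "sB n 0"] refls_sB(1)[OF n, of 0] c by auto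
  ultimately show "x \<in> affine_weyl TC n" using affine_weyl_even(1)[OF rank_ok_TC[OF n], of "x \<otimes>\<^bsub>W_aff n\<^esub> sB n 0"] by auto
qed

lemma affine_weyl_TD:
  assumes n: "4 \<le> n" 
  shows "x \<in> affine_weyl TD n \<longleftrightarrow> x \<in> carrier (W_aff n) \<and> even (top_refls n x) \<and> even (bottom_refls n x)"
proof
  assume "x \<in> affine_weyl TD n"
  then show "x \<in> carrier (W_aff n) \<and> even (top_refls n x) \<and> even (bottom_refls n x)"
    using affine_weyl_carrier[OF rank_ok_TD[OF n]] affine_weyl_even[OF rank_ok_TD[OF n]] by auto
next
  assume x: "x \<in> carrier (W_aff n) \<and> even (top_refls n x) \<and> even (bottom_refls n x)"
  have n3: "3 \<le> n" using n by simp
  have c: "sB n n \<in> carrier (W_aff n)" using sB_carrier n by simp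
  have "x \<in> affine_weyl TD n \<or> x \<otimes>\<^bsub>W_aff n\<^esub> sB n n \<in> affine_weyl TD n"
    by (rule affine_weyl_index_two[OF rank_ok_TD[OF n] _ rank_ok_TC[OF n3]])
      (use x affine_weyl_TC[OF n3] n in \<open>auto simp: end_node_def srefl_def\<close>)
  moreover have "odd (bottom_refls n (x \<otimes>\<^bsub>W_aff n\<^esub> sB n n))"
    using x refls_mult(2)[OF n3, of x "sB n n"] refls_sB(2)[OF n3, of n] c by auto
  ultimately show "x \<in> affine_weyl TD n" using affine_weyl_even(2)[OF rank_ok_TD[OF n], of "x \<otimes>\<^bsub>W_aff n\<^esub> sB n n"] by auto
qed

section \<open>The automorphism of type B on elements\<close>

text \<open>
  An explicit form of \<open>\<iota>\<^sub>B\<close>. On points it is the conjugation by \<open>y\<^sub>k \<mapsto> 1/2 - y\<^bsub>n+1-k\<^esub>\<close>, which preserves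
  the fundamental alcove; moving the constants \<open>1/2\<close> past the signs of \<open>w\<close> yields the term
  \<open>(1 - sign)/2\<close> of the translation, where the signs are the values of \<open>w\<close> at the constant vector
  \<open>1\<close>.
\<close>

definition flip_elt :: "nat \<Rightarrow> aelt \<Rightarrow> aelt" where
  "flip_elt n x = (\<lambda>k. if k \<in> {1..n} then (1 - snd x (\<lambda>_. 1) (n + 1 - k)) div 2 - fst x (n + 1 - k) else 0,
     \<lambda>z k. if k \<in> {1..n} then snd x (\<lambda>j. z (n + 1 - j)) (n + 1 - k) else z k)"

lemma flip_elt_carrier: 
  assumes x: "x \<in> carrier (W_aff n)" shows "flip_elt n x \<in> carrier (W_aff n)"
proof -
  have wx: "snd x \<in> signed_perms n" using assms by (simp add: carrier_W)
  obtain s \<sigma> where w: "snd x = (\<lambda>z k. s k * z (\<sigma> k))" "\<sigma> permutes {1..n}" "\<And>k. s k \<in> {1, -1}"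
    "\<And>k. k \<notin> {1..n} \<Longrightarrow> s k = 1" using signed_permsE[OF wx] by blast
  define r where "r k = (if k \<in> {1..n} then n + 1 - k else k)" for k
  have rr: "r (r k) = k" for k by (auto simp: r_def)
  have r: "r permutes {1..n}"
    by (rule bij_imp_permutes, rule bij_betw_byWitness[where f' = r]) (use rr in \<open>auto simp: r_def\<close>)
  have "(\<lambda>z k. s (r k) * z ((r \<circ> \<sigma> \<circ> r) k)) \<in> signed_perms n"
  proof (rule signed_permsI)
    show "r \<circ> \<sigma> \<circ> r permutes {1..n}" using permutes_compose[OF r permutes_compose[OF w(2) r]] by (simp add: comp_assoc)
    show "s (r k) \<in> {1, - 1}" for k using w(3) .
    show "s (r k) = 1" if "k \<notin> {1..n}" for k
    proof -
      have "r k = k" unfolding r_def using that by (rule if_not_P)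
      then show ?thesis using w(4)[OF that] by simp
    qed
  qed
  moreover have "s (r k) * z ((r \<circ> \<sigma> \<circ> r) k) = (if k \<in> {1..n} then snd x (\<lambda>j. z (n + 1 - j)) (n + 1 - k) else z k)" for z k
  proof (cases "k \<in> {1..n}")
    case True
    then have "n + 1 - k \<in> {1..n}" by auto
    then have "\<sigma> (n + 1 - k) \<in> {1..n}" using permutes_in_image[OF w(2)] by blast
    then show ?thesis using True by (simp add: r_def w(1))
  next
    case False
    then show ?thesis using w(4)[OF False] permutes_not_in[OF w(2) False] by (auto simp: r_def)
  qed
  ultimately show ?thesis by (simp add: carrier_W flip_elt_def)
qed

lemma aperm_flip_elt:
  assumes n: "1 \<le> n" and x: "x \<in> carrier (W_aff n)"
  shows "aperm n (flip_elt n x) = flip n (aperm n x)"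
proof (rule affine_perm_eqI[OF affine_perm_aperm[OF n flip_elt_carrier[OF x]] affine_perm_flip[OF affine_perm_aperm[OF n x]] n])
  fix m assume m: "1 \<le> m" "m \<le> int n"
  define k where "k = nat m"
  have k: "m = int k" "k \<in> {1..n}" using m by (auto simp: k_def)
  define l where "l = n + 1 - k"
  have l: "l \<in> {1..n}" "int n + 1 - m = int l" using k by (auto simp: l_def)
  have wx: "snd x \<in> signed_perms n" using x by (simp add: carrier_W)
  obtain s \<sigma> where w: "snd x = (\<lambda>z k. s k * z (\<sigma> k))" "\<sigma> permutes {1..n}" "\<And>k. s k \<in> {1, -1}"
    "\<And>k. k \<notin> {1..n} \<Longrightarrow> s k = 1" using signed_permsE[OF wx] by blast
  define j where "j = inv_into UNIV \<sigma> l"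
  have j: "j \<in> {1..n}" unfolding j_def using permutes_in_image[OF permutes_inv[OF w(2)]] l(1) by simp
  have sj: "\<sigma> i = l \<longleftrightarrow> i = j" for i unfolding j_def using permutes_inv_eq[OF w(2)] by metis
  define j' where "j' = n + 1 - j"
  have j': "j' \<in> {1..n}" "n + 1 - j' = j" "int j' = int n + 1 - int j" using j by (auto simp: j'_def)
  have we: "snd x (eps l) = (\<lambda>i. s j * eps j i)" unfolding w(1) using sj by (auto simp: eps_def fun_eq_iff)
  have a1: "act TC n x (position_vec n (int l)) = (\<lambda>i. s j * eps j i, - (s j * fst x j))"
    using position_vec_nat[of l n] l(1) sum_eps(2)[OF j, of "\<lambda>i. s j * fst x i"]
    by (simp add: act_eq we form_eq mult_ac)
  have w1: "snd x (\<lambda>_. 1) j = s j" by (simp add: w(1))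
  have ref: "(\<lambda>i. eps k (n + 1 - i)) = (\<lambda>i. if i \<le> n + 1 then eps l i else eps k 0)" using k l_def by (auto simp: eps_def fun_eq_iff)
  have we': "snd (flip_elt n x) (eps k) = (\<lambda>i. s j * eps j' i)"
  proof
    fix i
    show "snd (flip_elt n x) (eps k) i = s j * eps j' i"
    proof (cases "i \<in> {1..n}")
      case True
      then have i: "n + 1 - i \<in> {1..n}" by auto
      then have "\<sigma> (n + 1 - i) \<in> {1..n}" using permutes_in_image[OF w(2)] by blast
      then have "eps k (n + 1 - \<sigma> (n + 1 - i)) = of_bool (\<sigma> (n + 1 - i) = l)" using k(2) by (auto simp: eps_def l_def)
      also have "\<dots> = of_bool (i = j')" using sj[of "n + 1 - i"] True j by (auto simp: j'_def)
      finally show ?thesis using True by (auto simp: flip_elt_def w(1) eps_def j'_def)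
    next
      case False
      then show ?thesis using k(2) j'(1) by (auto simp: flip_elt_def eps_def)
    qed
  qed
  have b': "fst (flip_elt n x) j' = (1 - s j) div 2 - fst x j" using j' w1 by (simp add: flip_elt_def)
  have a2: "act TC n (flip_elt n x) (position_vec n m) = (\<lambda>i. s j * eps j' i, - (s j * ((1 - s j) div 2 - fst x j)))"
    using position_vec_nat[of k n] k sum_eps(2)[OF j'(1), of "\<lambda>i. s j * fst (flip_elt n x) i"] b'
    by (simp add: act_eq we' form_eq mult_ac)
  show "aperm n (flip_elt n x) m = flip n (aperm n x) m"
  proof (rule aperm_eqI[OF n flip_elt_carrier[OF x]])
    consider "s j = 1" | "s j = - 1" using w(3)[of j] by auto
    then show "act TC n (flip_elt n x) (position_vec n m) = position_vec n (flip n (aperm n x) m)"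
    proof cases
      case 1
      have "aperm n x (int l) = int j + 2 * int n * fst x j"
        by (rule aperm_eqI[OF n x]) (simp add: a1 1 position_vec_low[OF j])
      then have "flip n (aperm n x) m = int j' + 2 * int n * (- fst x j)" using l(2) j'(3) by (simp add: flip_def)
      then show ?thesis using position_vec_low[OF j'(1), of "- fst x j"] unfolding a2 by (simp add: 1)
    next
      case 2
      have "aperm n x (int l) = 2 * int n * (1 - fst x j) + 1 - int j"
        by (rule aperm_eqI[OF n x]) (use position_vec_high[OF j, of "1 - fst x j"] in \<open>simp add: a1 2\<close>)
      then have "flip n (aperm n x) m = 2 * int n * fst x j + 1 - int j'" using l(2) j'(3) by (simp add: flip_def algebra_simps)
      then show ?thesis using position_vec_high[OF j'(1), of "fst x j"] unfolding a2 by (simp add: 2)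
    qed
  qed
qed

lemma flip_elt_flip_elt: 
  assumes n: "1 \<le> n" and x: "x \<in> carrier (W_aff n)" shows "flip_elt n (flip_elt n x) = x"
  by (rule aperm_inj[OF n flip_elt_carrier[OF flip_elt_carrier[OF x]] x])
    (simp only: aperm_flip_elt[OF n flip_elt_carrier[OF x]] aperm_flip_elt[OF n x] flip_flip)

lemma flip_elt_mult:
  assumes n: "1 \<le> n" and x: "x \<in> carrier (W_aff n)" and y: "y \<in> carrier (W_aff n)"
  shows "flip_elt n (x \<otimes>\<^bsub>W_aff n\<^esub> y) = flip_elt n x \<otimes>\<^bsub>W_aff n\<^esub> flip_elt n y"
  by (rule aperm_inj[OF n flip_elt_carrier[OF mult_closed_W[OF x y]] mult_closed_W[OF flip_elt_carrier[OF x] flip_elt_carrier[OF y]]])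
    (simp only: aperm_flip_elt[OF n mult_closed_W[OF x y]] aperm_flip_elt[OF n x] aperm_flip_elt[OF n y] aperm_mult[OF n x y]
      aperm_mult[OF n flip_elt_carrier[OF x] flip_elt_carrier[OF y]] flip_comp)

lemma flip_elt_sB:
  assumes n: "3 \<le> n" and i: "i \<le> n" shows "flip_elt n (sB n i) = sB n (n - i)"
proof -
  have n1: "1 \<le> n" using n by simp
  have c: "sB n i \<in> carrier (W_aff n)" "sB n (n - i) \<in> carrier (W_aff n)" using sB_carrier[OF n1] i by auto
  show ?thesis
  proof (rule aperm_inj[OF n1 flip_elt_carrier[OF c(1)] c(2)])
    show "aperm n (flip_elt n (sB n i)) = aperm n (sB n (n - i))"
    proof (rule affine_perm_eqI[OF affine_perm_aperm[OF n1 flip_elt_carrier[OF c(1)]] affine_perm_aperm[OF n1 c(2)] n1])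
      fix k assume k: "1 \<le> k" "k \<le> int n"
      have ni: "int (n - i) = int n - int i" using i by simp
      show "aperm n (flip_elt n (sB n i)) k = aperm n (sB n (n - i)) k"
        unfolding aperm_flip_elt[OF n1 c(1)] aperm_sB[OF n i] aperm_sB[OF n diff_le_self] flip_def ni
        using affine_refl_window[of "int n + 1 - k" n "int i"] affine_refl_window[of k n "int n - int i"] k i by auto
    qed
  qed
qed

text \<open>
  Automorphisms are determined by their values on the generators \<open>s\<^sub>0, \<dots>, s\<^sub>n\<close>.
\<close>

lemma iota_B_eq:
  assumes n: "3 \<le> n" and x: "x \<in> carrier (W_aff n)" shows "iota_B n x = flip_elt n x"
proof -
  have n1: "1 \<le> n" using n by simp
  let ?f = "restrict (flip_elt n) (carrier (W_aff n))"
  have "iota_B n = ?f"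
    unfolding iota_B_def
  proof (rule the_equality)
    have "bij_betw (flip_elt n) (carrier (W_aff n)) (carrier (W_aff n))"
      by (rule bij_betw_byWitness[where f' = "flip_elt n"]) (auto simp: flip_elt_flip_elt[OF n1] flip_elt_carrier)
    then have "?f \<in> Bij (carrier (W_aff n))" by (simp add: Bij_def)
    moreover have "?f \<in> hom (W_aff n) (W_aff n)"
      by (rule homI) (simp_all add: flip_elt_carrier mult_closed_W flip_elt_mult[OF n1])
    ultimately show "?f \<in> auto (W_aff n) \<and> (\<forall>i\<in>{0..n}. ?f (sB n i) = sB n (n - i))"
      using flip_elt_sB[OF n] sB_carrier[OF n1] by (simp add: auto_def)
  next
    fix g assume g: "g \<in> auto (W_aff n) \<and> (\<forall>i\<in>{0..n}. g (sB n i) = sB n (n - i))"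
    then have gh: "g \<in> hom (W_aff n) (W_aff n)" and ge: "g \<in> extensional (carrier (W_aff n))"
      by (auto simp: auto_def Bij_def)
    have one: "g \<one>\<^bsub>W_aff n\<^esub> = \<one>\<^bsub>W_aff n\<^esub>" using hom_one[OF gh group_W group_W] .
    have fone: "flip_elt n \<one>\<^bsub>W_aff n\<^esub> = \<one>\<^bsub>W_aff n\<^esub>"
      by (rule aperm_inj[OF n1 flip_elt_carrier[OF one_closed_W] one_closed_W])
        (simp add: aperm_flip_elt[OF n1 one_closed_W] aperm_one[OF n1] flip_def fun_eq_iff)
    have word: "g (word_elt TB n is) = flip_elt n (word_elt TB n is)" if "set is \<subseteq> {0..n}" for "is"
      using that
    proof (induction "is")
      case Nil then show ?case by (simp add: one fone)
    next
      case (Cons i "is")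
      then have i: "i \<le> n" "set is \<subseteq> {0..n}" by auto
      note c = word_elt_carrier[OF rank_ok_TB[OF n] i(2)] sB_carrier[OF n1 i(1)]
      have sr: "srefl TB n i = sB n i" by (simp add: srefl_def)
      have "g (word_elt TB n (i # is)) = g (word_elt TB n is) \<otimes>\<^bsub>W_aff n\<^esub> g (sB n i)"
        using hom_mult[OF gh c] by (simp add: sr)
      also have "\<dots> = flip_elt n (word_elt TB n is) \<otimes>\<^bsub>W_aff n\<^esub> flip_elt n (sB n i)"
        using Cons.IH[OF i(2)] g i flip_elt_sB[OF n i(1)] by simp
      also have "\<dots> = flip_elt n (word_elt TB n (i # is))" using flip_elt_mult[OF n1 c] by (simp add: sr)
      finally show ?case .
    qed
    show "g = ?f"
    proof (rule extensionalityI[OF ge restrict_extensional])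
      fix y assume y: "y \<in> carrier (W_aff n)"
      then obtain "is" where "set is \<subseteq> {0..n}" "word_elt TB n is = y" using W_generated[OF n] by blast
      then show "g y = ?f y" using word[of "is"] y by auto
    qed
  qed
  then show ?thesis using x by simp
qed

lemma iota_B_carrier: "3 \<le> n \<Longrightarrow> x \<in> carrier (W_aff n) \<Longrightarrow> iota_B n x \<in> carrier (W_aff n)"
  by (simp add: iota_B_eq flip_elt_carrier)

lemma aperm_iota_B: "3 \<le> n \<Longrightarrow> x \<in> carrier (W_aff n) \<Longrightarrow> aperm n (iota_B n x) = flip n (aperm n x)"
  by (simp add: iota_B_eq aperm_flip_elt)

lemma iota_B_iota_B: "3 \<le> n \<Longrightarrow> x \<in> carrier (W_aff n) \<Longrightarrow> iota_B n (iota_B n x) = x"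
  by (simp add: iota_B_eq flip_elt_carrier flip_elt_flip_elt)

section \<open>B-positive elements as permutations\<close>

text \<open>
  The translation part of a \<open>B\<close>-positive element is constant on bunches because these are disjoint.
\<close>

lemma bunch_translation:
  assumes "length t = length p"
  shows "j < length p \<Longrightarrow> k \<in> bunch u p j \<Longrightarrow> (\<Sum>j<length p. int (t ! j) * (\<Sum>i\<in>bunch u p j. eps i k)) = int (t ! j)"
    "(\<And>j. j < length p \<Longrightarrow> k \<notin> bunch u p j) \<Longrightarrow> (\<Sum>j<length p. int (t ! j) * (\<Sum>i\<in>bunch u p j. eps i k)) = 0"
proof -
  have e: "(\<Sum>i\<in>bunch u p j. eps i k) = of_bool (k \<in> bunch u p j)" for j
    by (simp add: eps_def bunch_def)
  show "(\<Sum>j<length p. int (t ! j) * (\<Sum>i\<in>bunch u p j. eps i k)) = int (t ! j)" if "j < length p" "k \<in> bunch u p j" for j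
  proof -
    have "(\<Sum>j<length p. int (t ! j) * (\<Sum>i\<in>bunch u p j. eps i k)) = (\<Sum>j'<length p. if j' = j then int (t ! j) else 0)"
      unfolding e using that(2) bunch_disjoint by (intro sum.cong) (auto simp: of_bool_def)
    then show ?thesis using that(1) by simp
  qed
  show "(\<And>j. j < length p \<Longrightarrow> k \<notin> bunch u p j) \<Longrightarrow> (\<Sum>j<length p. int (t ! j) * (\<Sum>i\<in>bunch u p j. eps i k)) = 0"
    unfolding e by (intro sum.neutral) auto
qed

lemma bunch_union:
  assumes "k \<in> {1..n}" "u + v + sum_list p = n"
  shows "k \<notin> (\<Union>j<length p. bunch u p j) \<longleftrightarrow> k \<le> u \<or> n - v < k"
proof -
  have s: "u + sum_list p = n - v" using assms(2) by simp
  show ?thesis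
  proof (cases "u < k \<and> k \<le> n - v")
    case True
    then have "\<exists>j<length p. k \<in> bunch u p j" using bunch_cover[of u k p] s by simp
    then show ?thesis using True by auto
  next
    case False
    then have "k \<notin> bunch u p j" for j using bunch_bounds[of k u p j] s by auto
    then show ?thesis using False by auto
  qed
qed

lemma B_positive_iff:
  assumes n: "1 \<le> n" shows "B_positive n u v p t x \<longleftrightarrow> x \<in> carrier (W_aff n) \<and> perm_B_positive n u v p t (aperm n x)"
proof
  assume "B_positive n u v p t x"
  then obtain b w where D: "B_data n u v p t" and x: "x = (b, w)" "w \<in> signed_perms n"
    and b: "b = (\<lambda>k. - (\<Sum>j<length p. int (t ! j) * (\<Sum>i\<in>bunch u p j. eps i k)))"
    and w1: "\<And>i. i \<in> {1..n} \<Longrightarrow> i \<notin> (\<Union>j<length p. bunch u p j) \<Longrightarrow> w (eps i) = eps i"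
    and w2: "\<And>j i. j < length p \<Longrightarrow> i \<in> bunch u p j \<Longrightarrow> w (eps i) = (\<lambda>k. - eps (bunch_rev u p j i) k)"
    unfolding B_positive_def by blast
  have d: "u + v + sum_list p = n" "length t = length p" using D by (auto simp: B_data_def)
  have b1: "b k = 0" if "k \<notin> (\<Union>j<length p. bunch u p j)" for k
    unfolding b using bunch_translation(2)[OF d(2), of k u] that by auto
  have b2: "b k = - int (t ! j)" if "j < length p" "k \<in> bunch u p j" for k j
    unfolding b using bunch_translation(1)[OF d(2) that] by simp
  have inn: "k \<in> {1..n}" if "k \<in> bunch u p j" for k j using bunch_bounds[OF that] d(1) by auto
  have "b k = 0" if "k \<notin> {1..n}" for k using b1[of k] inn[of k] that by auto
  then have c: "x \<in> carrier (W_aff n)" using x by (simp add: carrier_W)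
  have fixd: "aperm n x (int k) = int k" if k: "k \<in> {1..n}" "k \<notin> (\<Union>j<length p. bunch u p j)" for k
    by (rule aperm_eqI[OF n c])
      (use position_vec_nat[of k n] k w1[OF k] b1[OF k(2)] sum_eps(2)[OF k(1), of b] in \<open>simp add: act_eq x form_eq\<close>)
  have moved: "aperm n x (int k) = 2 * int n * (int (t ! j) + 1) + 1 - int (bunch_rev u p j k)" 
    if j: "j < length p" "k \<in> bunch u p j" for j k
  proof (rule aperm_eqI[OF n c])
    have r: "bunch_rev u p j k \<in> {1..n}" using inn[OF bunch_rev_in(1)[OF j(2)]] .
    have k: "1 \<le> k" "k \<le> n" using inn[OF j(2)] by auto
    show "act TC n x (position_vec n (int k)) = position_vec n (2 * int n * (int (t ! j) + 1) + 1 - int (bunch_rev u p j k))"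
      unfolding position_vec_high[OF r] position_vec_nat[OF k]
      using w2[OF j] b2[OF j(1) bunch_rev_in(1)[OF j(2)]] sum_eps(2)[OF r, of b] by (simp add: act_eq x form_eq sum_negf)
  qed
  have "aperm n x (int k) = int k" if "1 \<le> k \<and> k \<le> u \<or> n - v < k \<and> k \<le> n" for k
  proof -
    have k: "k \<in> {1..n}" using that d(1) by auto
    then show ?thesis using fixd[OF k] bunch_union[OF k d(1)] that by blast
  qed
  then have "perm_B_positive n u v p t (aperm n x)" unfolding perm_B_positive_def using D moved by blast
  then show "x \<in> carrier (W_aff n) \<and> perm_B_positive n u v p t (aperm n x)" using c by blast
next
  assume "x \<in> carrier (W_aff n) \<and> perm_B_positive n u v p t (aperm n x)"
  then have c: "x \<in> carrier (W_aff n)" and bp: "perm_B_positive n u v p t (aperm n x)" by auto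
  have D: "B_data n u v p t" using bp by (simp add: perm_B_positive_def)
  have d: "u + v + sum_list p = n" "length t = length p" using D by (auto simp: B_data_def)
  obtain b w where x: "x = (b, w)" by (cases x)
  have w: "w \<in> signed_perms n" and b0: "\<And>k. k \<notin> {1..n} \<Longrightarrow> b k = 0" using c x by (auto simp: carrier_W)
  have inn: "k \<in> {1..n}" if "k \<in> bunch u p j" for k j using bunch_bounds[OF that] d(1) by auto
  have fixd: "w (eps k) = eps k \<and> b k = 0" if k: "k \<in> {1..n}" "k \<notin> (\<Union>j<length p. bunch u p j)" for k
  proof -
    have "aperm n x (int k) = int k" using bp k bunch_union[OF k(1) d(1)] by (auto simp: perm_B_positive_def)
    then have "(eps k, 0) = act TC n x (eps k, 0)" using position_vec_aperm[OF n c, of "int k"] position_vec_nat[of k n] k(1) by simp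
    then have "w (eps k) = eps k" "0 = - form TC n (w (eps k)) b" by (auto simp: act_eq x)
    then show ?thesis using sum_eps(2)[OF k(1), of b] by (simp add: form_eq)
  qed
  have moved: "w (eps k) = (\<lambda>i. - eps (bunch_rev u p j k) i) \<and> b (bunch_rev u p j k) = - int (t ! j)" 
    if j: "j < length p" "k \<in> bunch u p j" for j k
  proof -
    have r: "bunch_rev u p j k \<in> {1..n}" using inn[OF bunch_rev_in(1)[OF j(2)]] .
    have k: "1 \<le> k" "k \<le> n" using inn[OF j(2)] by auto
    have "aperm n x (int k) = 2 * int n * (int (t ! j) + 1) + 1 - int (bunch_rev u p j k)" using bp j by (auto simp: perm_B_positive_def)
    then have "(\<lambda>i. - eps (bunch_rev u p j k) i, - int (t ! j)) = act TC n x (eps k, 0)" 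
      using position_vec_aperm[OF n c, of "int k"] position_vec_nat[OF k] position_vec_high[OF r, of "int (t ! j) + 1"] by simp
    then have "w (eps k) = (\<lambda>i. - eps (bunch_rev u p j k) i)" "- int (t ! j) = - form TC n (w (eps k)) b" by (auto simp: act_eq x)
    then show ?thesis using sum_eps(2)[OF r, of b] by (simp add: form_eq sum_negf)
  qed
  have "b k = - (\<Sum>j<length p. int (t ! j) * (\<Sum>i\<in>bunch u p j. eps i k))" for k
  proof (cases "k \<in> (\<Union>j<length p. bunch u p j)")
    case True
    then obtain j where j: "j < length p" "k \<in> bunch u p j" by blast
    then show ?thesis using moved[OF j(1) bunch_rev_in(1)[OF j(2)]] bunch_rev_in(2)[OF j(2)] bunch_translation(1)[OF d(2) j] by simp
  next
    case False
    then have "b k = 0" using fixd b0 by blast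
    then show ?thesis using bunch_translation(2)[OF d(2), of k u] False by auto
  qed
  then have "b = (\<lambda>k. - (\<Sum>j<length p. int (t ! j) * (\<Sum>i\<in>bunch u p j. eps i k)))" by blast
  moreover have "\<forall>i\<in>{1..n}. i \<notin> (\<Union>j<length p. bunch u p j) \<longrightarrow> w (eps i) = eps i" using fixd by blast
  moreover have "\<forall>j<length p. \<forall>i\<in>bunch u p j. w (eps i) = (\<lambda>k. - eps (bunch_rev u p j i) k)" using moved by blast
  ultimately show "B_positive n u v p t x" unfolding B_positive_def using D x w by blast
qed

text \<open>
  A \<open>B\<close>-positive element is an involution: it reverses every bunch twice, and the two translations
  cancel because the sign in between is negative.
\<close>

lemma perm_B_positive_facts:
  assumes n: "3 \<le> n" and G: "affine_perm n G" and bp: "perm_B_positive n u v p t G"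
  shows "1 \<le> v" "v + 2 \<le> n" "G \<circ> G = id" "1 \<le> u \<Longrightarrow> G 1 = 1" "G (int n) = int n" "G (int (n - v)) > int n"
    "int (n - v) + 1 \<le> int n \<Longrightarrow> G (int (n - v) + 1) = int (n - v) + 1"
proof -
  have D: "B_data n u v p t" using bp by (simp add: perm_B_positive_def)
  then have d: "1 \<le> v" "u + v + sum_list p = n" "2 \<le> sum_list p" "\<forall>q\<in>set p. 1 \<le> q" "length t = length p"
    by (auto simp: B_data_def)
  have fixd: "G (int k) = int k" if "1 \<le> k" "k \<le> u \<or> n - v < k \<and> k \<le> n" for k
    using bp that by (auto simp: perm_B_positive_def)
  have moved: "G (int k) = 2 * int n * (int (t ! j) + 1) + 1 - int (bunch_rev u p j k)" if "j < length p" "k \<in> bunch u p j" for j k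
    using bp that by (auto simp: perm_B_positive_def)
  show "1 \<le> v" "v + 2 \<le> n" using d by auto
  show "1 \<le> u \<Longrightarrow> G 1 = 1" using fixd[of 1] by simp
  show "G (int n) = int n" using fixd[of n] d(1) n by simp
  show "G (int (n - v) + 1) = int (n - v) + 1" if "int (n - v) + 1 \<le> int n"
    using fixd[of "n - v + 1"] d(1) that by (simp add: add.commute)
  show "G \<circ> G = id"
  proof (rule affine_perm_eqI[OF affine_perm_comp[OF G G] affine_perm_id])
    show "1 \<le> n" using n by simp
    fix m assume m: "1 \<le> m" "m \<le> int n"
    define k where "k = nat m"
    have k: "m = int k" "k \<in> {1..n}" using m by (auto simp: k_def)
    show "(G \<circ> G) m = id m"
    proof (cases "k \<in> (\<Union>j<length p. bunch u p j)")
      case True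
      then obtain j where j: "j < length p" "k \<in> bunch u p j" by blast
      show ?thesis using moved[OF j] moved[OF j(1) bunch_rev_in(1)[OF j(2)]] bunch_rev_in(2)[OF j(2)] k(1)
          affine_perm_reflect[OF G, of "int (t ! j) + 1" "int (bunch_rev u p j k)"] by simp
    next
      case False
      then show ?thesis using bunch_union[OF k(2) d(2)] fixd[of k] k by auto
    qed
  qed
  have nv: "u < n - v" "n - v \<le> u + sum_list p" using d by auto
  then obtain j where j: "j < length p" "n - v \<in> bunch u p j" using bunch_cover by blast
  have "bunch_rev u p j (n - v) \<le> n" using bunch_bounds(2)[OF bunch_rev_in(1)[OF j(2)]] d(2) by simp
  moreover have "2 * int n \<le> 2 * int n * (int (t ! j) + 1)" using n by (simp add: algebra_simps)
  ultimately show "G (int (n - v)) > int n" using moved[OF j] by linarith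
qed

section \<open>Minimal NGT of types C and D\<close>

text \<open>
  Minimal NGT of the group extended by the reflections \<open>s\<^sub>0\<close> (and \<open>s\<^sub>n\<close>): the membership in the affine Weyl
  group of the type is dropped.
\<close>

definition ext_ngt :: "affine_type \<Rightarrow> nat \<Rightarrow> aelt \<Rightarrow> bool" where
  "ext_ngt X n y \<longleftrightarrow> y \<in> carrier (W_aff n) \<and> (\<exists>i j. ngt X n (aperm n y) i j)"

lemma ext_ngt_sB:
  assumes X: "rank_ok X n" "end_node X n c" and y: "ext_ngt X n y"
  shows "ext_ngt X n (y \<otimes>\<^bsub>W_aff n\<^esub> sB n c)" "ext_ngt X n (sB n c \<otimes>\<^bsub>W_aff n\<^esub> y)"
proof -
  have n: "3 \<le> n" "1 \<le> n" using rank_ok_ge3[OF X(1)] by auto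
  have c: "c \<le> n" using X(2) by (auto simp: end_node_def)
  note cc = sB_carrier[OF n(2) c]
  obtain i j where yc: "y \<in> carrier (W_aff n)" and ng: "ngt X n (aperm n y) i j" using y unfolding ext_ngt_def by blast
  note G = affine_perm_aperm[OF n(2) yc]
  have "ngt X n (aperm n (y \<otimes>\<^bsub>W_aff n\<^esub> sB n c)) (fork_swap n c i) j"
    unfolding aperm_mult[OF n(2) yc cc] aperm_sB[OF n(1) c] by (rule ngt_end_swap_right[OF X G ng])
  then show "ext_ngt X n (y \<otimes>\<^bsub>W_aff n\<^esub> sB n c)" using mult_closed_W[OF yc cc] by (auto simp: ext_ngt_def)
  have "ngt X n (aperm n (sB n c \<otimes>\<^bsub>W_aff n\<^esub> y)) i (fork_swap n c j)"
    unfolding aperm_mult[OF n(2) cc yc] aperm_sB[OF n(1) c] by (rule ngt_end_swap_left[OF X G ng])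
  then show "ext_ngt X n (sB n c \<otimes>\<^bsub>W_aff n\<^esub> y)" using mult_closed_W[OF cc yc] by (auto simp: ext_ngt_def)
qed

lemma minimal_NGT_carrier: "rank_ok X n \<Longrightarrow> minimal_NGT X n y \<Longrightarrow> y \<in> carrier (W_aff n)"
  unfolding minimal_NGT_def by (blast intro: affine_weyl_carrier)

lemma minimal_NGT_TB: assumes "3 \<le> n" shows "minimal_NGT TB n y \<longleftrightarrow> ext_ngt TB n y"
  using minimal_NGT_iff[OF rank_ok_TB[OF assms], of y] minimal_NGT_carrier[OF rank_ok_TB[OF assms], of y]
  unfolding affine_weyl_TB[OF assms] ext_ngt_def by blast

lemma minimal_NGT_TC: 
  assumes "3 \<le> n" shows "minimal_NGT TC n y \<longleftrightarrow> ext_ngt TC n y \<and> even (top_refls n y)"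
  using minimal_NGT_iff[OF rank_ok_TC[OF assms], of y] minimal_NGT_carrier[OF rank_ok_TC[OF assms], of y]
  unfolding affine_weyl_TC[OF assms] ext_ngt_def by blast

lemma minimal_NGT_TD: 
  assumes "4 \<le> n" 
  shows "minimal_NGT TD n y \<longleftrightarrow> ext_ngt TD n y \<and> even (top_refls n y) \<and> even (bottom_refls n y)"
  using minimal_NGT_iff[OF rank_ok_TD[OF assms], of y] minimal_NGT_carrier[OF rank_ok_TD[OF assms], of y]
  unfolding affine_weyl_TD[OF assms] ext_ngt_def by blast

definition double_coset :: "nat \<Rightarrow> nat \<Rightarrow> aelt \<Rightarrow> aelt set" where
  "double_coset n c y = {y, y \<otimes>\<^bsub>W_aff n\<^esub> sB n c, sB n c \<otimes>\<^bsub>W_aff n\<^esub> y,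
     sB n c \<otimes>\<^bsub>W_aff n\<^esub> y \<otimes>\<^bsub>W_aff n\<^esub> sB n c}"

lemma sB_cancel:
  assumes n: "3 \<le> n" "c \<le> n" and y: "y \<in> carrier (W_aff n)"
  shows "y \<otimes>\<^bsub>W_aff n\<^esub> sB n c \<otimes>\<^bsub>W_aff n\<^esub> sB n c = y" "sB n c \<otimes>\<^bsub>W_aff n\<^esub> (sB n c \<otimes>\<^bsub>W_aff n\<^esub> y) = y"
proof -
  interpret W: group "W_aff n" by (rule group_W)
  have c: "sB n c \<in> carrier (W_aff n)" using sB_carrier n by simp
  show "y \<otimes>\<^bsub>W_aff n\<^esub> sB n c \<otimes>\<^bsub>W_aff n\<^esub> sB n c = y" using sB_square[OF n] c y by (simp add: W.m_assoc)
  show "sB n c \<otimes>\<^bsub>W_aff n\<^esub> (sB n c \<otimes>\<^bsub>W_aff n\<^esub> y) = y" using sB_square[OF n] c y by (simp flip: W.m_assoc)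
qed

lemma double_coset_sym:
  assumes n: "3 \<le> n" "c \<le> n" and y: "y \<in> carrier (W_aff n)" and z: "z \<in> double_coset n c y"
  shows "z \<in> carrier (W_aff n)" "y \<in> double_coset n c z"
proof -
  have c: "sB n c \<in> carrier (W_aff n)" using sB_carrier n by simp
  let ?s = "sB n c"
  note ys = mult_closed_W[OF y c] and sy = mult_closed_W[OF c y]
  consider (1) "z = y" | (2) "z = y \<otimes>\<^bsub>W_aff n\<^esub> ?s" | (3) "z = ?s \<otimes>\<^bsub>W_aff n\<^esub> y" | (4) "z = ?s \<otimes>\<^bsub>W_aff n\<^esub> y \<otimes>\<^bsub>W_aff n\<^esub> ?s"
    using z unfolding double_coset_def by blast
  then have "z \<in> carrier (W_aff n) \<and> y \<in> double_coset n c z"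
  proof cases
    case 1 then show ?thesis using y by (simp add: double_coset_def)
  next
    case 2 then show ?thesis using ys sB_cancel(1)[OF n y] by (simp add: double_coset_def)
  next
    case 3 then show ?thesis using sy sB_cancel(2)[OF n y] by (simp add: double_coset_def)
  next
    case 4
    have "?s \<otimes>\<^bsub>W_aff n\<^esub> z \<otimes>\<^bsub>W_aff n\<^esub> ?s = y"
      unfolding 4 mult_assoc_W[OF c y c] sB_cancel(2)[OF n ys] sB_cancel(1)[OF n y] ..
    then show ?thesis using mult_closed_W[OF sy c] 4 by (simp add: double_coset_def)
  qed
  then show "z \<in> carrier (W_aff n)" "y \<in> double_coset n c z" by blast+
qed

lemma ext_ngt_double_coset:
  assumes X: "rank_ok X n" "end_node X n c" and y: "ext_ngt X n y" and z: "z \<in> double_coset n c y"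
  shows "ext_ngt X n z"
  using z ext_ngt_sB[OF X y] ext_ngt_sB(1)[OF X ext_ngt_sB(2)[OF X y]] y unfolding double_coset_def by blast

lemma aperm_double_coset:
  assumes n: "3 \<le> n" "c \<le> n" and y: "y \<in> carrier (W_aff n)"
  shows "aperm n ` double_coset n c y = {aperm n y, aperm n y \<circ> end_swap n c, end_swap n c \<circ> aperm n y, end_swap n c \<circ> aperm n y \<circ> end_swap n c}"
proof -
  have n1: "1 \<le> n" using n by simp
  have c: "sB n c \<in> carrier (W_aff n)" using sB_carrier n by simp
  show ?thesis unfolding double_coset_def
    by (simp add: aperm_mult[OF n1] aperm_sB[OF n] y c mult_closed_W)
qed

lemma end_normal_form:
  assumes n: "3 \<le> n" and c: "c = 0 \<or> c = n" and y: "y \<in> carrier (W_aff n)"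
  obtains z where "z \<in> double_coset n c y" "end_ascent (aperm n z) c"
proof -
  have n1: "1 \<le> n" "c \<le> n" using n c by auto
  obtain G where "G \<in> aperm n ` double_coset n c y" "end_ascent G c"
    using end_normalise[OF n c affine_perm_aperm[OF n1(1) y]] unfolding aperm_double_coset[OF n n1(2) y] by blast
  then obtain z where "z \<in> double_coset n c y" "G = aperm n z" "end_ascent G c" by blast
  then show thesis using that by blast
qed

lemma top_ascent_double_coset:
  assumes n: "3 \<le> n" and y: "y \<in> carrier (W_aff n)" and a: "end_ascent (aperm n y) 0" and z: "z \<in> double_coset n n y"
  shows "end_ascent (aperm n z) 0"
proof -
  have n1: "1 \<le> n" using n by simp
  note G = affine_perm_aperm[OF n1 y] and e = affine_perm_end_swap[OF n, of n]
  have "aperm n z \<in> {aperm n y, aperm n y \<circ> end_swap n n, end_swap n n \<circ> aperm n y, end_swap n n \<circ> aperm n y \<circ> end_swap n n}"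
    using z unfolding aperm_double_coset[OF n order.refl y, symmetric] by blast
  then show ?thesis using a end_ascent_other[OF n G a] end_ascent_other(1)[OF n affine_perm_comp[OF e G]] by auto
qed

text \<open>
  The case in which the upper block is fixed is reduced to the other one by \<open>\<iota>\<^sub>B\<close>.
\<close>

lemma ext_ngt_TB_classification:
  assumes n: "3 \<le> n" and y: "ext_ngt TB n y"
  shows "\<exists>u v p t w. B_positive_NGT n u v p t w \<and> (y = w \<or> y = iota_B n w)"
proof -
  have n1: "1 \<le> n" using n by simp
  obtain i j where yc: "y \<in> carrier (W_aff n)" and ng: "ngt TB n (aperm n y) i j" using y unfolding ext_ngt_def by blast
  note G = affine_perm_aperm[OF n1 yc]
  have pos: "\<exists>u v p t. B_positive_NGT n u v p t z" if z: "z \<in> carrier (W_aff n)" "ngt TB n (aperm n z) k k" "fixes_bottom n (aperm n z) k" for z k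
  proof -
    obtain u p t where "perm_B_positive n u (n - k) p t (aperm n z)" 
      using ngt_TB_perm_B_positive[OF affine_perm_aperm[OF n1 z(1)] n z(2,3)] by blast
    then have "B_positive n u (n - k) p t z" using B_positive_iff[OF n1] z(1) by simp
    moreover have "minimal_NGT TB n z" using z unfolding minimal_NGT_TB[OF n] ext_ngt_def by blast
    ultimately show ?thesis unfolding B_positive_NGT_def by blast
  qed
  have ij: "i = j" and fb: "fixes_bottom n (aperm n y) i \<or> fixes_bottom n (flip n (aperm n y)) (n - i)"
    using ngt_TB_fixes[OF G ng] by auto
  show ?thesis using fb
  proof
    assume "fixes_bottom n (aperm n y) i"
    then show ?thesis using pos[OF yc, of i] ng ij by blast
  next
    assume f: "fixes_bottom n (flip n (aperm n y)) (n - i)"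
    have "\<exists>u v p t. B_positive_NGT n u v p t (iota_B n y)"
    proof (rule pos[OF iota_B_carrier[OF n yc]])
      show "ngt TB n (aperm n (iota_B n y)) (n - i) (n - i)"
        unfolding aperm_iota_B[OF n yc] using ngt_flip[OF G ng] ij by simp
      show "fixes_bottom n (aperm n (iota_B n y)) (n - i)" unfolding aperm_iota_B[OF n yc] by (rule f)
    qed
    then show ?thesis using iota_B_iota_B[OF n yc, symmetric] by blast
  qed
qed

lemma TC_normal_form:
  assumes n: "3 \<le> n" and x: "minimal_NGT TC n x"
  obtains y where "ext_ngt TB n y" "ext_ngt TC n y" "x \<in> double_coset n 0 y"
proof -
  have n1: "1 \<le> n" using n by simp
  have X: "rank_ok TC n" "end_node TC n 0" using rank_ok_TC[OF n] by (auto simp: end_node_def)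
  have ex: "ext_ngt TC n x" using x minimal_NGT_TC[OF n] by blast
  then have xc: "x \<in> carrier (W_aff n)" by (simp add: ext_ngt_def)
  obtain y where y: "y \<in> double_coset n 0 x" "end_ascent (aperm n y) 0" using end_normal_form[OF n _ xc, of 0] by blast
  have yc: "y \<in> carrier (W_aff n)" "x \<in> double_coset n 0 y" using double_coset_sym[OF n _ xc y(1)] by auto
  have ey: "ext_ngt TC n y" using ext_ngt_double_coset[OF X ex y(1)] .
  then obtain i j where "ngt TC n (aperm n y) i j" unfolding ext_ngt_def by blast
  then have "ngt TB n (aperm n y) i j"
    using ngt_TB_I[OF X(1) _ affine_perm_aperm[OF n1 yc(1)]] y(2) by simp
  then have "ext_ngt TB n y" using yc(1) unfolding ext_ngt_def by blast
  then show thesis using that[OF _ ey yc(2)] by blast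
qed

text \<open>
  The two end nodes are treated one after the other, since the second step preserves the outcome of the
  first.
\<close>

lemma TD_normal_form:
  assumes n: "4 \<le> n" and x: "minimal_NGT TD n x"
  obtains y z where "ext_ngt TB n y" "ext_ngt TD n y" "z \<in> double_coset n n y" "x \<in> double_coset n 0 z"
proof -
  have n1: "1 \<le> n" "3 \<le> n" using n by auto
  have X: "rank_ok TD n" "end_node TD n 0" "end_node TD n n" using rank_ok_TD[OF n] by (auto simp: end_node_def)
  have ex: "ext_ngt TD n x" using x minimal_NGT_TD[OF n] by blast
  then have xc: "x \<in> carrier (W_aff n)" by (simp add: ext_ngt_def)
  obtain z where z: "z \<in> double_coset n 0 x" "end_ascent (aperm n z) 0" using end_normal_form[OF n1(2) _ xc, of 0] by blast
  have zc: "z \<in> carrier (W_aff n)" "x \<in> double_coset n 0 z" using double_coset_sym[OF n1(2) _ xc z(1)] by auto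
  have ez: "ext_ngt TD n z" using ext_ngt_double_coset[OF X(1,2) ex z(1)] .
  obtain y where y: "y \<in> double_coset n n z" "end_ascent (aperm n y) n" using end_normal_form[OF n1(2) _ zc(1), of n] by blast
  have yc: "y \<in> carrier (W_aff n)" "z \<in> double_coset n n y" using double_coset_sym[OF n1(2) _ zc(1) y(1)] by auto
  have ey: "ext_ngt TD n y" using ext_ngt_double_coset[OF X(1,3) ez y(1)] .
  have a0: "end_ascent (aperm n y) 0" using top_ascent_double_coset[OF n1(2) zc(1) z(2) y(1)] .
  from ey obtain i j where "ngt TD n (aperm n y) i j" unfolding ext_ngt_def by blast
  then have "ngt TB n (aperm n y) i j"
    using ngt_TB_I[OF X(1) _ affine_perm_aperm[OF n1(1) yc(1)] _ a0 y(2)] by simp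
  then have "ext_ngt TB n y" using yc(1) unfolding ext_ngt_def by blast
  then show thesis using that[OF _ ey yc(2) zc(2)] by blast
qed

text \<open>
  Conjugation moves the reflection in a pair of positions to the reflection in their images.
\<close>

lemma sB_commute:
  assumes n: "3 \<le> n" "c \<le> n" and x: "x \<in> carrier (W_aff n)"
    and f: "aperm n x (int c) = int c" "aperm n x (int c + 1) = int c + 1"
  shows "sB n c \<otimes>\<^bsub>W_aff n\<^esub> x = x \<otimes>\<^bsub>W_aff n\<^esub> sB n c"
proof -
  have n1: "1 \<le> n" using n by simp
  have c: "sB n c \<in> carrier (W_aff n)" using sB_carrier n by simp
  show ?thesis
    by (rule aperm_inj[OF n1 mult_closed_W[OF c x] mult_closed_W[OF x c]])
      (use refl_conj[OF affine_perm_aperm[OF n1 x], of "int c" "int c + 1"] f in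
        \<open>simp add: aperm_mult[OF n1] c x aperm_sB[OF n] fun_eq_iff\<close>)
qed

text \<open>
  A descent away from the end of the diagram does not create a descent at the fork, because the pair of
  the fork is composed of two adjacent pairs that are not descents.
\<close>

lemma no_descent_at_fork:
  assumes n: "3 \<le> n" and F: "affine_perm n F" and d: "descents TB n F = {k}"
  shows "2 \<le> k \<Longrightarrow> F (- 1) < F 1" "k + 2 \<le> n \<Longrightarrow> F (int n - 1) < F (int n + 1)"
proof -
  have a: "F (int l) < F (int l + 1)" if "l \<le> n" "l \<noteq> k" for l
  proof -
    have "l \<notin> descents TB n F" using d that by simp
    then show ?thesis using that affine_perm_inj[OF F, of "int l" "int l + 1"] by (simp add: descents_def node_simps)
  qed
  have "F 0 < F 1" "F 1 < F 2" if "2 \<le> k" using a[of 0] a[of 1] that n by auto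
  moreover have "F (- 1) = 1 - F 2" "F 0 = 1 - F 1" using affine_perm_mirror[OF F, of 2] affine_perm_mirror[OF F, of 1] by auto
  ultimately show "2 \<le> k \<Longrightarrow> F (- 1) < F 1" by linarith
  show "F (int n - 1) < F (int n + 1)" if k: "k + 2 \<le> n"
  proof -
    have "F (int n - 1) < F (int n)" using a[of "n - 1"] k n by (simp add: of_nat_diff)
    moreover have "F (int n) < F (int n + 1)" using a[of n] k by simp
    ultimately show ?thesis by simp
  qed
qed

text \<open>
  A \<open>B\<close>-positive minimal NGT of type \<open>B\<close>, with \<open>wi\<close> for its image under \<open>\<iota>\<^sub>B\<close>.
\<close>

locale B_positive_elt =
  fixes n u v :: nat and p t :: "nat list" and w :: aelt
  assumes n: "3 \<le> n" and w: "B_positive_NGT n u v p t w"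
begin

sublocale W: group "W_aff n" by (rule group_W)

abbreviation wmult (infixl "\<star>" 70) where "a \<star> b \<equiv> a \<otimes>\<^bsub>W_aff n\<^esub> b"
abbreviation "s0 \<equiv> sB n 0"
abbreviation "sn \<equiv> sB n n"
abbreviation "wi \<equiv> iota_B n w"

lemma n1: "1 \<le> n" using n by simp

lemma carriers [simp]: "w \<in> carrier (W_aff n)" "s0 \<in> carrier (W_aff n)" "sn \<in> carrier (W_aff n)" "wi \<in> carrier (W_aff n)"
proof -
  show wc: "w \<in> carrier (W_aff n)" using w B_positive_iff[OF n1] by (auto simp: B_positive_NGT_def)
  show "s0 \<in> carrier (W_aff n)" "sn \<in> carrier (W_aff n)" using sB_carrier n by simp_all
  show "wi \<in> carrier (W_aff n)" using iota_B_carrier[OF n wc] .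
qed

lemma w_perm: "perm_B_positive n u v p t (aperm n w)" 
  using w B_positive_iff[OF n1] by (auto simp: B_positive_NGT_def)

lemmas w_affine = affine_perm_aperm[OF n1 carriers(1)]
lemmas w_facts = perm_B_positive_facts[OF n w_affine w_perm]

lemma aperm_wi: "aperm n wi = flip n (aperm n w)" using aperm_iota_B[OF n carriers(1)] .

lemma w_square: "w \<star> w = \<one>\<^bsub>W_aff n\<^esub>"
  by (rule aperm_inj[OF n1]) (simp_all add: aperm_mult[OF n1] aperm_one[OF n1] w_facts(3) one_closed_W)

lemma wi_square: "wi \<star> wi = \<one>\<^bsub>W_aff n\<^esub>"
proof (rule aperm_inj[OF n1])
  have "flip n (aperm n w) \<circ> flip n (aperm n w) = flip n id" unfolding flip_comp[symmetric] w_facts(3) ..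
  also have "\<dots> = id" by (simp add: flip_def fun_eq_iff)
  finally show "aperm n (wi \<star> wi) = aperm n \<one>\<^bsub>W_aff n\<^esub>" by (simp add: aperm_mult[OF n1] aperm_one[OF n1] aperm_wi)
qed (simp_all add: one_closed_W)

lemma squares: "s0 \<star> s0 = \<one>\<^bsub>W_aff n\<^esub>" "sn \<star> sn = \<one>\<^bsub>W_aff n\<^esub>"
  using sB_square[OF n] by simp_all

lemma sn_w: "sn \<star> w = w \<star> sn"
  by (rule sB_commute[OF n order.refl carriers(1)])
    (use w_facts(5) affine_perm_reflect[OF w_affine, of 1 "int n"] in simp_all)

lemma s0_w: "1 \<le> u \<Longrightarrow> s0 \<star> w = w \<star> s0"
  by (rule sB_commute[OF n le0 carriers(1)])
    (use w_facts(4) affine_perm_mirror[OF w_affine, of 1] in simp_all)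

lemma s0_wi: "s0 \<star> wi = wi \<star> s0"
proof (rule sB_commute[OF n le0 carriers(4)])
  have 1: "aperm n wi 1 = 1" unfolding aperm_wi flip_def using w_facts(5) by simp
  then show "aperm n wi (int 0 + 1) = int 0 + 1" by simp
  show "aperm n wi (int 0) = int 0" using 1 affine_perm_mirror[OF affine_perm_aperm[OF n1 carriers(4)], of 1] by simp
qed

lemma s0_sn: "s0 \<star> sn = sn \<star> s0"
proof (rule sB_commute[OF n le0 carriers(3)])
  show "aperm n sn (int 0) = int 0" "aperm n sn (int 0 + 1) = int 0 + 1"
    using aperm_sB[OF n order.refl] end_swap_small(2)[OF n, of 0] end_swap_small(2)[OF n, of 1] n by simp_all
qed

lemma descents_w: "descents TB n (aperm n w) = {n - v}" "ngt TB n (aperm n w) (n - v) (n - v)"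
proof -
  have "ext_ngt TB n w" using w minimal_NGT_TB[OF n] by (auto simp: B_positive_NGT_def)
  then obtain i j where ng: "ngt TB n (aperm n w) i j" by (auto simp: ext_ngt_def)
  have "n - v \<in> descents TB n (aperm n w)" using w_facts(1,2,6,7) by (auto simp: descents_def node_simps)
  then have i: "i = n - v" using ng by (auto simp: ngt_def)
  have "finv (aperm n w) = aperm n w" using finv_eqI[OF w_affine] w_facts(3) by (metis comp_apply id_apply)
  then have "j = n - v" using ng i by (auto simp: ngt_def)
  then show "ngt TB n (aperm n w) (n - v) (n - v)" using ng i by simp
  then show "descents TB n (aperm n w) = {n - v}" by (simp add: ngt_def)
qed

lemma descents_wi: "descents TB n (aperm n wi) = {v}" "ngt TB n (aperm n wi) v v"
proof -
  have "n - (n - v) = v" using w_facts(2) by simp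
  then show "ngt TB n (aperm n wi) v v" using ngt_flip[OF w_affine descents_w(2)] by (simp add: aperm_wi)
  then show "descents TB n (aperm n wi) = {v}" by (simp add: ngt_def)
qed

lemma finv_self: "finv (aperm n w) = aperm n w" "finv (aperm n wi) = aperm n wi"
proof -
  show 1: "finv (aperm n w) = aperm n w" by (rule finv_eqI[OF w_affine]) (use fun_cong[OF w_facts(3)] in simp)
  show "finv (aperm n wi) = aperm n wi" unfolding aperm_wi finv_flip[OF w_affine] 1 ..
qed

lemmas wi_affine = affine_perm_aperm[OF n1 carriers(4)]

lemma ext_TC_w: "ext_ngt TC n w"
proof -
  have "2 \<le> n - v" using w_facts(2) by simp
  then have "ngt TC n (aperm n w) (n - v) (n - v)"
    using no_descent_at_fork(1)[OF n w_affine descents_w(1)] by (intro ngt_TB_D[OF _ n descents_w(2)]) (auto simp: finv_self)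
  then show ?thesis by (auto simp: ext_ngt_def)
qed

lemma ext_TC_wi: assumes "2 \<le> v" shows "ext_ngt TC n wi"
proof -
  have "ngt TC n (aperm n wi) v v"
    using no_descent_at_fork(1)[OF n wi_affine descents_wi(1) assms] by (intro ngt_TB_D[OF _ n descents_wi(2)]) (auto simp: finv_self)
  then show ?thesis by (auto simp: ext_ngt_def)
qed

lemma ext_TD_w: assumes "2 \<le> v" shows "ext_ngt TD n w"
proof -
  have "2 \<le> n - v" "n - v + 2 \<le> n" using w_facts(2) assms by simp_all
  then have "ngt TD n (aperm n w) (n - v) (n - v)"
    using no_descent_at_fork[OF n w_affine descents_w(1)] by (intro ngt_TB_D[OF _ n descents_w(2)]) (auto simp: finv_self)
  then show ?thesis by (auto simp: ext_ngt_def)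
qed

lemma ext_TD_wi: assumes "2 \<le> v" shows "ext_ngt TD n wi"
proof -
  have "ngt TD n (aperm n wi) v v"
    using no_descent_at_fork[OF n wi_affine descents_wi(1)] w_facts(2) assms by (intro ngt_TB_D[OF _ n descents_wi(2)]) (auto simp: finv_self)
  then show ?thesis by (auto simp: ext_ngt_def)
qed

text \<open>
  With one horizontal line at the bottom, the line above it is reflected past the bottom mirror. So both
  nodes of a fork at \<open>n\<close> are descents.
\<close>

lemma last_line: 
  assumes "v = 1" shows "aperm n w (int n - 1) > int n + 1"
proof -
  have "aperm n w (int n - 1) > int n" using w_facts(6) n1 assms by (simp add: of_nat_diff)
  moreover have "aperm n w (int n - 1) \<noteq> aperm n w (int n + 1)" using affine_perm_inj[OF w_affine] by simp
  moreover have "aperm n w (int n + 1) = int n + 1" using w_facts(5) affine_perm_reflect[OF w_affine, of 1 "int n"] by simp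
  ultimately show ?thesis by linarith
qed

text \<open>
  The image under \<open>\<iota>\<^sub>B\<close> has its descent at \<open>v\<close>. If \<open>v = 1\<close>, then both nodes of the fork at the top
  are descents.
\<close>

lemma v_ge_2_if_wi: assumes "X \<noteq> TB" "ext_ngt X n wi" shows "2 \<le> v"
proof (rule ccontr)
  assume "\<not> 2 \<le> v"
  then have v: "v = 1" using w_facts(1) by simp
  obtain i j where "ngt X n (aperm n wi) i j" using assms(2) by (auto simp: ext_ngt_def)
  then have d: "descents X n (aperm n wi) = {i}" by (simp add: ngt_def)
  have e: "aperm n wi 1 = 1" "aperm n wi 2 < 0" unfolding aperm_wi flip_def using w_facts(5) last_line[OF v] by (simp_all add: algebra_simps)
  have "aperm n wi (- 1) = 1 - aperm n wi 2" using affine_perm_mirror[OF wi_affine, of 2] by simp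
  then have "0 \<in> descents X n (aperm n wi)" "1 \<in> descents X n (aperm n wi)" using e assms(1) n by (auto simp: descents_def node_simps)
  then show False using d by auto
qed

lemma v_ge_2_if_w: assumes "ext_ngt TD n w" shows "2 \<le> v"
proof (rule ccontr)
  assume "\<not> 2 \<le> v"
  then have v: "v = 1" using w_facts(1) by simp
  obtain i j where "ngt TD n (aperm n w) i j" using assms by (auto simp: ext_ngt_def)
  then have d: "descents TD n (aperm n w) = {i}" by (simp add: ngt_def)
  have "aperm n w (int n + 1) = int n + 1" using w_facts(5) affine_perm_reflect[OF w_affine, of 1 "int n"] by simp
  then have "n \<in> descents TD n (aperm n w)" "n - 1 \<in> descents TD n (aperm n w)" 
    using last_line[OF v] w_facts(5) n by (auto simp: descents_def node_simps of_nat_diff)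
  then show False using d n by auto
qed

lemma top_parity:
  assumes "a \<in> carrier (W_aff n)" "b \<in> carrier (W_aff n)"
  shows "even (top_refls n (a \<star> b)) \<longleftrightarrow> (even (top_refls n a) \<longleftrightarrow> even (top_refls n b))"
  using refls_mult(1)[OF n assms] .

lemma bottom_parity:
  assumes "a \<in> carrier (W_aff n)" "b \<in> carrier (W_aff n)"
  shows "even (bottom_refls n (a \<star> b)) \<longleftrightarrow> (even (bottom_refls n a) \<longleftrightarrow> even (bottom_refls n b))"
  using refls_mult(2)[OF n assms] .

lemma end_parity: "\<not> even (top_refls n s0)" "even (top_refls n sn)" "even (bottom_refls n s0)" "\<not> even (bottom_refls n sn)"
  using refls_sB[OF n le0] refls_sB[OF n order.refl] n by auto

lemmas parities = top_parity bottom_parity end_parity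

text \<open>
  Of the four products of \<open>w\<close> with powers of \<open>s\<^sub>0\<close>, parity leaves the two that define \<open>w'\<close> and \<open>w''\<close>.
\<close>

lemma prime_elt_cases:
  "z \<in> double_coset n 0 w \<Longrightarrow> even (top_refls n z) \<Longrightarrow> z = prime_elt n w \<or> z = dprime_elt n w"
  by (auto simp: double_coset_def prime_elt_def dprime_elt_def iota_C_def parities)

lemma prime_elt_props:
  "prime_elt n w \<in> double_coset n 0 w" "dprime_elt n w \<in> double_coset n 0 w"
  "even (top_refls n (prime_elt n w))" "even (top_refls n (dprime_elt n w))"
  "even (bottom_refls n (prime_elt n w)) \<longleftrightarrow> even (bottom_refls n w)"
  "even (bottom_refls n (dprime_elt n w)) \<longleftrightarrow> even (bottom_refls n w)"
  by (auto simp: double_coset_def prime_elt_def dprime_elt_def iota_C_def parities)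

lemma star_elt_props:
  "star_elt n w \<in> double_coset n 0 wi" "even (top_refls n (star_elt n w))" 
  "even (bottom_refls n (star_elt n w)) \<longleftrightarrow> even (bottom_refls n wi)"
  by (auto simp: double_coset_def star_elt_def parities)

lemma s0_wi_s0: "s0 \<star> wi \<star> s0 = wi"
  using sB_cancel(1)[OF n le0 carriers(4)] by (simp add: s0_wi)

text \<open>
  As \<open>s\<^sub>0\<close> commutes with \<open>wi\<close>, the double coset collapses to two elements.
\<close>

lemma double_coset_wi: "z \<in> double_coset n 0 wi \<Longrightarrow> z = wi \<or> z = wi \<star> s0"
  using s0_wi_s0 by (auto simp: double_coset_def s0_wi)

lemma star_elt_cases:
  "z \<in> double_coset n 0 wi \<Longrightarrow> even (top_refls n z) \<Longrightarrow> z = star_elt n w"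
  using double_coset_wi[of z] by (auto simp: star_elt_def parities)

lemma sn_double_coset_w:
  assumes "z \<in> double_coset n 0 w" shows "sn \<star> z = z \<star> sn"
proof -
  have s: "sn \<star> (s0 \<star> a) = s0 \<star> (sn \<star> a)" if "a \<in> carrier (W_aff n)" for a
    using s0_sn that by (simp flip: W.m_assoc)
  have c: "sn \<star> (w \<star> a) = w \<star> (sn \<star> a)" if "a \<in> carrier (W_aff n)" for a
    using sn_w that by (simp flip: W.m_assoc)
  show ?thesis using assms unfolding double_coset_def
    by (elim insertE emptyE) (simp_all add: W.m_assoc s c sn_w s0_sn[symmetric])
qed

lemma star_square: "star_elt n w \<star> star_elt n w = \<one>\<^bsub>W_aff n\<^esub>" "star_elt n w \<in> carrier (W_aff n)"
proof -
  have "wi \<star> s0 \<star> (wi \<star> s0) = wi \<star> (s0 \<star> wi \<star> s0)" by (simp add: W.m_assoc)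
  then show "star_elt n w \<star> star_elt n w = \<one>\<^bsub>W_aff n\<^esub>" using wi_square s0_wi_s0 by (simp add: star_elt_def)
  show "star_elt n w \<in> carrier (W_aff n)" by (simp add: star_elt_def)
qed

lemma TC_converse:
  "(even (top_refls n w) \<longrightarrow> minimal_NGT TC n w \<and> minimal_NGT TC n (iota_C n w)) \<and>
   (even (top_refls n wi) \<longrightarrow>
     (2 \<le> v \<longrightarrow> minimal_NGT TC n wi) \<and> wi \<star> wi = \<one>\<^bsub>W_aff n\<^esub> \<and> iota_C n wi = wi) \<and>
   (odd (top_refls n w) \<longrightarrow> minimal_NGT TC n (w \<star> s0) \<and> minimal_NGT TC n (s0 \<star> w) \<and>
     s0 \<star> w = iota_C n (w \<star> s0) \<and> s0 \<star> w = inv\<^bsub>W_aff n\<^esub> (w \<star> s0) \<and>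
     (1 \<le> u \<longrightarrow> (\<exists>u2 v2 p2 t2 w2. B_positive_NGT n u2 v2 p2 t2 w2 \<and> s0 \<star> w = prime_elt n w2))) \<and>
   (odd (top_refls n wi) \<longrightarrow> wi \<star> s0 = s0 \<star> wi \<and> (2 \<le> v \<longrightarrow> minimal_NGT TC n (wi \<star> s0)))"
proof -
  have X: "rank_ok TC n" "end_node TC n 0" using rank_ok_TC[OF n] by (auto simp: end_node_def)
  have mw: "minimal_NGT TC n z" if "z \<in> double_coset n 0 w" "even (top_refls n z)" for z
    using ext_ngt_double_coset[OF X ext_TC_w that(1)] that(2) minimal_NGT_TC[OF n] by blast
  have mwi: "minimal_NGT TC n z" if "2 \<le> v" "z \<in> double_coset n 0 wi" "even (top_refls n z)" for z
    using ext_ngt_double_coset[OF X ext_TC_wi[OF that(1)] that(2)] that(3) minimal_NGT_TC[OF n] by blast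
  have i: "s0 \<star> w = iota_C n (w \<star> s0)"
    using sB_cancel(1)[OF n le0 W.m_closed[OF carriers(2,1)]] by (simp add: iota_C_def W.m_assoc)
  have "s0 \<star> w \<star> (w \<star> s0) = s0 \<star> (w \<star> w) \<star> s0" by (simp add: W.m_assoc)
  then have "s0 \<star> w \<star> (w \<star> s0) = \<one>\<^bsub>W_aff n\<^esub>" by (simp add: w_square squares)
  then have inv: "s0 \<star> w = inv\<^bsub>W_aff n\<^esub> (w \<star> s0)" using W.inv_equality[of "s0 \<star> w" "w \<star> s0"] by simp
  have p: "\<exists>u2 v2 p2 t2 w2. B_positive_NGT n u2 v2 p2 t2 w2 \<and> s0 \<star> w = prime_elt n w2"
    if "odd (top_refls n w)" "1 \<le> u"
  proof -
    have "s0 \<star> w = prime_elt n w" using s0_w[OF that(2)] that(1) by (simp add: prime_elt_def)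
    then show ?thesis using w by blast
  qed
  have 1: "minimal_NGT TC n w \<and> minimal_NGT TC n (iota_C n w)" if "even (top_refls n w)"
    using mw[of w] mw[of "iota_C n w"] that by (simp add: double_coset_def iota_C_def parities)
  have 2: "minimal_NGT TC n (w \<star> s0) \<and> minimal_NGT TC n (s0 \<star> w)" if "odd (top_refls n w)"
    using mw[of "w \<star> s0"] mw[of "s0 \<star> w"] that by (simp add: double_coset_def parities)
  have 3: "iota_C n wi = wi" using s0_wi_s0 by (simp add: iota_C_def)
  have 4: "2 \<le> v \<longrightarrow> minimal_NGT TC n wi" if "even (top_refls n wi)"
    using mwi[of wi] that by (simp add: double_coset_def)
  have 5: "2 \<le> v \<longrightarrow> minimal_NGT TC n (wi \<star> s0)" if "odd (top_refls n wi)"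
    using mwi[of "wi \<star> s0"] that by (simp add: double_coset_def parities)
  show ?thesis using 1 2 3 4 5 i inv p wi_square s0_wi[symmetric] by blast
qed

lemma TD_converse:
  assumes n4: "4 \<le> n" and v: "2 \<le> v"
  shows
  "(even (bottom_refls n w) \<longrightarrow> minimal_NGT TD n (prime_elt n w) \<and> minimal_NGT TD n (dprime_elt n w)) \<and>
   (even (bottom_refls n wi) \<longrightarrow> minimal_NGT TD n (star_elt n w)) \<and>
   (odd (bottom_refls n w) \<longrightarrow>
     sn \<star> prime_elt n w = prime_elt n w \<star> sn \<and> sn \<star> dprime_elt n w = dprime_elt n w \<star> sn \<and>
     minimal_NGT TD n (sn \<star> prime_elt n w) \<and> minimal_NGT TD n (sn \<star> dprime_elt n w)) \<and>
   (odd (bottom_refls n wi) \<longrightarrow>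
     minimal_NGT TD n (star_elt n w \<star> sn) \<and> minimal_NGT TD n (sn \<star> star_elt n w) \<and>
     sn \<star> star_elt n w = inv\<^bsub>W_aff n\<^esub> (star_elt n w \<star> sn))"
proof -
  have X: "rank_ok TD n" "end_node TD n 0" "end_node TD n n" using rank_ok_TD[OF n4] by (auto simp: end_node_def)
  have e: "ext_ngt TD n (prime_elt n w)" "ext_ngt TD n (dprime_elt n w)" "ext_ngt TD n (star_elt n w)"
    using ext_ngt_double_coset[OF X(1,2) ext_TD_w[OF v]] ext_ngt_double_coset[OF X(1,2) ext_TD_wi[OF v]]
      prime_elt_props(1,2) star_elt_props(1) by blast+
  then have c: "prime_elt n w \<in> carrier (W_aff n)" "dprime_elt n w \<in> carrier (W_aff n)" by (auto simp: ext_ngt_def)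
  note es = ext_ngt_sB[OF X(1,3)] and mTD = minimal_NGT_TD[OF n4]
  have "sn \<star> star_elt n w \<star> (star_elt n w \<star> sn) = sn \<star> (star_elt n w \<star> star_elt n w) \<star> sn"
    using star_square(2) by (simp add: W.m_assoc)
  then have "sn \<star> star_elt n w \<star> (star_elt n w \<star> sn) = \<one>\<^bsub>W_aff n\<^esub>" by (simp add: star_square(1) squares)
  then have iv: "sn \<star> star_elt n w = inv\<^bsub>W_aff n\<^esub> (star_elt n w \<star> sn)"
    using W.inv_equality[of "sn \<star> star_elt n w" "star_elt n w \<star> sn"] star_square(2) by simp
  have 1: "minimal_NGT TD n (prime_elt n w) \<and> minimal_NGT TD n (dprime_elt n w)" if "even (bottom_refls n w)"
    using e prime_elt_props that by (simp add: mTD)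
  have 2: "minimal_NGT TD n (star_elt n w)" if "even (bottom_refls n wi)"
    using e star_elt_props that by (simp add: mTD)
  have 3: "minimal_NGT TD n (sn \<star> prime_elt n w) \<and> minimal_NGT TD n (sn \<star> dprime_elt n w)"
    if "odd (bottom_refls n w)"
    using es(2)[OF e(1)] es(2)[OF e(2)] prime_elt_props that by (simp add: mTD parities c)
  have 4: "minimal_NGT TD n (star_elt n w \<star> sn) \<and> minimal_NGT TD n (sn \<star> star_elt n w)"
    if "odd (bottom_refls n wi)"
    using es(1)[OF e(3)] es(2)[OF e(3)] star_elt_props star_square(2) that by (simp add: mTD parities)
  show ?thesis
    using 1 2 3 4 iv sn_double_coset_w[OF prime_elt_props(1)] sn_double_coset_w[OF prime_elt_props(2)] by blast
qed

text \<open>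
  Here \<open>s\<^sub>n\<close> commutes with all the factors, so it contributes one factor or none, according to parity.
\<close>

lemma TD_from_w:
  assumes z: "z \<in> double_coset n n w" and x: "x \<in> double_coset n 0 z" 
    and even: "even (top_refls n x)" "even (bottom_refls n x)"
  shows "even (bottom_refls n w) \<and> (x = prime_elt n w \<or> x = dprime_elt n w) \<or>
    odd (bottom_refls n w) \<and> (x = sn \<star> prime_elt n w \<or> x = sn \<star> dprime_elt n w)"
proof -
  have "z = w \<or> z = sn \<star> w"
    using z sB_cancel(1)[OF n order.refl carriers(1)] by (auto simp: double_coset_def sn_w)
  then show ?thesis
  proof
    assume "z = w"
    then have xd: "x \<in> double_coset n 0 w" using x by simp
    then have "even (bottom_refls n w)" using even(2) by (auto simp: double_coset_def parities)
    then show ?thesis using prime_elt_cases[OF xd even(1)] by blast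
  next
    assume zs: "z = sn \<star> w"
    have s: "s0 \<star> (sn \<star> a) = sn \<star> (s0 \<star> a)" if "a \<in> carrier (W_aff n)" for a
      using s0_sn that by (simp flip: W.m_assoc)
    have "\<exists>x'\<in>double_coset n 0 w. x = sn \<star> x'"
      using x unfolding zs double_coset_def by (elim insertE emptyE) (simp_all add: W.m_assoc s)
    then obtain x' where x': "x' \<in> double_coset n 0 w" "x = sn \<star> x'" by blast
    then have c: "x' \<in> carrier (W_aff n)" using double_coset_sym(1)[OF n le0 carriers(1)] by blast
    have "even (top_refls n x')" "odd (bottom_refls n x')" using even x'(2) c by (simp_all add: parities)
    moreover from this have "odd (bottom_refls n w)" using x'(1) by (auto simp: double_coset_def parities)
    ultimately show ?thesis using prime_elt_cases[OF x'(1)] x'(2) by blast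
  qed
qed

text \<open>
  Here \<open>s\<^sub>0\<close> commutes with all the factors. The parity at the top fixes the power of \<open>s\<^sub>0\<close>, and what
  remains is the double coset of \<open>s\<^sub>n\<close> with four elements, divided by the parity at the bottom.
\<close>

lemma TD_from_wi:
  assumes z: "z \<in> double_coset n n wi" and x: "x \<in> double_coset n 0 z" 
    and even: "even (top_refls n x)" "even (bottom_refls n x)"
  shows "even (bottom_refls n wi) \<and> (x = star_elt n w \<or> x = sn \<star> star_elt n w \<star> sn) \<or>
    odd (bottom_refls n wi) \<and> (x = star_elt n w \<star> sn \<or> x = sn \<star> star_elt n w)"
proof -
  have s: "s0 \<star> (sn \<star> a) = sn \<star> (s0 \<star> a)" if "a \<in> carrier (W_aff n)" for a
    using s0_sn that by (simp flip: W.m_assoc)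
  have y: "s0 \<star> (wi \<star> a) = wi \<star> (s0 \<star> a)" if "a \<in> carrier (W_aff n)" for a
    using s0_wi that by (simp flip: W.m_assoc)
  have zc: "z \<in> carrier (W_aff n)" using double_coset_sym(1)[OF n order.refl carriers(4) z] .
  have sz: "s0 \<star> z = z \<star> s0"
    using z unfolding double_coset_def by (elim insertE emptyE) (simp_all add: W.m_assoc s y s0_wi s0_sn)
  have xz: "x = z \<or> x = z \<star> s0"
    using x sB_cancel(1)[OF n le0 zc] by (auto simp: double_coset_def sz)
  have tz: "even (top_refls n z) \<longleftrightarrow> even (top_refls n wi)"
    using z unfolding double_coset_def by (elim insertE emptyE) (simp_all add: parities)
  have xs: "x \<in> double_coset n n (star_elt n w)"
  proof (cases "even (top_refls n wi)")
    case True
    then have "x = z" using xz even(1) tz zc by (auto simp: parities)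
    then show ?thesis using z True by (simp add: star_elt_def)
  next
    case False
    then have "x = z \<star> s0" using xz even(1) tz by auto
    then show ?thesis using z False unfolding double_coset_def
      by (elim insertE emptyE) (simp_all add: star_elt_def W.m_assoc s0_sn)
  qed
  note sc = star_square(2)
  show ?thesis using xs even(2) star_elt_props(3) sc unfolding double_coset_def
    by (elim insertE emptyE) (simp_all add: parities)
qed

end

text \<open>
  The parity of \<open>x\<close> selects it in the double coset of its normal form.
\<close>

lemma TC_exists:
  assumes n: "3 \<le> n" and x: "minimal_NGT TC n x"
  shows "\<exists>u v p t w. B_positive_NGT n u v p t w \<and>
    (x = prime_elt n w \<or> x = dprime_elt n w \<or> (2 \<le> v \<and> x = star_elt n w))"
proof -
  obtain y where y: "ext_ngt TB n y" "ext_ngt TC n y" "x \<in> double_coset n 0 y" using TC_normal_form[OF n x] .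
  have ex: "even (top_refls n x)" using x minimal_NGT_TC[OF n] by blast
  obtain u v p t w where w: "B_positive_NGT n u v p t w" and yw: "y = w \<or> y = iota_B n w"
    using ext_ngt_TB_classification[OF n y(1)] by blast
  interpret B_positive_elt n u v p t w using n w by (rule B_positive_elt.intro)
  show ?thesis
    using yw
  proof
    assume "y = w"
    then show ?thesis using prime_elt_cases[OF _ ex] y(3) w by blast
  next
    assume "y = iota_B n w"
    then have "2 \<le> v" "x = star_elt n w" using v_ge_2_if_wi[of TC] star_elt_cases[OF _ ex] y(2,3) by auto
    then show ?thesis using w by blast
  qed
qed

lemma TD_exists:
  assumes n4: "4 \<le> n" and x: "minimal_NGT TD n x"
  shows "\<exists>u v p t w. B_positive_NGT n u v p t w \<and> 2 \<le> v \<and>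
             (even (bottom_refls n w) \<and> (x = prime_elt n w \<or> x = dprime_elt n w) \<or>
              odd (bottom_refls n w) \<and>
                (x = sB n n \<otimes>\<^bsub>W_aff n\<^esub> prime_elt n w \<or> x = sB n n \<otimes>\<^bsub>W_aff n\<^esub> dprime_elt n w) \<or>
              even (bottom_refls n (iota_B n w)) \<and>
                (x = star_elt n w \<or>
                 x = sB n n \<otimes>\<^bsub>W_aff n\<^esub> star_elt n w \<otimes>\<^bsub>W_aff n\<^esub> sB n n) \<or>
              odd (bottom_refls n (iota_B n w)) \<and>
                (x = star_elt n w \<otimes>\<^bsub>W_aff n\<^esub> sB n n \<or> x = sB n n \<otimes>\<^bsub>W_aff n\<^esub> star_elt n w))"
proof -
  have n: "3 \<le> n" using n4 by simp
  obtain y z where y: "ext_ngt TB n y" "ext_ngt TD n y" "z \<in> double_coset n n y" "x \<in> double_coset n 0 z" 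
    using TD_normal_form[OF n4 x] .
  have ex: "even (top_refls n x)" "even (bottom_refls n x)" using x minimal_NGT_TD[OF n4] by blast+
  obtain u v p t w where w: "B_positive_NGT n u v p t w" and yw: "y = w \<or> y = iota_B n w"
    using ext_ngt_TB_classification[OF n y(1)] by blast
  interpret B_positive_elt n u v p t w using n w by (rule B_positive_elt.intro)
  show ?thesis
    using yw
  proof
    assume yw: "y = w"
    then have "2 \<le> v" using v_ge_2_if_w y(2) by simp
    then show ?thesis using TD_from_w[of z x] y(3,4) ex yw w by blast
  next
    assume yw: "y = iota_B n w"
    then have "2 \<le> v" using v_ge_2_if_wi[of TD] y(2) by simp
    then show ?thesis using TD_from_wi[of z x] y(3,4) ex yw w by blast
  qed
qed

theorem theorem4p2:
  fixes n :: nat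
  shows
    "(3 \<le> n \<longrightarrow>
       (\<forall>x. minimal_NGT TC n x \<longrightarrow>
          (\<exists>u v p t w. B_positive_NGT n u v p t w \<and>
             (x = prime_elt n w \<or> x = dprime_elt n w \<or> (2 \<le> v \<and> x = star_elt n w)))) \<and>
       (\<forall>u v p t w. B_positive_NGT n u v p t w \<longrightarrow>
          (even (top_refls n w) \<longrightarrow>
             minimal_NGT TC n w \<and> minimal_NGT TC n (iota_C n w)) \<and>
          (even (top_refls n (iota_B n w)) \<longrightarrow>
             (2 \<le> v \<longrightarrow> minimal_NGT TC n (iota_B n w)) \<and>
             iota_B n w \<otimes>\<^bsub>W_aff n\<^esub> iota_B n w = \<one>\<^bsub>W_aff n\<^esub> \<and>
             iota_C n (iota_B n w) = iota_B n w) \<and>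
          (odd (top_refls n w) \<longrightarrow>
             minimal_NGT TC n (w \<otimes>\<^bsub>W_aff n\<^esub> sB n 0) \<and>
             minimal_NGT TC n (sB n 0 \<otimes>\<^bsub>W_aff n\<^esub> w) \<and>
             sB n 0 \<otimes>\<^bsub>W_aff n\<^esub> w = iota_C n (w \<otimes>\<^bsub>W_aff n\<^esub> sB n 0) \<and>
             sB n 0 \<otimes>\<^bsub>W_aff n\<^esub> w = inv\<^bsub>W_aff n\<^esub> (w \<otimes>\<^bsub>W_aff n\<^esub> sB n 0) \<and>
             (1 \<le> u \<longrightarrow> (\<exists>u2 v2 p2 t2 w2. B_positive_NGT n u2 v2 p2 t2 w2 \<and>
                sB n 0 \<otimes>\<^bsub>W_aff n\<^esub> w = prime_elt n w2))) \<and>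
          (odd (top_refls n (iota_B n w)) \<longrightarrow>
             iota_B n w \<otimes>\<^bsub>W_aff n\<^esub> sB n 0 = sB n 0 \<otimes>\<^bsub>W_aff n\<^esub> iota_B n w \<and>
             (2 \<le> v \<longrightarrow> minimal_NGT TC n (iota_B n w \<otimes>\<^bsub>W_aff n\<^esub> sB n 0))))) \<and>
     (4 \<le> n \<longrightarrow>
       (\<forall>x. minimal_NGT TD n x \<longrightarrow>
          (\<exists>u v p t w. B_positive_NGT n u v p t w \<and> 2 \<le> v \<and>
             (even (bottom_refls n w) \<and> (x = prime_elt n w \<or> x = dprime_elt n w) \<or>
              odd (bottom_refls n w) \<and>
                (x = sB n n \<otimes>\<^bsub>W_aff n\<^esub> prime_elt n w \<or> x = sB n n \<otimes>\<^bsub>W_aff n\<^esub> dprime_elt n w) \<or>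
              even (bottom_refls n (iota_B n w)) \<and>
                (x = star_elt n w \<or>
                 x = sB n n \<otimes>\<^bsub>W_aff n\<^esub> star_elt n w \<otimes>\<^bsub>W_aff n\<^esub> sB n n) \<or>
              odd (bottom_refls n (iota_B n w)) \<and>
                (x = star_elt n w \<otimes>\<^bsub>W_aff n\<^esub> sB n n \<or> x = sB n n \<otimes>\<^bsub>W_aff n\<^esub> star_elt n w)))) \<and>
       (\<forall>u v p t w. B_positive_NGT n u v p t w \<and> 2 \<le> v \<longrightarrow>
          (even (bottom_refls n w) \<longrightarrow>
             minimal_NGT TD n (prime_elt n w) \<and> minimal_NGT TD n (dprime_elt n w)) \<and>
          (even (bottom_refls n (iota_B n w)) \<longrightarrow> minimal_NGT TD n (star_elt n w)) \<and>
          (odd (bottom_refls n w) \<longrightarrow>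
             sB n n \<otimes>\<^bsub>W_aff n\<^esub> prime_elt n w = prime_elt n w \<otimes>\<^bsub>W_aff n\<^esub> sB n n \<and>
             sB n n \<otimes>\<^bsub>W_aff n\<^esub> dprime_elt n w = dprime_elt n w \<otimes>\<^bsub>W_aff n\<^esub> sB n n \<and>
             minimal_NGT TD n (sB n n \<otimes>\<^bsub>W_aff n\<^esub> prime_elt n w) \<and>
             minimal_NGT TD n (sB n n \<otimes>\<^bsub>W_aff n\<^esub> dprime_elt n w)) \<and>
          (odd (bottom_refls n (iota_B n w)) \<longrightarrow>
             minimal_NGT TD n (star_elt n w \<otimes>\<^bsub>W_aff n\<^esub> sB n n) \<and>
             minimal_NGT TD n (sB n n \<otimes>\<^bsub>W_aff n\<^esub> star_elt n w) \<and>
             sB n n \<otimes>\<^bsub>W_aff n\<^esub> star_elt n w =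
               inv\<^bsub>W_aff n\<^esub> (star_elt n w \<otimes>\<^bsub>W_aff n\<^esub> sB n n))))"
  by (intro conjI impI; intro allI impI;
      (erule (1) TC_exists TD_exists
       | (rule B_positive_elt.TC_converse, rule B_positive_elt.intro; assumption)
       | (elim conjE, rule B_positive_elt.TD_converse, rule B_positive_elt.intro; simp)))

end
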